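(* Let $d\ge 1$ and suppose that a complex-valued function $u \in W_2^2\big((0,\infty)\times\mathbb{T}^d\big)$ satisfies, for some constant $C$, $$|\Delta u(w,y)| \le C\,|u(w,y)| \quad\text{for almost all } (w,y)\in(0,\infty)\times\mathbb{T}^d.$$ 1) If $u(w,y) = O\big(e^{-N w^{4/3}}\big)$ for every $N>0$, then $u\equiv 0$. 2) If $d=1$ or $d=2$, and $u(w,y) = O\big(e^{-N w}\big)$ for every $N>0$, then $u\equiv 0$.
   Context: $\mathbb{T}^d = \mathbb{R}^d/(2\pi\mathbb{Z})^d$; $\Delta = \partial_w^2 + \sum_{j=1}^d\partial_{y_j}^2$. $W_2^2$ is the $L_2$-based Sobolev space of order 2. The $O$-bounds are as $w\to+\infty$, uniformly in $y\in\mathbb{T}^d$, with implied constant allowed to depend on $N$. *)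

theory Defs
  imports "HOL-Analysis.Analysis"
begin

text \<open>
  Functions on the half-cylinder \<open>(0,\<infinity>) \<times> (\<real> / 2\<pi>\<int>)\<^sup>d\<close> are represented by functions on
  \<open>real \<times> real ^ 'd\<close>, with \<open>d = CARD('d)\<close>, that are \<open>2\<pi>\<close>-periodic in each \<open>y\<close>-coordinate for
  \<open>w > 0\<close>; their values for \<open>w \<le> 0\<close> play no role. Integration over the half-cylinder is
  integration over the fundamental domain \<open>cyl_domain\<close>.
\<close>

definition half_space :: "(real \<times> (real ^ 'd)) set" where
  "half_space = {0<..} \<times> UNIV"

definition torus_cell :: "(real ^ 'd) set" where
  "torus_cell = {y. \<forall>j. 0 \<le> y $ j \<and> y $ j < 2 * pi}"

definition cyl_domain :: "(real \<times> (real ^ 'd)) set" where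
  "cyl_domain = {0<..} \<times> torus_cell"

definition cyl_function :: "(real \<times> (real ^ 'd) \<Rightarrow> complex) \<Rightarrow> bool" where
  "cyl_function u \<longleftrightarrow> (\<forall>w>0. \<forall>y j. u (w, y + axis j (2 * pi)) = u (w, y))"

primrec iter_partial ::
    "'a::real_normed_vector list \<Rightarrow> ('a \<Rightarrow> 'b::real_normed_vector) \<Rightarrow> 'a \<Rightarrow> 'b" where
  "iter_partial [] f = f"
| "iter_partial (b # bs) f = iter_partial bs (\<lambda>x. frechet_derivative f (at x) b)"

text \<open>On an open set \<open>S\<close> this is the class \<open>C\<^sup>\<infinity>\<close>.\<close>

definition smooth_on :: "'a::euclidean_space set \<Rightarrow> ('a \<Rightarrow> 'b::real_normed_vector) \<Rightarrow> bool" where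
  "smooth_on S f \<longleftrightarrow> (\<forall>bs. set bs \<subseteq> Basis \<longrightarrow> iter_partial bs f differentiable_on S)"

text \<open>Since the torus is compact, compact support in the open half-cylinder only restricts \<open>w\<close>.\<close>

definition test_function :: "(real \<times> (real ^ 'd) \<Rightarrow> complex) \<Rightarrow> bool" where
  "test_function \<phi> \<longleftrightarrow> cyl_function \<phi> \<and> smooth_on half_space \<phi> \<and>
     (\<exists>a b. 0 < a \<and> (\<forall>w>0. \<forall>y. \<phi> (w, y) \<noteq> 0 \<longrightarrow> a \<le> w \<and> w \<le> b))"

definition cyl_loc_integrable :: "(real \<times> (real ^ 'd) \<Rightarrow> complex) \<Rightarrow> bool" where
  "cyl_loc_integrable u \<longleftrightarrow> cyl_function u \<and>
     (\<forall>a b. 0 < a \<longrightarrow> integrable (lebesgue_on ({a..b} \<times> torus_cell)) u)"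

definition cyl_L2 :: "(real \<times> (real ^ 'd) \<Rightarrow> complex) \<Rightarrow> bool" where
  "cyl_L2 u \<longleftrightarrow> cyl_function u \<and> u \<in> borel_measurable (lebesgue_on cyl_domain) \<and>
     integrable (lebesgue_on cyl_domain) (\<lambda>z. (norm (u z))\<^sup>2)"

text \<open>
  A multi-index is given by the list \<open>bs\<close> of the coordinate directions (elements of \<open>Basis\<close>) in
  which one differentiates; its order is the length of the list.
\<close>

definition has_weak_deriv ::
    "(real \<times> (real ^ 'd)) list \<Rightarrow> (real \<times> (real ^ 'd) \<Rightarrow> complex) \<Rightarrow> (real \<times> (real ^ 'd) \<Rightarrow> complex) \<Rightarrow> bool"
  where
  "has_weak_deriv bs u v \<longleftrightarrow> cyl_loc_integrable u \<and> cyl_loc_integrable v \<and>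
     (\<forall>\<phi>. test_function \<phi> \<longrightarrow>
        integral\<^sup>L (lebesgue_on cyl_domain) (\<lambda>z. u z * iter_partial bs \<phi> z) =
        (-1) ^ length bs * integral\<^sup>L (lebesgue_on cyl_domain) (\<lambda>z. v z * \<phi> z))"

definition sobolev_W2 :: "nat \<Rightarrow> (real \<times> (real ^ 'd) \<Rightarrow> complex) set" where
  "sobolev_W2 k = {u. cyl_L2 u \<and>
     (\<forall>bs. set bs \<subseteq> Basis \<and> length bs \<le> k \<longrightarrow> (\<exists>v. cyl_L2 v \<and> has_weak_deriv bs u v))}"

text \<open>Weak derivatives are unique only up to null sets; \<open>weak_deriv\<close> picks a representative.\<close>

definition weak_deriv ::
    "(real \<times> (real ^ 'd)) list \<Rightarrow> (real \<times> (real ^ 'd) \<Rightarrow> complex) \<Rightarrow> real \<times> (real ^ 'd) \<Rightarrow> complex" where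
  "weak_deriv bs u = (SOME v. has_weak_deriv bs u v)"

definition dir_w :: "real \<times> (real ^ 'd)" where
  "dir_w = (1, 0)"

definition dir_y :: "'d \<Rightarrow> real \<times> (real ^ 'd)" where
  "dir_y j = (0, axis j 1)"

definition laplacian :: "(real \<times> (real ^ 'd) \<Rightarrow> complex) \<Rightarrow> real \<times> (real ^ 'd) \<Rightarrow> complex" where
  "laplacian u z =
     weak_deriv [dir_w, dir_w] u z + (\<Sum>j\<in>UNIV. weak_deriv [dir_y j, dir_y j] u z)"

text \<open>
  \<open>u(w,y) = O(g(w))\<close> as \<open>w \<rightarrow> +\<infinity>\<close>, uniformly in \<open>y\<close>. As elements of a Sobolev space are classes
  modulo null sets, the bound is required almost everywhere.
\<close>

definition cyl_bigo :: "(real \<times> (real ^ 'd) \<Rightarrow> complex) \<Rightarrow> (real \<Rightarrow> real) \<Rightarrow> bool" where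
  "cyl_bigo u g \<longleftrightarrow> (\<exists>K w0. AE z in lebesgue_on half_space.
     w0 \<le> fst z \<longrightarrow> norm (u z) \<le> K * \<bar>g (fst z)\<bar>)"

end

theory Submission
  imports Defs "HOL-Number_Theory.Residues" "HOL-Real_Asymp.Real_Asymp"
begin

text \<open>
  Expanding in Fourier series in \<open>y\<close>, the mode \<open>u\<^sub>k\<close> solves \<open>u\<^sub>k'' - \<mu>\<^sup>2 u\<^sub>k = f\<^sub>k\<close> with \<open>\<mu> = \<bar>k\<bar>\<close> and
  \<open>f = \<Delta> u\<close>. Factor the operator as \<open>(d/dw - \<mu>) (d/dw + \<mu>)\<close> and conjugate with \<open>exp \<phi>\<close>, where \<open>\<phi>\<close> is
  increasing and convex with derivatives \<open>P = \<phi>'\<close> and \<open>Q = \<phi>''\<close>. A kernel estimate for the first factor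
  and an energy estimate for the second give, with integrals over \<open>w \<ge> a\<close>,
  \<open>\<integral> W exp (2 \<phi>) \<bar>u\<^sub>k\<bar>\<^sup>2 \<le> \<integral> exp (2 \<phi>) \<bar>f\<^sub>k\<bar>\<^sup>2 + boundary terms\<close>, where
  \<open>W = (P + \<mu>)\<^sup>2 (P - \<mu>)\<^sup>2 + Q (P + \<mu>) (3 P - \<mu>)\<close>.

  Suppose \<open>W \<ge> C\<^sup>2 + 1\<close> for every frequency. Summing over \<open>k\<close> by Parseval and absorbing
  \<open>\<bar>f\<bar> \<le> C \<bar>u\<bar>\<close> leaves \<open>\<integral> exp (2 \<phi>) \<bar>u\<bar>\<^sup>2 \<le> K exp (2 \<phi> a)\<close> with \<open>K\<close> independent of the weight, and
  letting \<open>\<phi>\<close> grow through multiples \<open>\<phi> = \<tau> \<theta>\<close> forces \<open>u = 0\<close> beyond \<open>a\<close>. For \<open>\<theta> w = w powr (4/3)\<close> the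
  bound on \<open>W\<close> comes from convexity: where \<open>P\<close> is close to \<open>\<mu>\<close>, the term \<open>Q P\<^sup>2\<close>, of size \<open>\<tau>\<^sup>3\<close> uniformly in
  \<open>w\<close>, takes over. For \<open>\<theta> w = w\<close> there is no convexity, but in dimension one and two \<open>\<mu>\<^sup>2\<close> is a sum of two
  squares; these have arbitrarily long gaps, and one chooses \<open>\<tau>\<^sup>2\<close> in the middle of a gap.
\<close>

section \<open>Fourier series on the torus\<close>

text \<open>The exponent 4/3 comes from the convexity term: with \<phi> = \<tau> \<theta>, Q P^2 is
  \<tau>^3 / 3 times the derivative of \<theta>'^3, and the slowest growth that keeps this bounded
  below is \<theta>'^3 linear in w. The restriction to d \<le> 2 is arithmetic: every positive
  integer congruent to 1 mod 4 is a sum of three squares, so for d \<ge> 3 the values of \<mu>^2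
  leave no long gaps. The obstacle is the boundary term at w = a. For one mode it is of order
  \<mu>^3 |u_k(a)|^2, and it must be summed over all frequencies with a bound that does not see the
  weight. The second derivatives in y pay for it: \<open>Y\<close> = \<Delta>_y u is square
  integrable, so for almost every a the numbers \<mu>^4 |u_k(a)|^2 = |Y_k(a)|^2 are summable, and
  \<mu>^3 \<le> \<mu>^4 since \<mu> is 0 or at least 1. Hence the inequality is proved for almost
  every a > 0, and a good a is found in every interval. The decay of u makes all weighted integrals
  finite, so that boundary terms vanish along a sequence tending to infinity and C^2 times the left
  side may be subtracted.\<close>

definition fexp :: "int ^ 'd \<Rightarrow> real ^ 'd \<Rightarrow> complex" where
  "fexp k y = cis (\<Sum>j\<in>UNIV. of_int (k $ j) * y $ j)"

lemma norm_fexp [simp]: "norm (fexp k y) = 1"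
  by (simp add: fexp_def)

lemma fexp_0 [simp]: "fexp 0 y = 1"
  by (simp add: fexp_def)

lemma fexp_add: "fexp (k + l) y = fexp k y * fexp l y"
  by (simp add: fexp_def cis_mult sum.distrib distrib_right)

lemma cnj_fexp: "cnj (fexp k y) = fexp (- k) y"
  by (simp add: fexp_def cis_cnj sum_negf)

lemma continuous_on_fexp [continuous_intros]: "continuous_on A (fexp k)"
  unfolding fexp_def cis_conv_exp by (intro continuous_intros)

lemma borel_measurable_fexp [measurable]: "fexp k \<in> borel_measurable borel"
  by (intro borel_measurable_continuous_onI continuous_on_fexp)

lemma torus_cell_eq: "torus_cell = (\<Inter>j. {y. 0 \<le> y $ j} \<inter> {y. y $ j < 2 * pi})"
  by (auto simp: torus_cell_def)

lemma torus_cell_borel [measurable]: "torus_cell \<in> sets borel"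
  unfolding torus_cell_eq
  by (intro sets.countable_INT' countable_finite sets.Int borel_closed borel_open closed_Collect_le open_Collect_less continuous_intros) auto

text \<open>Fubini for products of one-variable functions. Lebesgue measure on the Euclidean space
  is the image of a product measure indexed by \<open>Basis\<close>, so coordinates are first
  reindexed along \<open>e j = axis j 1\<close>; then \<open>product_integral_prod\<close>
  applies.\<close>

lemma integral_vec_prod:
  fixes f :: "'d::finite \<Rightarrow> real \<Rightarrow> complex"
  assumes int: "\<And>j. integrable lborel (f j)"
  shows "(LINT y|(lborel::(real^'d) measure). (\<Prod>j\<in>UNIV. f j (y $ j))) = (\<Prod>j\<in>UNIV. LINT t|lborel. f j t)"
proof -
  interpret product_sigma_finite "\<lambda>_::real^'d. lborel :: real measure"
    by standard
  define e :: "'d \<Rightarrow> real^'d" where "e j = axis j 1" for j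
  have inj: "inj e"
    by (auto simp: e_def inj_on_def axis_eq_axis)
  have B: "(Basis :: (real^'d) set) = range e"
    by (auto simp: e_def Basis_vec_def)
  define g where "g b = f (inv_into UNIV e b)" for b
  have [measurable]: "f j \<in> borel_measurable borel" for j
    using int[of j] by simp
  have comp: "(\<Sum>b\<in>Basis. x b *\<^sub>R b) $ j = x (e j)" for x :: "real^'d \<Rightarrow> real" and j
  proof -
    have "(\<Sum>b\<in>Basis. x b *\<^sub>R b) $ j = (\<Sum>b\<in>Basis. x b *\<^sub>R b) \<bullet> e j"
      by (simp add: e_def inner_axis)
    also have "\<dots> = x (e j)"
    proof -
      have "e j \<in> Basis" unfolding B by blast
      then have "(\<Sum>b\<in>Basis. x b *\<^sub>R b) \<bullet> e j = (\<Sum>b\<in>Basis. if b = e j then x b else 0)"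
        unfolding inner_sum_left by (intro sum.cong) (auto simp: inner_Basis)
      also have "\<dots> = x (e j)" using \<open>e j \<in> Basis\<close> by simp
      finally show ?thesis .
    qed
    finally show ?thesis .
  qed
  have [measurable]: "(\<lambda>y::real^'d. y $ j) \<in> borel_measurable borel" for j
    by (intro borel_measurable_continuous_onI continuous_intros)
  have "(LINT y|(lborel::(real^'d) measure). (\<Prod>j\<in>UNIV. f j (y $ j))) =
     (LINT x|(\<Pi>\<^sub>M b\<in>(Basis::(real^'d) set). lborel). (\<Prod>j\<in>UNIV. f j (x (e j))))"
    by (subst lborel_eq, subst integral_distr) (simp_all add: comp del: sum_component vector_scaleR_component)
  also have "\<dots> = (LINT x|(\<Pi>\<^sub>M b\<in>(Basis::(real^'d) set). lborel). (\<Prod>b\<in>Basis. g b (x b)))"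
    unfolding B using inj by (simp add: prod.reindex g_def)
  also have "\<dots> = (\<Prod>b\<in>(Basis::(real^'d) set). integral\<^sup>L lborel (g b))"
    by (rule product_integral_prod) (auto simp: g_def int)
  also have "\<dots> = (\<Prod>j\<in>UNIV. LINT t|lborel. f j t)"
    unfolding B using inj by (simp add: prod.reindex g_def)
  finally show ?thesis .
qed

abbreviation cell_vol :: "'d::finite itself \<Rightarrow> real" where
  "cell_vol _ \<equiv> (2 * pi) ^ CARD('d)"

lemma integral_cis_period:
  "(LINT t|lborel. indicator {0..<2*pi} t *\<^sub>R cis (of_int m * t)) = (if m = 0 then complex_of_real (2 * pi) else 0)"
proof -
  have 1: "(LINT t|lborel. indicator {0..<2*pi} t *\<^sub>R cis (of_int m * t)) =
     (LINT t|lborel. indicator {0..2*pi} t *\<^sub>R cis (of_int m * t))"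
    by (rule integral_cong_AE, simp_all add: cis_conv_exp, use AE_lborel_singleton[of "2*pi"] in eventually_elim)
       (auto simp: indicator_def)
  show ?thesis
  proof (cases "m = 0")
    case True
    then show ?thesis unfolding 1
      by (simp add: measure_def scaleR_conv_of_real)
  next
    case False
    define F where "F t = cis (of_int m * t) / (\<i> * of_int m)" for t
    have "(LINT t|lborel. indicator {0..2*pi} t *\<^sub>R cis (of_int m * t)) = F (2*pi) - F 0"
    proof (rule integral_FTC_Icc)
      show "(F has_vector_derivative cis (of_int m * x)) (at x within {0..2*pi})" for x
      proof -
        have "((\<lambda>z. exp (\<i> * (of_int m * z)) / (\<i> * of_int m)) has_field_derivative exp (\<i> * (of_int m * of_real x))) (at (of_real x))"
        proof -
          have i: "- (\<i> * (e * \<i>)) = e" for e by (simp add: complex_eq_iff)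
          show ?thesis using False by (auto intro!: derivative_eq_intros simp: i)
        qed
        from has_vector_derivative_real_field[OF this] show ?thesis
          unfolding F_def cis_conv_exp by simp
      qed
      show "continuous_on {0..2*pi} (\<lambda>x. cis (of_int m * x))"
        unfolding cis_conv_exp by (intro continuous_intros)
    qed auto
    also have "\<dots> = 0"
    proof -
      have "cis (of_int m * (2 * pi)) = 1"
        using cis_multiple_2pi[of "of_int m"] by (simp add: mult.commute)
      then show ?thesis by (simp only: F_def mult_zero_right cis_zero diff_self)
    qed
    finally show ?thesis using 1 False by simp
  qed
qed

lemma integral_fexp:
  fixes k :: "int ^ 'd"
  shows "(LINT y|lborel. indicator torus_cell y *\<^sub>R fexp k y) = (if k = 0 then of_real (cell_vol TYPE('d)) else 0)"
proof -
  have "(LINT y|lborel. indicator torus_cell y *\<^sub>R fexp k y) =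
    (LINT y|lborel. (\<Prod>j\<in>UNIV. indicator {0..<2*pi} (y$j) *\<^sub>R cis (of_int (k$j) * y$j)))"
  proof (rule Bochner_Integration.integral_cong)
    fix y :: "real^'d"
    have "indicator torus_cell y = (\<Prod>j\<in>UNIV. indicator {0..<2*pi} (y$j) :: real)"
      by (auto simp: torus_cell_def indicator_def)
    moreover have "fexp k y = (\<Prod>j\<in>UNIV. cis (of_int (k$j) * y$j))"
      unfolding fexp_def cis_conv_exp by (simp add: sum_distrib_left exp_sum)
    ultimately show "indicator torus_cell y *\<^sub>R fexp k y = (\<Prod>j\<in>UNIV. indicator {0..<2*pi} (y$j) *\<^sub>R cis (of_int (k$j) * y$j))"
      by (simp add: scaleR_conv_of_real prod.distrib)
  qed auto
  also have "\<dots> = (\<Prod>j\<in>UNIV. LINT t|lborel. indicator {0..<2*pi} t *\<^sub>R cis (of_int (k$j) * t))"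
  proof (rule integral_vec_prod)
    fix j
    show "integrable lborel (\<lambda>t. indicator {0..<2*pi} t *\<^sub>R cis (of_int (k$j) * t))"
      by (rule integrableI_bounded_set_indicator[where B=1]) (auto simp: cis_conv_exp)
  qed
  also have "\<dots> = (\<Prod>j\<in>UNIV. if k$j = 0 then complex_of_real (2 * pi) else 0)"
    by (simp add: integral_cis_period)
  also have "\<dots> = (if k = 0 then of_real (cell_vol TYPE('d)) else 0)"
    by (auto simp: vec_eq_iff)
  finally show ?thesis .
qed


section \<open>Square-integrable functions on the cell and Bessel's inequality\<close>

text \<open>Functions are Borel on the whole space and vanish off the cell, so that integrals over
  the torus become plain \<open>lborel\<close> integrals.\<close>

definition cell_L2 :: "(real ^ 'd \<Rightarrow> complex) \<Rightarrow> bool" where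
  "cell_L2 g \<longleftrightarrow> g \<in> borel_measurable borel \<and> (\<forall>y. y \<notin> torus_cell \<longrightarrow> g y = 0) \<and>
     integrable lborel (\<lambda>y. (norm (g y))\<^sup>2)"

text \<open>Not normalised: the factor 1 / \<open>cell_vol\<close> is left out, which is why
  \<open>cell_vol\<close> multiplies the integral in Bessel's inequality and in Parseval's
  identity.\<close>

definition fcoef :: "(real ^ 'd \<Rightarrow> complex) \<Rightarrow> int ^ 'd \<Rightarrow> complex" where
  "fcoef g k = (LINT y|lborel. g y * fexp (- k) y)"

lemma emeasure_torus_cell_finite: "emeasure lborel (torus_cell :: (real^'d) set) < \<infinity>"
proof -
  have "(torus_cell :: (real^'d) set) \<subseteq> cbox 0 (\<chi> j. 2 * pi)"
    by (auto simp: torus_cell_def mem_box_cart less_imp_le)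
  then have "emeasure lborel (torus_cell :: (real^'d) set) \<le> emeasure lborel (cbox 0 (\<chi> j. 2 * pi) :: (real^'d) set)"
    by (intro emeasure_mono) auto
  also have "\<dots> < \<infinity>"
    by (simp add: emeasure_lborel_cbox_eq)
  finally show ?thesis .
qed

lemma integrable_cell_bounded:
  assumes "f \<in> borel_measurable borel" "\<And>y. norm (f y) \<le> B"
  shows "integrable lborel (\<lambda>y::real^'d. indicator torus_cell y *\<^sub>R (f y :: complex))"
  using assms emeasure_torus_cell_finite by (intro integrableI_bounded_set_indicator[where B=B]) auto

lemma integrable_torus_cell: "integrable lborel (indicator (torus_cell :: (real^'d) set) :: _ \<Rightarrow> real)"
  using emeasure_torus_cell_finite by (intro integrable_real_indicator) auto

lemma le_add_square_half: "(x::real) \<le> 1 + x\<^sup>2"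
  using zero_le_power2[of "x - 1/2"] by (simp add: power2_eq_square algebra_simps)

lemma cell_L2_integrable:
  fixes g :: "real ^ 'd \<Rightarrow> complex"
  assumes "cell_L2 g" shows "integrable lborel g"
proof (rule Bochner_Integration.integrable_bound)
  show "integrable lborel (\<lambda>y. indicator (torus_cell :: (real^'d) set) y + (norm (g y))\<^sup>2)"
    using assms by (intro Bochner_Integration.integrable_add integrable_torus_cell) (auto simp: cell_L2_def)
  show "AE y in lborel. norm (g y) \<le> norm (indicator torus_cell y + (norm (g y))\<^sup>2)"
    using assms le_add_square_half[of "norm (g _)"] by (intro AE_I2) (auto simp: cell_L2_def indicator_def)
qed (use assms in \<open>auto simp: cell_L2_def\<close>)

lemma cell_L2_integrable_mult_fexp:
  fixes g :: "real ^ 'd \<Rightarrow> complex"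
  assumes "cell_L2 g" shows "integrable lborel (\<lambda>y. g y * fexp k y)"
  by (rule Bochner_Integration.integrable_bound[OF cell_L2_integrable[OF assms]])
     (use assms in \<open>auto simp: cell_L2_def norm_mult\<close>)

lemma cmod_sq_diff_expand:
  fixes z p :: complex
  shows "of_real ((norm (z - p))\<^sup>2) = of_real ((norm z)\<^sup>2) - z * cnj p - cnj (z * cnj p) + p * cnj p"
  unfolding complex_norm_square by (simp add: algebra_simps)

text \<open>Completing the square in the coefficients: the distance to a trigonometric polynomial is
  smallest for \<open>a k = fcoef g k / V\<close>, and any other choice costs V times the squared
  coefficient error. The optimal choice gives Bessel's inequality; the formula for arbitrary
  \<open>a\<close> is what later converts density of trigonometric polynomials into Parseval's
  identity.\<close>

lemma fourier_projection_identity: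
  fixes g :: "real ^ 'd \<Rightarrow> complex"
  assumes g: "cell_L2 g" and K: "finite K"
  defines "V \<equiv> cell_vol TYPE('d)"
  shows "integrable lborel (\<lambda>y. (norm (g y - indicator torus_cell y *\<^sub>R (\<Sum>k\<in>K. a k * fexp k y)))\<^sup>2)" (is ?I)
    and "(LINT y|lborel. (norm (g y - indicator torus_cell y *\<^sub>R (\<Sum>k\<in>K. a k * fexp k y)))\<^sup>2) =
      (LINT y|lborel. (norm (g y))\<^sup>2) - (\<Sum>k\<in>K. (norm (fcoef g k))\<^sup>2) / V + V * (\<Sum>k\<in>K. (norm (a k - fcoef g k / V))\<^sup>2)"
      (is "?L = ?R")
proof -
  have V: "V > 0" unfolding V_def by simp
  \<comment> \<open>The squared modulus is expanded over the complex numbers, where it is a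
    polynomial in \<open>g\<close>, the exponentials and their conjugates, so each term can be
    integrated separately and orthogonality applies to the double sum.\<close>
  define G where "G y = of_real ((norm (g y))\<^sup>2) - (\<Sum>k\<in>K. cnj (a k) * (g y * fexp (-k) y))
     - (\<Sum>k\<in>K. a k * cnj (g y * fexp (-k) y))
     + (\<Sum>k\<in>K. \<Sum>l\<in>K. a k * cnj (a l) * (indicator torus_cell y *\<^sub>R fexp (k - l) y))" for y
  have eq: "of_real ((norm (g y - indicator torus_cell y *\<^sub>R (\<Sum>k\<in>K. a k * fexp k y)))\<^sup>2) = G y" for y
  proof (cases "y \<in> torus_cell")
    case True
    have 1: "g y * cnj (\<Sum>k\<in>K. a k * fexp k y) = (\<Sum>k\<in>K. cnj (a k) * (g y * fexp (-k) y))"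
      by (simp add: sum_distrib_left cnj_fexp mult_ac)
    have 2: "(\<Sum>k\<in>K. a k * fexp k y) * cnj (\<Sum>k\<in>K. a k * fexp k y) =
       (\<Sum>k\<in>K. \<Sum>l\<in>K. a k * cnj (a l) * fexp (k - l) y)"
      unfolding diff_conv_add_uminus fexp_add by (simp add: sum_product cnj_fexp mult_ac)
    have 3: "cnj (\<Sum>k\<in>K. cnj (a k) * (g y * fexp (-k) y)) = (\<Sum>k\<in>K. a k * cnj (g y * fexp (-k) y))"
      by simp
    show ?thesis
      using True unfolding G_def by (simp only: cmod_sq_diff_expand indicator_simps scaleR_one 1 2 3)
  next
    case False
    then show ?thesis using g by (simp add: G_def cell_L2_def)
  qed
  have int1: "integrable lborel (\<lambda>y. complex_of_real ((norm (g y))\<^sup>2))"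
    using g by (intro integrable_of_real) (auto simp: cell_L2_def)
  note int2 = cell_L2_integrable_mult_fexp[OF g]
  have int3: "integrable lborel (\<lambda>y. indicator torus_cell y *\<^sub>R fexp k y)" for k :: "int^'d"
    by (rule integrable_cell_bounded[where B=1]) auto
  have int4: "integrable lborel (\<lambda>y. cnj (g y * fexp k y))" for k
    using int2[of k] by (subst complex_integrable_cnj)
  have intG: "integrable lborel G"
    unfolding G_def
    by (intro Bochner_Integration.integrable_add Bochner_Integration.integrable_diff Bochner_Integration.integrable_sum
       integrable_mult_right int1 int2 int3 int4)
  have "integrable lborel (\<lambda>y. Re (G y))"
    using intG by (rule integrable_Re)
  then show ?I unfolding eq[symmetric] by simp
  have "complex_of_real ?L = (LINT y|lborel. G y)"
    unfolding eq[symmetric] by (rule integral_complex_of_real[symmetric])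
  also have "\<dots> = of_real (LINT y|lborel. (norm (g y))\<^sup>2) - (\<Sum>k\<in>K. cnj (a k) * fcoef g k)
     - (\<Sum>k\<in>K. a k * cnj (fcoef g k))
     + (\<Sum>k\<in>K. \<Sum>l\<in>K. a k * cnj (a l) * (if k = l then of_real V else 0))"
  proof -
    have i3: "(LINT y|lborel. indicator torus_cell y *\<^sub>R fexp (k - l) y) = (if k = l then of_real V else 0)" for k l :: "int^'d"
      unfolding integral_fexp V_def by simp
    have i4: "(LINT y|lborel. cnj (g y * fexp (-k) y)) = cnj (fcoef g k)" for k
      unfolding fcoef_def by (rule Bochner_Integration.integral_cnj)
    have I1: "integrable lborel (\<lambda>y. \<Sum>k\<in>K. cnj (a k) * (g y * fexp (-k) y))"
      by (intro Bochner_Integration.integrable_sum integrable_mult_right int2)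
    have I2: "integrable lborel (\<lambda>y. \<Sum>k\<in>K. a k * cnj (g y * fexp (-k) y))"
      by (intro Bochner_Integration.integrable_sum integrable_mult_right int4)
    have I3: "integrable lborel (\<lambda>y. \<Sum>k\<in>K. \<Sum>l\<in>K. a k * cnj (a l) * (indicator torus_cell y *\<^sub>R fexp (k - l) y))"
      by (intro Bochner_Integration.integrable_sum integrable_mult_right int3)
    have J1: "(LINT y|lborel. (\<Sum>k\<in>K. cnj (a k) * (g y * fexp (-k) y))) = (\<Sum>k\<in>K. cnj (a k) * fcoef g k)"
      by (subst Bochner_Integration.integral_sum)
        (intro integrable_mult_right int2, simp only: integral_mult_right_zero fcoef_def)
    have J2: "(LINT y|lborel. (\<Sum>k\<in>K. a k * cnj (g y * fexp (-k) y))) = (\<Sum>k\<in>K. a k * cnj (fcoef g k))"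
      by (subst Bochner_Integration.integral_sum)
        (intro integrable_mult_right int4, simp only: integral_mult_right_zero i4)
    have J3: "(LINT y|lborel. (\<Sum>k\<in>K. \<Sum>l\<in>K. a k * cnj (a l) * (indicator torus_cell y *\<^sub>R fexp (k - l) y))) =
       (\<Sum>k\<in>K. \<Sum>l\<in>K. a k * cnj (a l) * (if k = l then of_real V else 0))"
      by (simp only: Bochner_Integration.integral_sum Bochner_Integration.integrable_sum integrable_mult_right int3 integral_mult_right_zero i3)
    have J0: "(LINT y|lborel. complex_of_real ((norm (g y))\<^sup>2)) = of_real (LINT y|lborel. (norm (g y))\<^sup>2)"
      by (rule integral_complex_of_real)
    show ?thesis
      unfolding G_def Bochner_Integration.integral_add[OF Bochner_Integration.integrable_diff[OF Bochner_Integration.integrable_diff[OF int1 I1] I2] I3]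
        Bochner_Integration.integral_diff[OF Bochner_Integration.integrable_diff[OF int1 I1] I2] Bochner_Integration.integral_diff[OF int1 I1]
        J0 J1 J2 J3 ..
  qed
  also have "\<dots> = of_real (LINT y|lborel. (norm (g y))\<^sup>2) + (\<Sum>k\<in>K. of_real V * (a k * cnj (a k)) - cnj (a k) * fcoef g k - a k * cnj (fcoef g k))"
    using K by (simp add: sum_subtractf if_distrib[of "(*) _"] sum_distrib_left mult_ac cong: if_cong)
  also have "\<dots> = of_real (LINT y|lborel. (norm (g y))\<^sup>2) + (\<Sum>k\<in>K. of_real (V * (norm (a k - fcoef g k / V))\<^sup>2 - (norm (fcoef g k))\<^sup>2 / V))"
    (is "_ = _ + ?S")
  proof (intro arg_cong2[where f="(+)"] sum.cong refl)
    fix k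
    have "complex_of_real (V * (norm (a k - fcoef g k / V))\<^sup>2 - (norm (fcoef g k))\<^sup>2 / V) =
      of_real V * ((a k - fcoef g k / V) * cnj (a k - fcoef g k / V)) - (fcoef g k * cnj (fcoef g k)) / V"
      by (simp only: of_real_diff of_real_mult of_real_divide complex_norm_square)
    also have "\<dots> = of_real V * (a k * cnj (a k)) - cnj (a k) * fcoef g k - a k * cnj (fcoef g k)"
      using V by (simp add: field_simps)
    finally show "of_real V * (a k * cnj (a k)) - cnj (a k) * fcoef g k - a k * cnj (fcoef g k) =
      complex_of_real (V * (norm (a k - fcoef g k / V))\<^sup>2 - (norm (fcoef g k))\<^sup>2 / V)" by simp
  qed
  also have "\<dots> = of_real ?R"
    by (simp add: sum_subtractf sum_distrib_left sum_divide_distrib)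
  finally show "?L = ?R" unfolding of_real_eq_iff .
qed

corollary bessel:
  fixes g :: "real ^ 'd \<Rightarrow> complex"
  assumes g: "cell_L2 g" and K: "finite K"
  shows "(\<Sum>k\<in>K. (norm (fcoef g k))\<^sup>2) \<le> cell_vol TYPE('d) * (LINT y|lborel. (norm (g y))\<^sup>2)"
proof -
  have "0 \<le> (LINT y|lborel. (norm (g y - indicator torus_cell y *\<^sub>R (\<Sum>k\<in>K. (fcoef g k / cell_vol TYPE('d)) * fexp k y)))\<^sup>2)"
    by simp
  also note fourier_projection_identity(2)[OF g K]
  finally show ?thesis by (simp add: field_simps)
qed

section \<open>Density of trigonometric polynomials and Parseval's identity\<close>

text \<open>A closure under sums instead of an explicit coefficient family: stability under products
  is then a short rule induction, as Stone-Weierstrass requires, and \<open>trig_poly_repr\<close>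
  recovers coefficients when they are wanted.\<close>

inductive trig_poly :: "(real ^ 'd \<Rightarrow> complex) \<Rightarrow> bool" where
  monom: "trig_poly (\<lambda>y. c * fexp k y)"
| add: "trig_poly P \<Longrightarrow> trig_poly Q \<Longrightarrow> trig_poly (\<lambda>y. P y + Q y)"

lemma trig_poly_mult:
  assumes "trig_poly P" "trig_poly Q" shows "trig_poly (\<lambda>y. P y * Q y)"
  using assms(1)
proof induction
  case (monom c k)
  show ?case using assms(2)
  proof induction
    case (monom d l)
    have "(\<lambda>y. c * fexp k y * (d * fexp l y)) = (\<lambda>y. (c * d) * fexp (k + l) y)"
      by (simp add: fexp_add mult_ac)
    then show ?case by (metis trig_poly.monom)
  qed (simp add: trig_poly.add distrib_left)
qed (simp add: trig_poly.add distrib_right)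

lemma trig_poly_const: "trig_poly (\<lambda>y. c)"
  using trig_poly.monom[of c 0] by simp

lemma trig_poly_sum: "finite I \<Longrightarrow> (\<And>i. i \<in> I \<Longrightarrow> trig_poly (f i)) \<Longrightarrow> trig_poly (\<lambda>y. \<Sum>i\<in>I. f i y)"
  by (induction rule: finite_induct) (auto intro: trig_poly.add trig_poly_const)

lemma trig_poly_repr:
  assumes "trig_poly P"
  obtains K a where "finite K" "P = (\<lambda>y. \<Sum>k\<in>K. a k * fexp k y)"
  using assms
proof (induction arbitrary: thesis)
  case (monom c k)
  show ?case by (rule monom[of "{k}" "\<lambda>_. c"]) auto
next
  case (add P Q)
  obtain K a where 1: "finite K" "P = (\<lambda>y. \<Sum>k\<in>K. a k * fexp k y)" using add.IH(1) by blast
  obtain L b where 2: "finite L" "Q = (\<lambda>y. \<Sum>k\<in>L. b k * fexp k y)" using add.IH(2) by blast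
  let ?a = "\<lambda>k. if k \<in> K then a k else 0" and ?b = "\<lambda>k. if k \<in> L then b k else 0"
  have "P y = (\<Sum>k\<in>K \<union> L. ?a k * fexp k y)" "Q y = (\<Sum>k\<in>K \<union> L. ?b k * fexp k y)" for y
    unfolding 1(2) 2(2) using 1(1) 2(1) by (auto intro!: sum.mono_neutral_cong_left)
  then have "P y + Q y = (\<Sum>k\<in>K \<union> L. (?a k + ?b k) * fexp k y)" for y
    by (simp add: distrib_right sum.distrib)
  then show ?case using 1(1) 2(1) by (intro add.prems[of "K \<union> L" "\<lambda>k. ?a k + ?b k"]) auto
qed

text \<open>Realises the torus as a compact subset of a Euclidean space, where the polynomial form
  of Stone-Weierstrass is available; real polynomials in the ambient coordinates pull back to
  trigonometric polynomials.\<close>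

definition torus_map :: "real ^ 'd \<Rightarrow> complex ^ 'd" where
  "torus_map y = (\<chi> j. cis (y $ j))"

lemma continuous_on_torus_map: "continuous_on A torus_map"
  unfolding torus_map_def cis_conv_exp by (intro continuous_intros)

lemma fexp_axis: "fexp (axis j m) y = cis (of_int m * y $ j)"
proof -
  have "(\<Sum>i\<in>UNIV. of_int (axis j m $ i) * y $ i) = (\<Sum>i\<in>UNIV. if i = j then of_int m * y $ j else 0)"
    by (intro sum.cong) (auto simp: axis_def)
  then show ?thesis by (simp add: fexp_def)
qed

lemma trig_poly_Re_Im:
  "trig_poly (\<lambda>y. of_real (Re (torus_map y $ j)))" "trig_poly (\<lambda>y. of_real (Im (torus_map y $ j)))"
proof -
  have "(\<lambda>y. complex_of_real (Re (torus_map y $ j))) = (\<lambda>y. (1/2) * fexp (axis j 1) y + (1/2) * fexp (axis j (-1)) y)"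
    by (auto simp: fun_eq_iff torus_map_def fexp_axis complex_eq_iff)
  then show "trig_poly (\<lambda>y. of_real (Re (torus_map y $ j)))"
    by (simp only:) (intro trig_poly.add trig_poly.monom)
  have "(\<lambda>y. complex_of_real (Im (torus_map y $ j))) = (\<lambda>y. (-\<i>/2) * fexp (axis j 1) y + (\<i>/2) * fexp (axis j (-1)) y)"
    by (auto simp: fun_eq_iff torus_map_def fexp_axis complex_eq_iff)
  then show "trig_poly (\<lambda>y. of_real (Im (torus_map y $ j)))"
    by (simp only:) (intro trig_poly.add trig_poly.monom)
qed

lemma trig_poly_real_polynomial:
  fixes p :: "complex ^ 'd \<Rightarrow> real"
  assumes "real_polynomial_function p"
  shows "trig_poly (\<lambda>y. of_real (p (torus_map y)))"
  using assms
proof induction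
  case (linear f)
  interpret bounded_linear f by fact
  have *: "of_real (f (torus_map y)) = (\<Sum>b\<in>Basis. of_real (f b) * of_real (torus_map y \<bullet> b))" for y :: "real^'d"
  proof -
    have "f (torus_map y) = f (\<Sum>b\<in>Basis. (torus_map y \<bullet> b) *\<^sub>R b)"
      by (simp only: euclidean_representation)
    also have "\<dots> = (\<Sum>b\<in>Basis. f b * (torus_map y \<bullet> b))"
      by (simp only: sum scaleR real_scaleR_def mult.commute)
    finally show ?thesis by simp
  qed
  have "trig_poly (\<lambda>y. of_real (torus_map y \<bullet> b))" if b: "b \<in> Basis" for b :: "complex^'d"
  proof -
    obtain j c where "b = axis j c" "c \<in> Basis"
      using b by (auto simp: Basis_vec_def)
    then show ?thesis
      using trig_poly_Re_Im[of j] by (auto simp: inner_axis Basis_complex_def inner_complex_def)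
  qed
  then show ?case unfolding *
    by (intro trig_poly_sum trig_poly_mult trig_poly_const) auto
next
  case (const c)
  show ?case by (rule trig_poly_const)
qed (auto intro: trig_poly.add trig_poly_mult)

lemma compact_range_torus_map: "compact (torus_map ` cbox 0 (\<chi> j. 2 * pi))"
  by (intro compact_continuous_image continuous_on_torus_map compact_cbox)

text \<open>Density is recorded for one function at a time so that it can be carried from indicators
  to simple functions and from there to L2 limits.\<close>

definition trig_dense :: "(real ^ 'd \<Rightarrow> complex) \<Rightarrow> bool" where
  "trig_dense g \<longleftrightarrow> cell_L2 g \<and> (\<forall>\<epsilon>>0. \<exists>P. trig_poly P \<and>
     (LINT y|lborel. (norm (g y - indicator torus_cell y *\<^sub>R P y))\<^sup>2) < \<epsilon>)"

lemma cell_L2_trig_poly: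
  assumes "trig_poly P"
  shows "cell_L2 (\<lambda>y. indicator torus_cell y *\<^sub>R P y)"
proof -
  obtain K a where K: "finite K" "P = (\<lambda>y. \<Sum>k\<in>K. a k * fexp k y)"
    using trig_poly_repr[OF assms] by blast
  have [measurable]: "P \<in> borel_measurable borel"
    unfolding K by measurable
  have "cell_L2 (\<lambda>y. 0)" by (simp add: cell_L2_def)
  from fourier_projection_identity(1)[OF this K(1), of a] show ?thesis
    by (auto simp: cell_L2_def K(2))
qed

lemma norm_add_sq_le: "(norm (a + b :: 'a::real_normed_vector))\<^sup>2 \<le> 2 * (norm a)\<^sup>2 + 2 * (norm b)\<^sup>2"
proof -
  have "(norm (a + b))\<^sup>2 \<le> (norm a + norm b)\<^sup>2"
    by (intro power_mono norm_triangle_ineq) auto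
  also have "\<dots> \<le> 2 * (norm a)\<^sup>2 + 2 * (norm b)\<^sup>2"
    using zero_le_power2[of "norm a - norm b"] by (simp add: power2_eq_square algebra_simps)
  finally show ?thesis .
qed

lemma cell_L2_add:
  assumes "cell_L2 f" "cell_L2 g"
  shows "cell_L2 (\<lambda>y. f y + g y)"
    and "(LINT y|lborel. (norm (f y + g y))\<^sup>2) \<le> 2 * (LINT y|lborel. (norm (f y))\<^sup>2) + 2 * (LINT y|lborel. (norm (g y))\<^sup>2)"
proof -
  have [measurable]: "f \<in> borel_measurable borel" "g \<in> borel_measurable borel"
    using assms by (auto simp: cell_L2_def)
  have i: "integrable lborel (\<lambda>y. 2 * (norm (f y))\<^sup>2 + 2 * (norm (g y))\<^sup>2)"
    using assms by (auto simp: cell_L2_def)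
  have i2: "integrable lborel (\<lambda>y. (norm (f y + g y))\<^sup>2)"
    by (rule Bochner_Integration.integrable_bound[OF i]) (use norm_add_sq_le in auto)
  then show "cell_L2 (\<lambda>y. f y + g y)"
    using assms by (auto simp: cell_L2_def)
  have "(LINT y|lborel. (norm (f y + g y))\<^sup>2) \<le> (LINT y|lborel. 2 * (norm (f y))\<^sup>2 + 2 * (norm (g y))\<^sup>2)"
    by (rule integral_mono[OF i2 i]) (rule norm_add_sq_le)
  also have "\<dots> = 2 * (LINT y|lborel. (norm (f y))\<^sup>2) + 2 * (LINT y|lborel. (norm (g y))\<^sup>2)"
    using assms by (simp add: cell_L2_def)
  finally show "(LINT y|lborel. (norm (f y + g y))\<^sup>2) \<le> 2 * (LINT y|lborel. (norm (f y))\<^sup>2) + 2 * (LINT y|lborel. (norm (g y))\<^sup>2)" .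
qed

lemma cell_L2_scale: "cell_L2 f \<Longrightarrow> cell_L2 (\<lambda>y. c * f y)"
  by (auto simp: cell_L2_def norm_mult power_mult_distrib)

lemma cell_L2_diff: "cell_L2 f \<Longrightarrow> cell_L2 g \<Longrightarrow> cell_L2 (\<lambda>y. f y - g y)"
  using cell_L2_add(1)[of f "\<lambda>y. - 1 * g y"] cell_L2_scale[of g "-1"] by simp

lemma trig_dense_limit:
  assumes g: "cell_L2 g"
    and h: "\<And>\<epsilon>. \<epsilon> > 0 \<Longrightarrow> \<exists>h. trig_dense h \<and> (LINT y|lborel. (norm (g y - h y))\<^sup>2) < \<epsilon>"
  shows "trig_dense g"
  unfolding trig_dense_def
proof (intro conjI allI impI g)
  fix \<epsilon> :: real assume \<epsilon>: "\<epsilon> > 0"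
  obtain h where h: "trig_dense h" "(LINT y|lborel. (norm (g y - h y))\<^sup>2) < \<epsilon>/4"
    using h[of "\<epsilon>/4"] \<epsilon> by auto
  obtain P where P: "trig_poly P" "(LINT y|lborel. (norm (h y - indicator torus_cell y *\<^sub>R P y))\<^sup>2) < \<epsilon>/4"
    using h(1) \<epsilon> unfolding trig_dense_def by (meson divide_pos_pos zero_less_numeral)
  have "(LINT y|lborel. (norm ((g y - h y) + (h y - indicator torus_cell y *\<^sub>R P y)))\<^sup>2) < \<epsilon>"
    by (rule le_less_trans[OF cell_L2_add(2)])
      (use h P g in \<open>auto intro!: cell_L2_diff cell_L2_trig_poly simp: trig_dense_def\<close>)
  then show "\<exists>P. trig_poly P \<and> (LINT y|lborel. (norm (g y - indicator torus_cell y *\<^sub>R P y))\<^sup>2) < \<epsilon>"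
    using P(1) by auto
qed

lemma trig_dense_add:
  assumes f: "trig_dense f" and g: "trig_dense g"
  shows "trig_dense (\<lambda>y. f y + g y)"
  unfolding trig_dense_def
proof (intro conjI allI impI)
  show "cell_L2 (\<lambda>y. f y + g y)" using f g by (intro cell_L2_add) (auto simp: trig_dense_def)
  fix \<epsilon> :: real assume \<epsilon>: "\<epsilon> > 0"
  obtain P where P: "trig_poly P" "(LINT y|lborel. (norm (f y - indicator torus_cell y *\<^sub>R P y))\<^sup>2) < \<epsilon>/4"
    using f \<epsilon> unfolding trig_dense_def by (meson divide_pos_pos zero_less_numeral)
  obtain Q where Q: "trig_poly Q" "(LINT y|lborel. (norm (g y - indicator torus_cell y *\<^sub>R Q y))\<^sup>2) < \<epsilon>/4"
    using g \<epsilon> unfolding trig_dense_def by (meson divide_pos_pos zero_less_numeral)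
  have "(LINT y|lborel. (norm ((f y - indicator torus_cell y *\<^sub>R P y) + (g y - indicator torus_cell y *\<^sub>R Q y)))\<^sup>2) < \<epsilon>"
    by (rule le_less_trans[OF cell_L2_add(2)])
      (use f g P Q in \<open>auto intro!: cell_L2_diff cell_L2_trig_poly simp: trig_dense_def\<close>)
  moreover have "(f y - indicator torus_cell y *\<^sub>R P y) + (g y - indicator torus_cell y *\<^sub>R Q y) =
    f y + g y - indicator torus_cell y *\<^sub>R (P y + Q y)" for y
    by (simp add: algebra_simps)
  ultimately show "\<exists>P. trig_poly P \<and> (LINT y|lborel. (norm (f y + g y - indicator torus_cell y *\<^sub>R P y))\<^sup>2) < \<epsilon>"
    using trig_poly.add[OF P(1) Q(1)] by auto
qed

lemma trig_dense_scale:
  assumes f: "trig_dense f" 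
  shows "trig_dense (\<lambda>y. c * f y)"
  unfolding trig_dense_def
proof (intro conjI allI impI)
  show "cell_L2 (\<lambda>y. c * f y)" using f by (intro cell_L2_scale) (auto simp: trig_dense_def)
  fix \<epsilon> :: real assume \<epsilon>: "\<epsilon> > 0"
  have c: "(norm c)\<^sup>2 + 1 > 0" by (simp add: add_nonneg_pos)
  obtain P where P: "trig_poly P" "(LINT y|lborel. (norm (f y - indicator torus_cell y *\<^sub>R P y))\<^sup>2) < \<epsilon> / ((norm c)\<^sup>2 + 1)" (is "?I < _")
    using f \<epsilon> c unfolding trig_dense_def by (meson divide_pos_pos)
  have "norm (c * f y - indicator torus_cell y *\<^sub>R (c * P y)) = norm c * norm (f y - indicator torus_cell y *\<^sub>R P y)" for y
    unfolding norm_mult[symmetric] by (simp add: algebra_simps)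
  then have "(LINT y|lborel. (norm (c * f y - indicator torus_cell y *\<^sub>R (c * P y)))\<^sup>2) = (norm c)\<^sup>2 * ?I"
    by (simp add: power_mult_distrib)
  also have "\<dots> \<le> ((norm c)\<^sup>2 + 1) * ?I" by (intro mult_right_mono) auto
  also have "\<dots> < \<epsilon>" using P(2) c by (simp add: field_simps)
  finally show "\<exists>P. trig_poly P \<and> (LINT y|lborel. (norm (c * f y - indicator torus_cell y *\<^sub>R P y))\<^sup>2) < \<epsilon>"
    using trig_poly_mult[OF trig_poly_const P(1)] by blast
qed

lemma trig_dense_sum:
  assumes "finite I" "\<And>i. i \<in> I \<Longrightarrow> trig_dense (f i)"
  shows "trig_dense (\<lambda>y. \<Sum>i\<in>I. f i y)"
  using assms
proof (induction rule: finite_induct)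
  case empty
  have "cell_L2 (\<lambda>y. 0)" by (simp add: cell_L2_def)
  then show ?case
    unfolding trig_dense_def by (auto intro!: exI[of _ "\<lambda>y. 0"] trig_poly_const)
qed (auto intro: trig_dense_add)

text \<open>The hypotheses are asymmetric because \<open>torus_map\<close> glues opposite faces of
  the closed cube; injectivity survives when one of the two points is interior.\<close>

lemma torus_map_eq_imp_eq:
  assumes eq: "torus_map x = torus_map y" and x: "x \<in> box 0 (\<chi> j. 2 * pi)" and y: "y \<in> cbox 0 (\<chi> j. 2 * pi)"
  shows "x = y"
proof (rule vec_eq_iff[THEN iffD2], rule allI)
  fix j
  have "cis (x $ j) = cis (y $ j)" using eq by (simp add: torus_map_def vec_eq_iff)
  then have "cis (x $ j - y $ j) = 1" by (simp add: cis_divide[symmetric])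
  then have "cos (x $ j - y $ j) = 1" by (metis cis.simps(1) one_complex.simps(1))
  then obtain n :: int where n: "x $ j - y $ j = n * 2 * pi" by (auto simp: cos_one_2pi_int)
  have n': "real_of_int n * (2 * pi) = x $ j - y $ j" by (simp add: n)
  have b: "0 < x $ j" "x $ j < 2 * pi" "0 \<le> y $ j" "y $ j \<le> 2 * pi"
    using x y by (auto simp: mem_box_cart)
  have "real_of_int n * (2 * pi) < 1 * (2 * pi)" "(-1) * (2 * pi) < real_of_int n * (2 * pi)"
    unfolding n' using b by auto
  then have "real_of_int n < 1" "-1 < real_of_int n"
    using mult_less_cancel_right_pos[of "2 * pi" "real_of_int n" 1] mult_less_cancel_right_pos[of "2 * pi" "-1" "real_of_int n"]
    by auto
  then have "n = 0" by linarith
  then show "x $ j = y $ j" using n by simp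
qed

text \<open>Regularity squeezes the set between a compact \<open>K\<close> and an open
  \<open>U'\<close> with small difference \<open>D\<close>. The images of \<open>K\<close> and of
  the rest of the closed cube under \<open>torus_map\<close> are disjoint and compact, so Urysohn
  gives a continuous function on the torus that equals the indicator off \<open>D\<close>, and
  Stone-Weierstrass replaces it by a polynomial.\<close>

lemma trig_dense_indicator:
  fixes A :: "(real ^ 'd) set"
  assumes A: "A \<in> sets borel" "A \<subseteq> torus_cell"
  shows "trig_dense (\<lambda>y. indicator A y)"
  unfolding trig_dense_def
proof (intro conjI allI impI)
  have finA: "emeasure lborel A < \<infinity>"
    using A emeasure_mono[OF A(2), of lborel] emeasure_torus_cell_finite[where 'd='d] by (auto intro: le_less_trans)
  have eqA: "(norm (indicator A y :: complex))\<^sup>2 = indicator A y" for y by (auto simp: indicator_def)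
  show "cell_L2 (indicator A)"
    unfolding cell_L2_def eqA
  proof (intro conjI allI impI)
    show "integrable lborel (\<lambda>y. indicator A y :: real)"
      using A finA by (intro integrable_real_indicator) auto
    show "indicator A y = (0::complex)" if "y \<notin> torus_cell" for y
      using that A by (auto simp: indicator_def)
  qed (use A in auto)
  fix \<epsilon> :: real assume \<epsilon>: "\<epsilon> > 0"
  define V where "V = measure lborel (torus_cell :: (real^'d) set)"
  have V: "V \<ge> 0" by (simp add: V_def)
  let ?B = "box 0 (\<chi> j. 2 * pi) :: (real^'d) set" and ?Q = "cbox 0 (\<chi> j. 2 * pi) :: (real^'d) set"
  have cQ: "torus_cell \<subseteq> ?Q" and Bc: "?B \<subseteq> torus_cell" 
    by (auto simp: torus_cell_def mem_box_cart less_imp_le)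
  \<comment> \<open>Discarding the faces of the cube changes \<open>A\<close> by a null set only.
    Points on a face are identified with points of the opposite face, which would destroy the
    disjointness needed for Urysohn.\<close>
  define A' where "A' = A \<inter> ?B"
  have A': "A' \<in> sets lebesgue" "A' \<in> sets borel" using A by (auto simp: A'_def)
  have \<epsilon>8: "\<epsilon> / 32 > 0" using \<epsilon> by simp
  obtain K where K: "closed K" "K \<subseteq> A'" "A' - K \<in> lmeasurable" "emeasure lebesgue (A' - K) < ennreal (\<epsilon>/32)"
    using sets_lebesgue_inner_closed[OF A'(1) \<epsilon>8] by blast
  obtain U where U: "open U" "A' \<subseteq> U" "U - A' \<in> lmeasurable" "emeasure lebesgue (U - A') < ennreal (\<epsilon>/32)"
    using sets_lebesgue_outer_open[OF A'(1) \<epsilon>8] by blast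
  define U' where "U' = U \<inter> ?B"
  have U': "open U'" "A' \<subseteq> U'" using U by (auto simp: U'_def A'_def)
  have "compact K" using K(1,2) bounded_subset[OF bounded_box] unfolding compact_eq_bounded_closed A'_def by blast
  define D where "D = U' - K"
  have D [measurable]: "D \<in> sets borel" using U' K unfolding D_def by auto
  have "D \<subseteq> (U - A') \<union> (A' - K)" by (auto simp: D_def U'_def)
  then have "emeasure lebesgue D \<le> emeasure lebesgue ((U - A') \<union> (A' - K))"
    using U(3) K(3) by (intro emeasure_mono) auto
  also have "\<dots> \<le> emeasure lebesgue (U - A') + emeasure lebesgue (A' - K)"
    using U(3) K(3) by (intro emeasure_subadditive) auto
  also have "\<dots> < ennreal (\<epsilon>/32) + ennreal (\<epsilon>/32)"
    using U(4) K(4) by (intro add_strict_mono)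
  also have "\<dots> = ennreal (\<epsilon>/16)" using \<epsilon> by (simp flip: ennreal_plus)
  finally have emD: "emeasure lborel D < ennreal (\<epsilon>/16)" by simp
  then have mD: "measure lborel D < \<epsilon>/16"
    using \<epsilon> by (metis emeasure_eq_ennreal_measure ennreal_less_iff ennreal_less_top measure_nonneg order.strict_trans top.not_eq_extremum)
  let ?T = "torus_map ` ?Q"
  have cS1: "compact (torus_map ` K)"
    using \<open>compact K\<close> by (intro compact_continuous_image continuous_on_torus_map)
  have cS2: "compact (torus_map ` (?Q - U'))"
    using U'(1) by (intro compact_continuous_image continuous_on_torus_map compact_diff) auto
  have KB: "K \<subseteq> ?B" "K \<subseteq> U'" using K(2) U'(2) by (auto simp: A'_def)
  have BQ: "?B \<subseteq> ?Q" by (rule box_subset_cbox)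
  have disj: "torus_map ` K \<inter> torus_map ` (?Q - U') = {}"
  proof (rule ccontr)
    assume "\<not> ?thesis"
    then obtain x y where xy: "x \<in> K" "y \<in> ?Q - U'" "torus_map x = torus_map y" by auto
    then have "x = y" using KB by (intro torus_map_eq_imp_eq) auto
    then show False using xy KB by auto
  qed
  have cl: "closedin (top_of_set ?T) (torus_map ` K)" "closedin (top_of_set ?T) (torus_map ` (?Q - U'))"
  proof -
    have "torus_map ` K \<subseteq> ?T" using KB BQ by (intro image_mono) (rule order_trans)
    then show "closedin (top_of_set ?T) (torus_map ` K)" by (intro closed_subset compact_imp_closed cS1)
    have "torus_map ` (?Q - U') \<subseteq> ?T" by (intro image_mono Diff_subset)
    then show "closedin (top_of_set ?T) (torus_map ` (?Q - U'))" by (intro closed_subset compact_imp_closed cS2)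
  qed
  obtain F :: "complex^'d \<Rightarrow> real" where F: "continuous_on ?T F" "\<And>z. z \<in> ?T \<Longrightarrow> F z \<in> closed_segment 1 0"
     "\<And>z. z \<in> torus_map ` K \<Longrightarrow> F z = 1" "\<And>z. z \<in> torus_map ` (?Q - U') \<Longrightarrow> F z = 0"
    using Urysohn_local[OF cl disj, where a=1 and b=0] by metis
  \<comment> \<open>With \<delta> \<le> 1 the squared error is at most \<delta> off \<open>D\<close>
    and at most 2^2 on \<open>D\<close>. Since \<open>D\<close> has measure below \<epsilon>/16, the
    second bound in the minimum makes both contributions at most \<epsilon>/4.\<close>
  define \<delta> where "\<delta> = min 1 (\<epsilon> / (4 * (V + 1)))"
  have \<delta>: "\<delta> > 0" "\<delta> \<le> 1" "\<delta> \<le> \<epsilon> / (4 * (V + 1))" using \<epsilon> V by (auto simp: \<delta>_def)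
  obtain p where p: "real_polynomial_function p" "\<And>z. z \<in> ?T \<Longrightarrow> \<bar>F z - p z\<bar> < \<delta>"
    using Stone_Weierstrass_real_polynomial_function[OF compact_range_torus_map F(1) \<delta>(1)] by blast
  define P where "P y = complex_of_real (p (torus_map y))" for y
  have tP: "trig_poly P" unfolding P_def by (rule trig_poly_real_polynomial[OF p(1)])
  have L2: "cell_L2 (\<lambda>y. indicator A y - indicator torus_cell y *\<^sub>R P y)"
    by (intro cell_L2_diff cell_L2_trig_poly tP) fact
  have bnd: "(norm (indicator A y - indicator torus_cell y *\<^sub>R P y))\<^sup>2 \<le> 4 * indicator D y + \<delta> * indicator torus_cell y"
    if yB: "y \<notin> ?Q - ?B" for y
  proof (cases "y \<in> ?B")
    case False
    then have "y \<notin> torus_cell" "y \<notin> A" using yB cQ A(2) by auto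
    then show ?thesis by simp
  next
    case True
    then have yc: "y \<in> torus_cell" "y \<in> ?Q" "torus_map y \<in> ?T" using Bc BQ by auto
    have eq: "norm (indicator A y - indicator torus_cell y *\<^sub>R P y) = \<bar>indicator A y - p (torus_map y)\<bar>"
    proof -
      have "indicator A y - indicator torus_cell y *\<^sub>R P y = complex_of_real (indicator A y - p (torus_map y))"
        using yc by (simp add: P_def indicator_def)
      then show ?thesis by (simp only: norm_of_real)
    qed
    have F01: "0 \<le> F (torus_map y)" "F (torus_map y) \<le> 1"
      using F(2)[OF yc(3)] by (auto simp: closed_segment_eq_real_ivl)
    have pF: "\<bar>F (torus_map y) - p (torus_map y)\<bar> < \<delta>" using p(2)[OF yc(3)] .
    show ?thesis
    proof (cases "y \<in> D")
      case True
      have "\<bar>indicator A y - p (torus_map y)\<bar> \<le> 2"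
        using pF F01 \<delta> by (auto simp: indicator_def)
      then have "\<bar>indicator A y - p (torus_map y)\<bar>\<^sup>2 \<le> 2\<^sup>2" by (intro power_mono) auto
      then show ?thesis unfolding eq using True \<delta> by (auto simp: indicator_def)
    next
      case False
      have "indicator A y = F (torus_map y)"
      proof (cases "y \<in> K")
        case True
        then show ?thesis using F(3) K(2) by (auto simp: A'_def indicator_def)
      next
        case False
        with \<open>y \<notin> D\<close> have "y \<notin> U'" by (auto simp: D_def)
        then have "y \<notin> A" using U'(2) \<open>y \<in> ?B\<close> by (auto simp: A'_def)
        then show ?thesis using F(4) \<open>y \<notin> U'\<close> yc by (auto simp: indicator_def)
      qed
      then have l: "\<bar>indicator A y - p (torus_map y)\<bar> < \<delta>" using pF by simp
      have "\<bar>indicator A y - p (torus_map y)\<bar>\<^sup>2 \<le> \<delta> * 1"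
        unfolding power2_eq_square using l \<delta> by (intro mult_mono) auto
      then show ?thesis unfolding eq using yc False by (simp add: indicator_def)
    qed
  qed
  have "(?Q - ?B) \<in> null_sets lborel"
    using negligible_frontier_interval[of 0 "(\<chi> j. 2 * pi) :: real^'d"] by (simp add: negligible_iff_null_sets null_sets_completion_iff)
  then have AE: "AE y in lborel. y \<notin> ?Q - ?B" by (rule AE_not_in)
  have intb: "integrable lborel (\<lambda>y. 4 * indicator D y + \<delta> * indicator (torus_cell :: (real^'d) set) y :: real)"
    using emD by (intro Bochner_Integration.integrable_add integrable_mult_right integrable_torus_cell integrable_real_indicator)
      (auto intro: less_trans)
  have "(LINT y|lborel. (norm (indicator A y - indicator torus_cell y *\<^sub>R P y))\<^sup>2) \<le>
     (LINT y|lborel. 4 * indicator D y + \<delta> * indicator torus_cell y)"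
    using AE bnd by (intro integral_mono_AE intb) (use L2 in \<open>auto simp: cell_L2_def\<close>)
  also have "\<dots> = 4 * measure lborel D + \<delta> * V"
    using emD by (subst Bochner_Integration.integral_add)
      (auto simp: V_def intro!: integrable_torus_cell integrable_mult_right integrable_real_indicator intro: less_trans)
  also have "\<dots> < \<epsilon>"
  proof -
    have "\<delta> * V \<le> (\<epsilon> / (4 * (V + 1))) * V" using \<delta> V by (intro mult_right_mono) auto
    also have "\<dots> \<le> \<epsilon> / 4" using V \<epsilon> by (simp add: field_simps)
    finally show ?thesis using mD \<epsilon> by linarith
  qed
  finally show "\<exists>P. trig_poly P \<and> (LINT y|lborel. (norm (indicator A y - indicator torus_cell y *\<^sub>R P y))\<^sup>2) < \<epsilon>"
    using tP by blast
qed

lemma trig_dense_simple: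
  fixes s :: "real ^ 'd \<Rightarrow> complex"
  assumes s: "simple_function borel s" and "\<And>y. y \<notin> torus_cell \<Longrightarrow> s y = 0"
  shows "trig_dense s"
proof -
  have fin: "finite (range s)" using simple_functionD(1)[OF s] by simp
  have eq: "s = (\<lambda>y. \<Sum>c\<in>range s - {0}. c * indicator (s -` {c}) y)"
  proof
    fix y
    have "(\<Sum>c\<in>range s - {0}. c * indicator (s -` {c}) y) = (\<Sum>c\<in>range s - {0}. if c = s y then c else 0)"
      by (intro sum.cong refl) (auto simp: indicator_def)
    also have "\<dots> = s y" using fin by (simp add: sum.delta)
    finally show "s y = (\<Sum>c\<in>range s - {0}. c * indicator (s -` {c}) y)" ..
  qed
  show ?thesis
  proof (subst eq, intro trig_dense_sum trig_dense_scale trig_dense_indicator)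
    fix c assume "c \<in> range s - {0}"
    then show "s -` {c} \<subseteq> torus_cell" using assms(2) by auto
    show "s -` {c} \<in> sets borel"
      using simple_functionD(2)[OF s, of "{c}"] by simp
  qed (use fin in auto)
qed

text \<open>Simple approximants of norm at most 2 |g| converge pointwise, the error is at most 3
  |g|, and dominated convergence with majorant 9 |g|^2 turns this into L2 convergence.\<close>

lemma cell_L2_trig_dense:
  fixes g :: "real ^ 'd \<Rightarrow> complex"
  assumes g: "cell_L2 g"
  shows "trig_dense g"
proof (rule trig_dense_limit[OF g])
  fix \<epsilon> :: real assume \<epsilon>: "\<epsilon> > 0"
  have [measurable]: "g \<in> borel_measurable borel" using g by (simp add: cell_L2_def)
  obtain s where s: "\<And>i. simple_function borel (s i)" "\<And>y. (\<lambda>i. s i y) \<longlonglongrightarrow> g y" 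
      "\<And>i y. dist (s i y) 0 \<le> 2 * dist (g y) 0"
    using borel_measurable_implies_sequence_metric[of g borel 0] by auto
  have [measurable]: "s i \<in> borel_measurable borel" for i
    using s(1) by (rule borel_measurable_simple_function)
  have "(\<lambda>i. LINT y|lborel. (norm (g y - s i y))\<^sup>2) \<longlonglongrightarrow> (LINT y|(lborel::(real^'d) measure). 0)"
  proof (rule integral_dominated_convergence[where w="\<lambda>y. 9 * (norm (g y))\<^sup>2"])
    show "AE y in lborel. (\<lambda>i. (norm (g y - s i y))\<^sup>2) \<longlonglongrightarrow> 0"
    proof (rule AE_I2)
      fix y
      have "(\<lambda>i. (norm (g y - s i y))\<^sup>2) \<longlonglongrightarrow> (norm (g y - g y))\<^sup>2"
        by (intro tendsto_intros s)
      then show "(\<lambda>i. (norm (g y - s i y))\<^sup>2) \<longlonglongrightarrow> 0" by simp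
    qed
    show "AE y in lborel. norm ((norm (g y - s i y))\<^sup>2) \<le> 9 * (norm (g y))\<^sup>2" for i
    proof (rule AE_I2)
      fix y
      have "norm (g y - s i y) \<le> 3 * norm (g y)"
        using s(3)[of i y] norm_triangle_ineq4[of "g y" "s i y"] by simp
      then have "(norm (g y - s i y))\<^sup>2 \<le> (3 * norm (g y))\<^sup>2" by (intro power_mono) auto
      then show "norm ((norm (g y - s i y))\<^sup>2) \<le> 9 * (norm (g y))\<^sup>2" by (simp add: power_mult_distrib)
    qed
    show "integrable lborel (\<lambda>y. 9 * (norm (g y))\<^sup>2)" using g by (simp add: cell_L2_def)
  qed auto
  then have "eventually (\<lambda>i. (LINT y|lborel. (norm (g y - s i y))\<^sup>2) < \<epsilon>) sequentially"
    using \<epsilon> by (intro order_tendstoD) auto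
  then obtain i where i: "(LINT y|lborel. (norm (g y - s i y))\<^sup>2) < \<epsilon>"
    by (meson eventually_happens sequentially_bot)
  have "trig_dense (s i)"
  proof (intro trig_dense_simple s)
    fix y :: "real^'d" assume "y \<notin> torus_cell"
    then have "g y = 0" using g by (simp add: cell_L2_def)
    then show "s i y = 0" using s(3)[of i y] by simp
  qed
  with i show "\<exists>h. trig_dense h \<and> (LINT y|lborel. (norm (g y - h y))\<^sup>2) < \<epsilon>" by blast
qed

text \<open>Finite cubes exhausting the lattice. Since they are nested, the Parseval partial sums
  increase, which later permits monotone convergence in w.\<close>

definition freq_box :: "nat \<Rightarrow> (int ^ 'd) set" where
  "freq_box N = {k. \<forall>j. \<bar>k $ j\<bar> \<le> int N}"

lemma finite_freq_box: "finite (freq_box N :: (int ^ 'd) set)"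
proof -
  have "freq_box N \<subseteq> (\<lambda>f. \<chi> j. f j) ` (UNIV \<rightarrow>\<^sub>E {- int N..int N} :: ('d \<Rightarrow> int) set)"
  proof
    fix k :: "int^'d" assume k: "k \<in> freq_box N"
    have "k = (\<chi> j. (\<lambda>j. k $ j) j)" by (simp add: vec_eq_iff)
    moreover have "(\<lambda>j. k $ j) \<in> (UNIV \<rightarrow>\<^sub>E {- int N..int N})" using k by (auto simp: freq_box_def abs_le_iff minus_le_iff)
    ultimately show "k \<in> (\<lambda>f. \<chi> j. f j) ` (UNIV \<rightarrow>\<^sub>E {- int N..int N})" by blast
  qed
  then show ?thesis by (rule finite_subset) (intro finite_imageI finite_PiE, auto)
qed

lemma freq_box_mono: "M \<le> N \<Longrightarrow> freq_box M \<subseteq> (freq_box N :: (int ^ 'a) set)"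
proof
  fix k :: "int^'a" assume "M \<le> N" "k \<in> freq_box M"
  then have "\<bar>k $ j\<bar> \<le> int N" for j by (intro order_trans[of "\<bar>k $ j\<bar>" "int M" "int N"]) (auto simp: freq_box_def)
  then show "k \<in> freq_box N" by (simp add: freq_box_def)
qed

lemma finite_subset_freq_box:
  fixes K :: "(int ^ 'd) set"
  assumes "finite K" shows "\<exists>N. K \<subseteq> freq_box N"
proof -
  define N where "N = (\<Sum>k\<in>K. \<Sum>j\<in>UNIV. nat \<bar>k $ j\<bar>)"
  have "\<bar>k $ j\<bar> \<le> int N" if "k \<in> K" for k j
  proof -
    have "nat \<bar>k $ j\<bar> \<le> (\<Sum>j\<in>UNIV. nat \<bar>k $ j\<bar>)" by (rule member_le_sum) auto
    also have "\<dots> \<le> N" unfolding N_def using assms that by (intro member_le_sum) auto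
    finally show ?thesis by linarith
  qed
  then show ?thesis by (auto simp: freq_box_def)
qed

text \<open>A trigonometric polynomial close to g has its frequencies in some box, and by the
  projection identity the Fourier projection onto any larger box is at least as close. This bounds
  the partial sums from below; Bessel's inequality bounds them from above.\<close>

theorem parseval:
  fixes g :: "real ^ 'd \<Rightarrow> complex"
  assumes g: "cell_L2 g"
  shows "(\<lambda>N. \<Sum>k\<in>freq_box N. (norm (fcoef g k))\<^sup>2) \<longlonglongrightarrow> cell_vol TYPE('d) * (LINT y|lborel. (norm (g y))\<^sup>2)"
proof (rule LIMSEQ_I)
  let ?V = "cell_vol TYPE('d)" and ?I = "LINT y|lborel. (norm (g y))\<^sup>2"
  have V: "?V > 0" by simp
  fix r :: real assume r: "r > 0"
  obtain P where P: "trig_poly P" "(LINT y|lborel. (norm (g y - indicator torus_cell y *\<^sub>R P y))\<^sup>2) < r / ?V"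
    using cell_L2_trig_dense[OF g] r V unfolding trig_dense_def by (meson divide_pos_pos)
  obtain K a where K: "finite K" "P = (\<lambda>y. \<Sum>k\<in>K. a k * fexp k y)"
    using trig_poly_repr[OF P(1)] by blast
  obtain N0 where N0: "K \<subseteq> freq_box N0" using finite_subset_freq_box[OF K(1)] by blast
  show "\<exists>no. \<forall>N\<ge>no. norm ((\<Sum>k\<in>freq_box N. (norm (fcoef g k))\<^sup>2) - ?V * ?I) < r"
  proof (intro exI allI impI)
    fix N assume "N \<ge> N0"
    let ?S = "\<Sum>k\<in>freq_box N. (norm (fcoef g k))\<^sup>2"
    have KN: "K \<subseteq> freq_box N" using N0 freq_box_mono[OF \<open>N \<ge> N0\<close>] by blast
    let ?b = "\<lambda>k. if k \<in> K then a k else 0"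
    have Pb: "P y = (\<Sum>k\<in>freq_box N. ?b k * fexp k y)" for y
      unfolding K(2) using KN finite_freq_box by (auto intro!: sum.mono_neutral_cong_left)
    have "?I - ?S / ?V \<le> (LINT y|lborel. (norm (g y - indicator torus_cell y *\<^sub>R P y))\<^sup>2)"
      unfolding Pb fourier_projection_identity(2)[OF g finite_freq_box]
      by (simp add: sum_nonneg)
    also have "\<dots> < r / ?V" by fact
    finally have lt: "?I - ?S / ?V < r / ?V" .
    have "v * i - s < r" if "v > 0" "i - s / v < r / v" for v i s :: real
      using mult_strict_right_mono[OF that(2,1)] that(1) by (simp add: right_diff_distrib mult.commute[of _ v])
    from this[OF V lt] have "?V * ?I - ?S < r" .
    moreover have "?S \<le> ?V * ?I" by (rule bessel[OF g finite_freq_box])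
    ultimately show "norm (?S - ?V * ?I) < r" by simp
  qed
qed

section \<open>Test functions on the half-line\<close>

text \<open>The classical function exp(-1/x) divided by powers of x. Admitting all n makes the
  family closed under differentiation up to linear combinations, with value 0 at the origin
  throughout.\<close>

definition flat :: "nat \<Rightarrow> real \<Rightarrow> real" where
  "flat n x = (if x > 0 then exp (- 1 / x) / x ^ n else 0)"

lemma flat_tendsto_0: "(flat n \<longlongrightarrow> 0) (at 0)"
proof -
  have "((\<lambda>x. inverse x ^ n / exp (inverse x)) \<longlongrightarrow> 0) (at_right (0::real))"
    by (rule filterlim_compose[OF tendsto_power_div_exp_0 filterlim_inverse_at_top_right])
  then have "(flat n \<longlongrightarrow> 0) (at_right 0)"
    by (rule Lim_transform_eventually)
      (auto simp: eventually_at_filter flat_def exp_minus field_simps)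
  moreover have "(flat n \<longlongrightarrow> 0) (at_left 0)"
    by (rule tendsto_eventually) (auto simp: eventually_at_filter flat_def)
  ultimately show ?thesis by (simp add: filterlim_at_split)
qed

lemma flat_has_derivative:
  "(flat n has_real_derivative (flat (n + 2) x - real n * flat (n + 1) x)) (at x)"
proof (cases x "0::real" rule: linorder_cases)
  case less
  have "((\<lambda>_. 0) has_real_derivative 0) (at x)" by simp
  then have "(flat n has_real_derivative 0) (at x)"
    by (rule has_field_derivative_transform_within_open[of _ _ _ "{..<0}"]) (use less in \<open>auto simp: flat_def\<close>)
  then show ?thesis using less by (simp add: flat_def)
next
  case greater
  have "((\<lambda>x. exp (- 1 / x) / x ^ n) has_real_derivative
     (exp (- 1 / x) * (1 / x\<^sup>2) * x ^ n - exp (- 1 / x) * (real n * x ^ (n - 1))) / (x ^ n * x ^ n)) (at x)"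
    using greater by (auto intro!: derivative_eq_intros simp: power2_eq_square)
  also have "(exp (- 1 / x) * (1 / x\<^sup>2) * x ^ n - exp (- 1 / x) * (real n * x ^ (n - 1))) / (x ^ n * x ^ n) =
     flat (n + 2) x - real n * flat (n + 1) x"
    using greater by (cases n) (auto simp: flat_def field_simps power2_eq_square)
  finally show ?thesis
    by (rule has_field_derivative_transform_within_open[of _ _ _ "{0<..}"]) (use greater in \<open>auto simp: flat_def\<close>)
next
  case equal
  have "(\<lambda>h. (flat n (0 + h) - flat n 0) / h) = (\<lambda>h. if h = 0 then 0 else flat (n + 1) h)"
    by (auto simp: fun_eq_iff flat_def)
  moreover have "((\<lambda>h. if h = 0 then 0 else flat (n + 1) h) \<longlongrightarrow> 0) (at 0)"
    by (rule Lim_transform_eventually[OF flat_tendsto_0[of "n+1"]]) (auto simp: eventually_at_filter)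
  ultimately have "(flat n has_real_derivative 0) (at 0)"
    unfolding DERIV_def by simp
  then show ?thesis using equal by (simp add: flat_def)
qed

text \<open>A space of functions that contains the bump, is closed under differentiation, and, for N
  > 0, has all members vanishing outside [x, y]. Iterating a choice of derivative inside it yields
  all derivatives of the bump without computing them.\<close>

inductive flat_class :: "real \<Rightarrow> real \<Rightarrow> real \<Rightarrow> (real \<Rightarrow> real) \<Rightarrow> bool" for N x y where
  prod: "flat_class N x y (\<lambda>w. C * (flat m (N * (w - x)) * flat k (N * (y - w))))"
| add: "flat_class N x y f \<Longrightarrow> flat_class N x y g \<Longrightarrow> flat_class N x y (\<lambda>w. f w + g w)"

lemma flat_class_derivative:
  assumes "flat_class N x y f"
  shows "\<exists>g. flat_class N x y g \<and> (\<forall>w. (f has_real_derivative g w) (at w))"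
  using assms
proof induction
  case (prod C m k)
  define g1 g2 g3 g4 where
    "g1 = (\<lambda>w. (C * N) * (flat (m + 2) (N * (w - x)) * flat k (N * (y - w))))"
    "g2 = (\<lambda>w. (- C * N * m) * (flat (m + 1) (N * (w - x)) * flat k (N * (y - w))))"
    "g3 = (\<lambda>w. (- C * N) * (flat m (N * (w - x)) * flat (k + 2) (N * (y - w))))"
    "g4 = (\<lambda>w. (C * N * k) * (flat m (N * (w - x)) * flat (k + 1) (N * (y - w))))"
  have "flat_class N x y (\<lambda>w. (g1 w + g2 w) + (g3 w + g4 w))"
    unfolding g1_g2_g3_g4_def by (intro flat_class.intros)
  moreover have "((\<lambda>w. C * (flat m (N * (w - x)) * flat k (N * (y - w)))) has_real_derivative (g1 w + g2 w) + (g3 w + g4 w)) (at w)" for w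
  proof -
    have 1: "((\<lambda>w. flat m (N * (w - x))) has_real_derivative (flat (m + 2) (N * (w - x)) - m * flat (m + 1) (N * (w - x))) * N) (at w)"
      by (rule DERIV_chain'[OF _ flat_has_derivative]) (auto intro!: derivative_eq_intros)
    have 2: "((\<lambda>w. flat k (N * (y - w))) has_real_derivative (flat (k + 2) (N * (y - w)) - k * flat (k + 1) (N * (y - w))) * - N) (at w)"
      by (rule DERIV_chain'[OF _ flat_has_derivative]) (auto intro!: derivative_eq_intros)
    show ?thesis
      by (rule DERIV_cong[OF DERIV_cmult[OF DERIV_mult[OF 1 2]]]) (simp add: g1_g2_g3_g4_def algebra_simps)
  qed
  ultimately show ?case by blast
next
  case (add f g)
  then obtain f' g' where "flat_class N x y f'" "flat_class N x y g'"
     "\<forall>w. (f has_real_derivative f' w) (at w)" "\<forall>w. (g has_real_derivative g' w) (at w)" by blast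
  then show ?case
    by (intro exI[of _ "\<lambda>w. f' w + g' w"]) (auto intro: flat_class.add DERIV_add)
qed

definition smooth_seq :: "(nat \<Rightarrow> real \<Rightarrow> real) \<Rightarrow> bool" where
  "smooth_seq D \<longleftrightarrow> (\<forall>n x. (D n has_real_derivative D (Suc n) x) (at x))"

text \<open>A test function on \<open>(c, \<infinity>)\<close> is given together with the sequence of its derivatives.\<close>

definition test_seq :: "real \<Rightarrow> (nat \<Rightarrow> real \<Rightarrow> real) \<Rightarrow> bool" where
  "test_seq c D \<longleftrightarrow> smooth_seq D \<and> (\<exists>a b. c < a \<and> (\<forall>n x. D n x \<noteq> 0 \<longrightarrow> a \<le> x \<and> x \<le> b))"

lemma bump_test_seq:
  assumes "c < x" "N > 0"
  shows "\<exists>D. test_seq c D \<and> D 0 = (\<lambda>w. flat 0 (N * (w - x)) * flat 0 (N * (y - w)))"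
proof -
  have 0: "flat_class N x y (\<lambda>w. flat 0 (N * (w - x)) * flat 0 (N * (y - w)))"
    using flat_class.prod[of N x y 1 0 0] by simp
  obtain d where d: "\<And>f. flat_class N x y f \<Longrightarrow> flat_class N x y (d f) \<and> (\<forall>w. (f has_real_derivative d f w) (at w))"
    using flat_class_derivative by metis
  define D where "D n = (d ^^ n) (\<lambda>w. flat 0 (N * (w - x)) * flat 0 (N * (y - w)))" for n
  have cl: "flat_class N x y (D n)" for n
    by (induction n) (auto simp: D_def 0 d)
  have vanish: "x \<le> w \<and> w \<le> y" if "flat_class N x y f" "f w \<noteq> 0" for f w
    using that
  proof induction
    case (prod C m k)
    then show ?case using assms by (auto simp: flat_def zero_less_mult_iff split: if_splits)
  next
    case (add f g)
    then have "f w \<noteq> 0 \<or> g w \<noteq> 0" by auto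
    then show ?case using add.IH by blast
  qed
  have "smooth_seq D"
    unfolding smooth_seq_def using cl d by (auto simp: D_def)
  moreover have "\<forall>n w. D n w \<noteq> 0 \<longrightarrow> x \<le> w \<and> w \<le> y" using cl vanish by blast
  ultimately show ?thesis
    using assms(1) unfolding test_seq_def by (intro exI[of _ D]) (auto simp: D_def)
qed

lemma smooth_seq_continuous: "smooth_seq D \<Longrightarrow> continuous_on A (D n)"
  unfolding smooth_seq_def by (meson DERIV_continuous_on has_field_derivative_at_within)

lemma test_seq_smooth: "test_seq c D \<Longrightarrow> smooth_seq D"
  by (simp add: test_seq_def)

lemma smooth_seq_measurable [measurable_dest]: "smooth_seq D \<Longrightarrow> D n \<in> borel_measurable borel"
  by (intro borel_measurable_continuous_onI smooth_seq_continuous)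

lemma test_seq_shift: "test_seq c D \<Longrightarrow> test_seq c (\<lambda>n. D (Suc n))"
  unfolding test_seq_def smooth_seq_def by blast

lemma test_seq_lincomb:
  assumes "test_seq c D" "test_seq c E"
  shows "test_seq c (\<lambda>n x. p * D n x + q * E n x)"
proof -
  obtain a b where ab: "c < a" "\<And>n x. D n x \<noteq> 0 \<Longrightarrow> a \<le> x \<and> x \<le> b"
    using assms(1) unfolding test_seq_def by blast
  obtain a' b' where ab': "c < a'" "\<And>n x. E n x \<noteq> 0 \<Longrightarrow> a' \<le> x \<and> x \<le> b'"
    using assms(2) unfolding test_seq_def by blast
  have "smooth_seq (\<lambda>n x. p * D n x + q * E n x)"
    using assms unfolding test_seq_def smooth_seq_def by (auto intro!: DERIV_add DERIV_cmult)
  moreover have "min a a' \<le> x \<and> x \<le> max b b'" if "p * D n x + q * E n x \<noteq> 0" for n x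
  proof -
    have "D n x \<noteq> 0 \<or> E n x \<noteq> 0" using that by auto
    then show ?thesis using ab(2)[of n x] ab'(2)[of n x] by auto
  qed
  ultimately show ?thesis
    unfolding test_seq_def using ab(1) ab'(1) by (intro conjI exI[of _ "min a a'"] exI[of _ "max b b'"]) auto
qed

lemma test_seq_exp_mult:
  assumes "test_seq c D"
  shows "\<exists>E. test_seq c E \<and> (\<forall>x. E 0 x = exp (\<mu> * x) * D 0 x) \<and> (\<forall>x. E 1 x = exp (\<mu> * x) * (D 1 x + \<mu> * D 0 x))"
proof -
  \<comment> \<open>\<open>P n k\<close> is the k-th derivative of (d/dx + \<mu>)^n applied to
    \<open>D 0\<close>. Hence exp(\<mu> x) \<open>P n 0\<close> is the n-th derivative of exp(\<mu>
    x) \<open>D 0\<close>.\<close>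
  define P where "P = rec_nat D (\<lambda>_ Q k x. Q (Suc k) x + \<mu> * Q k x)"
  have P0: "P 0 = D" and PS: "P (Suc n) = (\<lambda>k x. P n (Suc k) x + \<mu> * P n k x)" for n
    by (simp_all add: P_def)
  have PS': "P (Suc n) = (\<lambda>k x. 1 * P n (Suc k) x + \<mu> * P n k x)" for n by (simp add: PS)
  obtain a b where ab: "c < a" "\<And>n x. D n x \<noteq> 0 \<Longrightarrow> a \<le> x \<and> x \<le> b"
    using assms unfolding test_seq_def by blast
  have sm: "test_seq c (P n)" for n
  proof (induction n)
    case (Suc n)
    show ?case unfolding PS' by (intro test_seq_lincomb test_seq_shift Suc)
  qed (simp add: P0 assms)
  have supp: "a \<le> x \<and> x \<le> b" if "P n k x \<noteq> 0" for n k x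
    using that
  proof (induction n arbitrary: k)
    case 0 then show ?case using ab(2) by (auto simp: P0)
  next
    case (Suc n)
    then have "P n (Suc k) x \<noteq> 0 \<or> P n k x \<noteq> 0" by (auto simp: PS)
    then show ?case using Suc.IH by blast
  qed
  define E where "E n x = exp (\<mu> * x) * P n 0 x" for n x
  have "smooth_seq E"
    unfolding smooth_seq_def
  proof (intro allI)
    fix n x
    have "(P n 0 has_real_derivative P n (Suc 0) x) (at x)"
      using sm[of n] unfolding test_seq_def smooth_seq_def by blast
    then show "(E n has_real_derivative E (Suc n) x) (at x)"
      unfolding E_def by (auto intro!: derivative_eq_intros simp: PS algebra_simps)
  qed
  then have "test_seq c E"
    unfolding test_seq_def using ab(1) supp by (intro conjI exI[of _ a] exI[of _ b]) (auto simp: E_def)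
  then show ?thesis by (intro exI[of _ E]) (auto simp: E_def P0 PS)
qed

lemma test_seq_bounded:
  assumes "test_seq c D" shows "\<exists>B. \<forall>x. \<bar>D n x\<bar> \<le> B"
proof -
  obtain a b where ab: "\<And>n x. D n x \<noteq> 0 \<Longrightarrow> a \<le> x \<and> x \<le> b"
    using assms unfolding test_seq_def by blast
  have "compact (D n ` {a..b})"
    using assms by (intro compact_continuous_image smooth_seq_continuous test_seq_smooth) auto
  then have "bounded (D n ` {a..b})" by (rule compact_imp_bounded)
  then obtain B where "\<forall>y\<in>D n ` {a..b}. norm y \<le> B" unfolding bounded_iff by blast
  then have B: "\<And>x. x \<in> {a..b} \<Longrightarrow> \<bar>D n x\<bar> \<le> B" by simp
  have "\<bar>D n x\<bar> \<le> max B 0" for x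
    using B[of x] ab[of n x] by (cases "D n x = 0") (auto simp: max_def)
  then show ?thesis by blast
qed

lemma integrable_mult_test_seq:
  fixes U :: "real \<Rightarrow> complex"
  assumes D: "test_seq c D" and U: "U \<in> borel_measurable borel" "\<And>a b. c < a \<Longrightarrow> set_integrable lborel {a..b} U"
  shows "integrable lborel (\<lambda>x. U x * of_real (D n x))"
proof -
  obtain a b where ab: "c < a" "\<And>n x. D n x \<noteq> 0 \<Longrightarrow> a \<le> x \<and> x \<le> b"
    using D unfolding test_seq_def by blast
  obtain B where B: "\<And>x. \<bar>D n x\<bar> \<le> B" using test_seq_bounded[OF D] by blast
  have [measurable]: "D n \<in> borel_measurable borel" using D test_seq_smooth smooth_seq_measurable by blast
  note [measurable] = U(1)
  have "integrable lborel (\<lambda>x. B *\<^sub>R (indicator {a..b} x *\<^sub>R U x))"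
    using U(2)[OF ab(1), of b] unfolding set_integrable_def by (rule integrable_scaleR_right)
  then show ?thesis
  proof (rule Bochner_Integration.integrable_bound)
    show "AE x in lborel. norm (U x * of_real (D n x)) \<le> norm (B *\<^sub>R (indicator {a..b} x *\<^sub>R U x))"
    proof (rule AE_I2)
      fix x
      show "norm (U x * of_real (D n x)) \<le> norm (B *\<^sub>R (indicator {a..b} x *\<^sub>R U x))"
      proof (cases "x \<in> {a..b}")
        case True
        have "norm (U x) * \<bar>D n x\<bar> \<le> norm (U x) * \<bar>B\<bar>"
          using B[of x] by (intro mult_left_mono) auto
        then show ?thesis using True by (simp add: norm_mult mult.commute)
      next
        case False
        then have "D n x = 0" using ab(2) by auto
        then show ?thesis by simp
      qed
    qed
  qed auto
qed

section \<open>Weak derivatives on a half-line: the du Bois-Reymond lemma and primitives\<close>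

text \<open>Integrating from the left end of the support gives a primitive that is constant to the
  right of the support; the zero mean makes this constant 0, so the primitive is again a test
  function.\<close>

lemma test_seq_antiderivative:
  assumes D: "test_seq c D" and 0: "(LINT x|lborel. D 0 x) = 0"
  shows "\<exists>E. test_seq c E \<and> E 1 = D 0"
proof -
  obtain a b where ab: "c < a" "\<And>n x. D n x \<noteq> 0 \<Longrightarrow> a \<le> x \<and> x \<le> b"
    using D unfolding test_seq_def by blast
  have cont: "continuous_on A (D 0)" for A using D by (intro smooth_seq_continuous test_seq_smooth)
  define H where "H x = integral {a..x} (D 0)" for x
  have vanish: "integral {A..a} (D 0) = 0" for A
  proof (cases "A \<le> a")
    case True
    have "integral {A..a} (D 0) = integral {A..a} (\<lambda>_. 0)"
      by (rule integral_spike[of "{a}"]) (use ab(2)[of 0] in force)+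
    then show ?thesis by simp
  qed auto
  have eq: "H x = integral {A..x} (D 0)" if "A \<le> a" "A \<le> x" for A x
  proof (cases "a \<le> x")
    case True
    have "integral {A..a} (D 0) + integral {a..x} (D 0) = integral {A..x} (D 0)"
      using that True cont by (intro Henstock_Kurzweil_Integration.integral_combine integrable_continuous_real) auto
    then show ?thesis by (simp add: H_def vanish)
  next
    case False
    have "integral {A..x} (D 0) = integral {A..x} (\<lambda>_. 0)"
      by (rule Henstock_Kurzweil_Integration.integral_cong) (use ab(2)[of 0] False in force)
    then show ?thesis using False by (simp add: H_def)
  qed
  have deriv: "(H has_real_derivative D 0 x) (at x)" for x
  proof -
    \<comment> \<open>A base point to the left of both a and x makes x interior to the interval of
      integration, so the one-sided fundamental theorem gives a two-sided derivative. Moving the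
      base point from a to A leaves \<open>H\<close> unchanged, because \<open>D 0\<close> vanishes
      left of a.\<close>
    define A where "A = min (a - 1) (x - 1)"
    have "((\<lambda>u. integral {A..u} (D 0)) has_real_derivative D 0 x) (at x within {A..x+1})"
      by (rule integral_has_real_derivative) (auto simp: A_def cont)
    then have "((\<lambda>u. integral {A..u} (D 0)) has_real_derivative D 0 x) (at x within {A<..<x+1})"
      by (rule DERIV_subset) auto
    then have "((\<lambda>u. integral {A..u} (D 0)) has_real_derivative D 0 x) (at x)"
      by (subst (asm) at_within_open) (auto simp: A_def)
    then show ?thesis
      by (rule has_field_derivative_transform_within_open[of _ _ _ "{A<..<x+1}"])
        (auto simp: A_def intro!: eq[symmetric])
  qed
  have H0: "H x = 0" if "x \<notin> {a..b}" for x
  proof (cases "x < a")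
    case False
    then have x: "x > b" "x \<ge> a" using that by auto
    have "H x = (LINT t:{a..x}|lborel. D 0 t)"
      unfolding H_def using cont by (intro set_borel_integral_eq_integral(2)[symmetric] borel_integrable_atLeastAtMost')
    also have "\<dots> = (LINT t|lborel. D 0 t)"
      unfolding set_lebesgue_integral_def
      by (rule Bochner_Integration.integral_cong) (use ab(2)[of 0] x in \<open>force simp: indicator_def\<close>)+
    finally show ?thesis using 0 by simp
  qed (simp add: H_def)
  define E where "E n = (case n of 0 \<Rightarrow> H | Suc m \<Rightarrow> D m)" for n
  have "smooth_seq E"
    unfolding smooth_seq_def
  proof (intro allI)
    fix n x show "(E n has_real_derivative E (Suc n) x) (at x)"
      using D deriv by (cases n) (auto simp: E_def test_seq_def smooth_seq_def)
  qed
  moreover have "a \<le> x \<and> x \<le> b" if "E n x \<noteq> 0" for n x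
    using that H0[of x] ab(2)[of _ x] by (cases n) (auto simp: E_def)
  ultimately show ?thesis using ab(1) by (intro exI[of _ E]) (auto simp: test_seq_def E_def)
qed

text \<open>Dynkin's argument: half-lines form an intersection-stable generator of the Borel sets,
  and the sets on which f integrates to 0 are closed under complements and countable disjoint
  unions.\<close>

lemma integral_zero_on_intervals_imp_AE_zero:
  fixes f :: "real \<Rightarrow> complex"
  assumes f: "integrable lborel f"
    and 0: "\<And>x. (LINT t|lborel. indicator {..x} t *\<^sub>R f t) = 0" "(LINT t|lborel. f t) = 0"
  shows "AE t in lborel. f t = 0"
proof -
  have [measurable]: "f \<in> borel_measurable borel" using f by simp
  have si: "set_integrable lborel A f" if "A \<in> sets borel" for A
    using that f integrable_mult_indicator[of A lborel f] by (simp add: set_integrable_def)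
  have gen: "sets (borel :: real measure) = sigma_sets UNIV (range (\<lambda>a::real. {..a}))"
    unfolding borel_eq_atMost by simp
  show ?thesis
  proof (rule sigma_finite_measure.density_zero[OF sigma_finite_lborel f])
    fix A :: "real set" assume "A \<in> sets lborel"
    then have mem: "A \<in> sigma_sets UNIV (range (\<lambda>a::real. {..a}))" by (simp add: gen)
    have stable: "Int_stable (range (\<lambda>a::real. {..a}))" by (auto simp: Int_stable_def)
    have "range (\<lambda>a::real. {..a}) \<subseteq> Pow UNIV" by simp
    from stable this mem show "set_lebesgue_integral lborel A f = 0"
    proof (induction rule: sigma_sets_induct_disjoint)
      case (basic A)
      then show ?case using 0(1) by (auto simp: set_lebesgue_integral_def)
    next
      case empty
      show ?case by (simp add: set_lebesgue_integral_def)
    next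
      case (compl A)
      then have A: "A \<in> sets borel" by (simp add: gen)
      have "set_lebesgue_integral lborel (UNIV - A) f + set_lebesgue_integral lborel A f = set_lebesgue_integral lborel ((UNIV - A) \<union> A) f"
        using A by (intro set_integral_Un[symmetric] si) auto
      then show ?case using compl 0(2) by (simp add: set_lebesgue_integral_def)
    next
      case (union A)
      then have A: "A i \<in> sets borel" for i by (auto simp: gen)
      have "set_lebesgue_integral lborel (\<Union>i. A i) f = (\<Sum>i. set_lebesgue_integral lborel (A i) f)"
        using A union(1) by (intro lebesgue_integral_countable_add si) (auto simp: disjoint_family_on_def)
      then show ?case using union by simp
    qed
  qed
qed

lemma integrable_test_seq: "test_seq c D \<Longrightarrow> integrable lborel (D n)"
proof -
  assume D: "test_seq c D"
  have "integrable lborel (\<lambda>x. 1 * complex_of_real (D n x))"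
    by (rule integrable_mult_test_seq[OF D]) (auto simp: set_integrable_def emeasure_lborel_Icc_eq intro!: integrableI_bounded_set_indicator[where B=1])
  from integrable_Re[OF this] show ?thesis by simp
qed

lemma bump_tendsto_indicator:
  "(\<lambda>n. flat 0 (real (Suc n) * (w - x)) * flat 0 (real (Suc n) * (y - w))) \<longlonglongrightarrow> indicator {x<..<y} w"
proof (cases "w \<in> {x<..<y}")
  case True
  have lim: "(\<lambda>n. exp (- 1 / (real (Suc n) * d))) \<longlonglongrightarrow> 1" if "d > 0" for d
  proof -
    have "(\<lambda>n. (- 1 / d) * inverse (real (Suc n))) \<longlonglongrightarrow> (- 1 / d) * 0"
      by (intro tendsto_intros LIMSEQ_inverse_real_of_nat)
    then have "(\<lambda>n. exp ((- 1 / d) * inverse (real (Suc n)))) \<longlonglongrightarrow> exp 0"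
      by (intro tendsto_exp) simp
    then show ?thesis by (simp add: field_simps)
  qed
  have "(\<lambda>n. exp (- 1 / (real (Suc n) * (w - x))) * exp (- 1 / (real (Suc n) * (y - w)))) \<longlonglongrightarrow> 1 * 1"
    using True by (intro tendsto_mult lim) auto
  then show ?thesis using True by (simp add: flat_def del: of_nat_Suc)
next
  case False
  then have z: "flat 0 (real (Suc n) * (w - x)) * flat 0 (real (Suc n) * (y - w)) = 0" for n
    by (auto simp: flat_def zero_less_mult_iff)
  show ?thesis unfolding z using False by simp
qed

lemma flat_bounds: "0 \<le> flat 0 x" "flat 0 x \<le> 1"
  by (auto simp: flat_def)

text \<open>The du Bois-Reymond lemma. Subtracting a multiple of one fixed bump from a test function
  gives it zero mean, hence makes it a derivative; therefore Z - k annihilates all test functions,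
  where k is the average of Z against the fixed bump. Bumps increasing to indicators of intervals
  then force Z = k almost everywhere.\<close>

lemma weak_const:
  fixes Z :: "real \<Rightarrow> complex"
  assumes Z: "Z \<in> borel_measurable borel" "\<And>a b. c < a \<Longrightarrow> set_integrable lborel {a..b} Z"
    and weak: "\<And>D. test_seq c D \<Longrightarrow> (LINT x|lborel. Z x * of_real (D 1 x)) = 0"
  shows "\<exists>k. AE x in lborel. c < x \<longrightarrow> Z x = k"
proof -
  note [measurable] = Z(1)
  obtain D0 where D0: "test_seq c D0" "D0 0 = (\<lambda>w. flat 0 (1 * (w - (c + 1))) * flat 0 (1 * ((c + 2) - w)))"
    using bump_test_seq[of c "c+1" 1 "c+2"] by auto
  define I0 where "I0 = (LINT x|lborel. D0 0 x)"
  have "I0 \<noteq> 0"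
  proof
    assume "I0 = 0"
    then have "AE x in lborel. D0 0 x = 0"
    proof -
      have nn: "AE x in lborel. 0 \<le> D0 0 x" using flat_bounds by (intro AE_I2) (simp add: D0(2))
      show ?thesis
        using integral_nonneg_eq_0_iff_AE[OF integrable_test_seq[OF D0(1)] nn] \<open>I0 = 0\<close> by (simp only: I0_def)
    qed
    then have "AE x in lborel. x \<notin> {c+1<..<c+2}"
      by eventually_elim (auto simp: D0(2) flat_def)
    then have "{c+1<..<c+2} \<in> null_sets lborel" by (subst (asm) AE_iff_null_sets[symmetric]) auto
    then show False by (simp add: null_sets_def)
  qed
  define k where "k = (LINT x|lborel. Z x * of_real (D0 0 x)) / of_real I0"
  have key: "(LINT x|lborel. (Z x - k) * of_real (D 0 x)) = 0" if D: "test_seq c D" for D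
  proof -
    define s where "s = (LINT x|lborel. D 0 x) / I0"
    define T where "T n x = 1 * D n x + (- s) * D0 n x" for n x
    have T: "test_seq c T" unfolding T_def by (rule test_seq_lincomb[OF D D0(1)])
    have "(LINT x|lborel. T 0 x) = (LINT x|lborel. D 0 x) - s * I0"
      unfolding T_def I0_def using integrable_test_seq[OF D, of 0] integrable_test_seq[OF D0(1), of 0] by simp
    then have "(LINT x|lborel. T 0 x) = 0" using \<open>I0 \<noteq> 0\<close> by (simp add: s_def)
    from test_seq_antiderivative[OF T this] obtain E where E: "test_seq c E" "E 1 = T 0" by blast
    note i = integrable_mult_test_seq[OF D Z, of 0] integrable_mult_test_seq[OF D0(1) Z, of 0]
    have "0 = (LINT x|lborel. Z x * of_real (T 0 x))"
      using weak[OF E(1)] E(2) by simp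
    also have "\<dots> = (LINT x|lborel. Z x * of_real (D 0 x) - of_real s * (Z x * of_real (D0 0 x)))"
      by (simp add: T_def algebra_simps)
    also have "\<dots> = (LINT x|lborel. Z x * of_real (D 0 x)) - of_real s * (LINT x|lborel. Z x * of_real (D0 0 x))"
      using i by simp
    also have "of_real s * (LINT x|lborel. Z x * of_real (D0 0 x)) = k * of_real (LINT x|lborel. D 0 x)"
      using \<open>I0 \<noteq> 0\<close> by (simp add: k_def s_def)
    finally have 1: "(LINT x|lborel. Z x * of_real (D 0 x)) = k * of_real (LINT x|lborel. D 0 x)" by simp
    have i2: "integrable lborel (\<lambda>x. k * complex_of_real (D 0 x))"
      using integrable_test_seq[OF D, of 0] by (intro integrable_mult_right integrable_of_real)
    have "(LINT x|lborel. (Z x - k) * of_real (D 0 x)) = (LINT x|lborel. Z x * of_real (D 0 x) - k * of_real (D 0 x))"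
      by (simp add: algebra_simps)
    also have "\<dots> = (LINT x|lborel. Z x * of_real (D 0 x)) - (LINT x|lborel. k * of_real (D 0 x))"
      using i i2 by (intro Bochner_Integration.integral_diff)
    also have "\<dots> = 0" using 1 by simp
    finally show ?thesis .
  qed
  have loc: "integrable lborel (\<lambda>t. indicator {x..y} t *\<^sub>R (Z t - k))" if "c < x" for x y
  proof -
    have "set_integrable lborel {x..y} (\<lambda>t. Z t - k)"
      using Z(2)[OF that, of y] by (intro set_integral_diff(1))
        (auto simp: set_integrable_def emeasure_lborel_Icc_eq intro!: integrableI_bounded_set_indicator[where B="norm k"])
    then show ?thesis by (simp add: set_integrable_def)
  qed
  have interval: "(LINT t|lborel. indicator {x<..<y} t *\<^sub>R (Z t - k)) = 0" if cx: "c < x" for x y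
  proof -
    let ?b = "\<lambda>n t. flat 0 (real (Suc n) * (t - x)) * flat 0 (real (Suc n) * (y - t))"
    have m: "?b n \<in> borel_measurable borel" for n
    proof -
      obtain D where "test_seq c D" "D 0 = ?b n"
        using bump_test_seq[OF cx, of "real (Suc n)" y] by auto
      then show ?thesis using smooth_seq_measurable[OF test_seq_smooth] by metis
    qed
    have "(\<lambda>n. LINT t|lborel. (Z t - k) * of_real (?b n t)) \<longlonglongrightarrow> (LINT t|lborel. (Z t - k) * of_real (indicator {x<..<y} t))"
    proof (rule integral_dominated_convergence[where w="\<lambda>t. norm (indicator {x..y} t *\<^sub>R (Z t - k))"])
      show "integrable lborel (\<lambda>t. norm (indicator {x..y} t *\<^sub>R (Z t - k)))"
        using loc[OF that] by (rule integrable_norm)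
      show "AE t in lborel. (\<lambda>n. (Z t - k) * of_real (?b n t)) \<longlonglongrightarrow> (Z t - k) * of_real (indicator {x<..<y} t)"
        by (intro AE_I2 tendsto_intros bump_tendsto_indicator)
      show "AE t in lborel. norm ((Z t - k) * of_real (?b n t)) \<le> norm (indicator {x..y} t *\<^sub>R (Z t - k))" for n
      proof (rule AE_I2)
        fix t
        have "\<bar>?b n t\<bar> \<le> indicator {x..y} t"
        proof (cases "t \<in> {x..y}")
          case True
          have "?b n t \<le> 1 * 1" by (intro mult_mono flat_bounds) auto
          moreover have "?b n t \<ge> 0" by (intro mult_nonneg_nonneg flat_bounds)
          ultimately show ?thesis using True by simp
        next
          case False
          then have z: "?b n t = 0" by (auto simp: flat_def zero_less_mult_iff)
          show ?thesis unfolding z by simp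
        qed
        then have "norm (Z t - k) * \<bar>?b n t\<bar> \<le> norm (Z t - k) * indicator {x..y} t"
          by (intro mult_left_mono) auto
        then show "norm ((Z t - k) * of_real (?b n t)) \<le> norm (indicator {x..y} t *\<^sub>R (Z t - k))"
          by (simp only: norm_mult norm_of_real norm_scaleR) (simp add: mult.commute)
      qed
    qed (use m in measurable)
    moreover have "(LINT t|lborel. (Z t - k) * of_real (?b n t)) = 0" for n
    proof -
      obtain D where "test_seq c D" "D 0 = ?b n"
        using bump_test_seq[OF cx, of "real (Suc n)" y] by auto
      then show ?thesis using key[of D] by simp
    qed
    ultimately have "(LINT t|lborel. (Z t - k) * of_real (indicator {x<..<y} t)) = 0"
      by (simp add: LIMSEQ_const_iff)
    then show ?thesis by (simp add: scaleR_conv_of_real mult.commute)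
  qed
  \<comment> \<open>Z is integrable only over intervals that stay away from c, so the half-line is
    exhausted by countably many bounded intervals whose left ends exceed c.\<close>
  define J where "J m = {c + 1 / real (Suc m)<..<c + real (Suc m)}" for m
  have [measurable]: "J m \<in> sets borel" for m by (simp add: J_def)
  have "AE t in lborel. indicator (J m) t *\<^sub>R (Z t - k) = 0" for m
  proof (rule integral_zero_on_intervals_imp_AE_zero)
    have c: "c < c + 1 / real (Suc m)" by simp
    show "integrable lborel (\<lambda>t. indicator (J m) t *\<^sub>R (Z t - k))"
      by (rule Bochner_Integration.integrable_bound[OF loc[OF c, of "c + real (Suc m)"]])
        (auto simp: J_def indicator_def)
    show "(LINT t|lborel. indicator (J m) t *\<^sub>R (Z t - k)) = 0"
      unfolding J_def by (rule interval[OF c])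
    fix x
    have "(LINT t|lborel. indicator {..x} t *\<^sub>R indicator (J m) t *\<^sub>R (Z t - k)) =
       (LINT t|lborel. indicator {c + 1 / real (Suc m)<..<min x (c + real (Suc m))} t *\<^sub>R (Z t - k))"
    proof (rule integral_cong_AE)
      show "AE t in lborel. indicator {..x} t *\<^sub>R indicator (J m) t *\<^sub>R (Z t - k) =
         indicator {c + 1 / real (Suc m)<..<min x (c + real (Suc m))} t *\<^sub>R (Z t - k)"
        using AE_lborel_singleton[of x] by eventually_elim (auto simp: J_def indicator_def)
    qed measurable
    then show "(LINT t|lborel. indicator {..x} t *\<^sub>R indicator (J m) t *\<^sub>R (Z t - k)) = 0"
      using interval[OF c] by simp
  qed
  then have "AE t in lborel. \<forall>m. indicator (J m) t *\<^sub>R (Z t - k) = 0"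
    by (subst AE_all_countable) simp
  then have "AE t in lborel. c < t \<longrightarrow> Z t = k"
  proof eventually_elim
    case (elim t)
    show ?case
    proof
      assume t: "c < t"
      obtain m where m: "real m > max (t - c) (1 / (t - c))" using reals_Archimedean2 by blast
      then have "real (Suc m) > t - c" "real (Suc m) > 1 / (t - c)" by auto
      then have "t \<in> J m" using t by (auto simp: J_def field_simps)
      then show "Z t = k" using elim[rule_format, of m] by simp
    qed
  qed
  then show ?thesis by blast
qed

text \<open>Fubini on the triangle c \<le> t \<le> x shows that the integral of G from c has G as
  weak derivative; U minus this integral then has weak derivative 0 and is constant by
  \<open>weak_const\<close>.\<close>

lemma weak_primitive:
  fixes U G :: "real \<Rightarrow> complex"
  assumes U: "U \<in> borel_measurable borel" "\<And>a b. set_integrable lborel {a..b} U"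
    and G: "G \<in> borel_measurable borel" "\<And>a b. set_integrable lborel {a..b} G"
    and weak: "\<And>D. test_seq c D \<Longrightarrow> (LINT x|lborel. U x * of_real (D 1 x)) = - (LINT x|lborel. G x * of_real (D 0 x))"
  shows "\<exists>k. AE x in lborel. c < x \<longrightarrow> U x = k + (LINT t:{c..x}|lborel. G t)"
proof -
  note [measurable] = U(1) G(1)
  define V where "V x = (LINT t:{c..x}|lborel. G t)" for x
  have V': "V x = (LINT t|lborel. indicator {(x, t). c \<le> t \<and> t \<le> x} (x, t) *\<^sub>R G t)" for x
    unfolding V_def set_lebesgue_integral_def by (intro Bochner_Integration.integral_cong) (auto simp: indicator_def)
  have S [measurable]: "{(x, t). c \<le> t \<and> t \<le> x} \<in> sets (borel \<Otimes>\<^sub>M borel :: (real \<times> real) measure)"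
  proof -
    have "closed {(x, t). c \<le> t \<and> t \<le> (x::real)}"
      unfolding split_beta' by (intro closed_Collect_conj closed_Collect_le continuous_intros)
    then show ?thesis unfolding borel_prod by (rule borel_closed)
  qed
  have Vm [measurable]: "V \<in> borel_measurable borel"
    unfolding V' by (rule lborel.borel_measurable_lebesgue_integral[of _ borel, simplified]) (auto simp: split_beta')
  have iG: "integrable lborel (\<lambda>t. indicator {c..b} t *\<^sub>R G t)" for b
    using G(2) by (simp add: set_integrable_def)
  have Vb: "norm (V x) \<le> (LINT t|lborel. norm (indicator {c..b} t *\<^sub>R G t))" if "x \<le> b" for x b
  proof -
    have "norm (V x) \<le> (LINT t|lborel. norm (indicator {c..x} t *\<^sub>R G t))"
      unfolding V_def set_lebesgue_integral_def by (rule integral_norm_bound)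
    also have "\<dots> \<le> (LINT t|lborel. norm (indicator {c..b} t *\<^sub>R G t))"
      using that by (intro integral_mono integrable_norm iG) (auto simp: indicator_def)
    finally show ?thesis .
  qed
  have Vi: "set_integrable lborel {a..b} V" for a b
    unfolding set_integrable_def
    by (rule integrableI_bounded_set_indicator[where B="LINT t|lborel. norm (indicator {c..b} t *\<^sub>R G t)"])
      (auto simp: emeasure_lborel_Icc_eq simp del: norm_scaleR intro!: Vb AE_I2)
  have Vweak: "(LINT x|lborel. V x * of_real (D 1 x)) = - (LINT x|lborel. G x * of_real (D 0 x))"
    if D: "test_seq c D" for D
  proof -
    obtain a b where ab: "c < a" "\<And>n x. D n x \<noteq> 0 \<Longrightarrow> a \<le> x \<and> x \<le> b"
      using D unfolding test_seq_def by blast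
    define b' where "b' = max a b + 1"
    have Db: "D n x = 0" if "x \<notin> {a..b}" for n x using ab(2)[of n x] that by auto
    have [measurable]: "D n \<in> borel_measurable borel" for n using D test_seq_smooth smooth_seq_measurable by blast
    \<comment> \<open>Truncating t at \<open>b'\<close> makes \<open>F\<close> integrable on the
      plane and costs nothing, since \<open>D 1\<close> vanishes beyond b. The margin 1 in
      \<open>b'\<close> puts it outside the support, so that \<open>D 0\<close> vanishes there in
      the inner integral.\<close>
    define F where "F = (\<lambda>(x, t). (indicator {(x, t). c \<le> t \<and> t \<le> x} (x, t) * D 1 x) *\<^sub>R (indicator {c..b'} t *\<^sub>R G t))"
    have Fm: "F \<in> borel_measurable (lborel \<Otimes>\<^sub>M lborel)"
      unfolding F_def by measurable
    have intF: "integrable (lborel \<Otimes>\<^sub>M lborel) F"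
    proof (rule Bochner_Integration.integrable_bound)
      show "integrable (lborel \<Otimes>\<^sub>M lborel) (\<lambda>(x, t). norm (D 1 x) * norm (indicator {c..b'} t *\<^sub>R G t))"
      proof (rule lborel_pair.Fubini_integrable)
        show "integrable lborel (\<lambda>x. LINT t|lborel. norm (case (x, t) of (x, t) \<Rightarrow> norm (D 1 x) * norm (indicator {c..b'} t *\<^sub>R G t)))"
          using integrable_test_seq[OF D, of 1] by (simp add: abs_mult)
        show "AE x in lborel. integrable lborel (\<lambda>t. case (x, t) of (x, t) \<Rightarrow> norm (D 1 x) * norm (indicator {c..b'} t *\<^sub>R G t))"
          using iG[of b'] by (intro AE_I2) (auto intro!: integrable_norm integrable_mult_right simp del: norm_scaleR)
      qed measurable
      show "AE z in lborel \<Otimes>\<^sub>M lborel. norm (F z) \<le> norm (case z of (x, t) \<Rightarrow> norm (D 1 x) * norm (indicator {c..b'} t *\<^sub>R G t))"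
        by (rule AE_I2) (auto simp: F_def indicator_def split: prod.splits)
    qed (rule Fm)
    have "(LINT x|lborel. V x * of_real (D 1 x)) = (LINT x|lborel. LINT t|lborel. F (x, t))"
    proof (rule Bochner_Integration.integral_cong)
      fix x :: real
      show "V x * of_real (D 1 x) = (LINT t|lborel. F (x, t))"
      proof (cases "x \<in> {a..b}")
        case False
        then show ?thesis by (simp add: Db F_def)
      next
        case True
        have "(LINT t|lborel. F (x, t)) = (LINT t|lborel. of_real (D 1 x) * (indicator {(x, t). c \<le> t \<and> t \<le> x} (x, t) *\<^sub>R G t))"
          by (rule Bochner_Integration.integral_cong) (use True in \<open>auto simp: F_def indicator_def b'_def scaleR_conv_of_real\<close>)
        then have "(LINT t|lborel. F (x, t)) = of_real (D 1 x) * V x"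
          by (simp only: integral_mult_right_zero V'[symmetric])
        then show ?thesis by (simp only: mult.commute)
      qed
    qed simp
    also have "\<dots> = (LINT t|lborel. LINT x|lborel. F (x, t))"
      using lborel_pair.Fubini_integral[of "\<lambda>x t. F (x, t)"] intF by simp
    also have "\<dots> = (LINT t|lborel. - (G t * of_real (D 0 t)))"
    proof (rule Bochner_Integration.integral_cong)
      fix t :: real
      show "(LINT x|lborel. F (x, t)) = - (G t * of_real (D 0 t))"
      proof (cases "t \<in> {c..b'}")
        case False
        then have "t \<notin> {a..b}" using ab(1) by (auto simp: b'_def)
        then show ?thesis using False by (simp add: Db F_def)
      next
        case True
        have "(LINT x|lborel. F (x, t)) = (LINT x|lborel. (indicator {t..b'} x *\<^sub>R D 1 x) *\<^sub>R G t)"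
        proof (rule Bochner_Integration.integral_cong)
          fix x :: real
          show "F (x, t) = (indicator {t..b'} x *\<^sub>R D 1 x) *\<^sub>R G t"
          proof (cases "x \<in> {a..b}")
            case False then show ?thesis by (simp add: Db F_def)
          next
            case x: True
            then show ?thesis using True by (auto simp: F_def indicator_def b'_def)
          qed
        qed simp
        also have "\<dots> = (LINT x|lborel. indicator {t..b'} x *\<^sub>R D 1 x) *\<^sub>R G t"
          by (rule integral_scaleR_left) (auto intro!: integrable_mult_indicator[of "{t..b'}" lborel "D 1", simplified] integrable_test_seq[OF D])
        also have "(LINT x|lborel. indicator {t..b'} x *\<^sub>R D 1 x) = D 0 b' - D 0 t"
        proof (rule integral_FTC_Icc)
          show "t \<le> b'" using True by simp
          show "(D 0 has_vector_derivative D 1 x) (at x within {t..b'})" for x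
            using D unfolding test_seq_def smooth_seq_def has_real_derivative_iff_has_vector_derivative[symmetric]
            by (metis One_nat_def has_field_derivative_at_within)
          show "continuous_on {t..b'} (D 1)"
            using D by (intro smooth_seq_continuous test_seq_smooth)
        qed
        also have "D 0 b' = 0" by (rule Db) (auto simp: b'_def)
        finally show ?thesis by (simp add: scaleR_conv_of_real mult.commute)
      qed
    qed simp
    also have "\<dots> = - (LINT t|lborel. G t * of_real (D 0 t))" by simp
    finally show ?thesis .
  qed
  have "\<exists>k. AE x in lborel. c < x \<longrightarrow> U x - V x = k"
  proof (rule weak_const)
    show "(\<lambda>x. U x - V x) \<in> borel_measurable borel" by measurable
    show "set_integrable lborel {a..b} (\<lambda>x. U x - V x)" for a b
      using U(2) Vi by (rule set_integral_diff(1))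
    fix D assume D: "test_seq c D"
    have "(LINT x|lborel. (U x - V x) * of_real (D 1 x)) = (LINT x|lborel. U x * of_real (D 1 x) - V x * of_real (D 1 x))"
      by (simp add: algebra_simps)
    also have "\<dots> = (LINT x|lborel. U x * of_real (D 1 x)) - (LINT x|lborel. V x * of_real (D 1 x))"
      using U Vi by (intro Bochner_Integration.integral_diff integrable_mult_test_seq[OF D] Vm) auto
    also have "\<dots> = 0" using weak[OF D] Vweak[OF D] by simp
    finally show "(LINT x|lborel. (U x - V x) * of_real (D 1 x)) = 0" .
  qed
  then obtain k where "AE x in lborel. c < x \<longrightarrow> U x - V x = k" by blast
  then have "AE x in lborel. c < x \<longrightarrow> U x = k + (LINT t:{c..x}|lborel. G t)"
    by eventually_elim (auto simp: V_def algebra_simps)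
  then show ?thesis by blast
qed

section \<open>Weighted estimates for a single Fourier mode\<close>

text \<open>The derivative conditions concern \<open>{a..}\<close> alone, so measurability on the
  whole line is required separately. The growth of \<phi> to infinity is what gives the kernel
  exp(\<Phi> w - \<Phi> s), with respect to p(s) ds on s \<ge> w, total mass 1 in
  \<open>kernel_estimate\<close>.\<close>

definition weight :: "real \<Rightarrow> (real \<Rightarrow> real) \<Rightarrow> (real \<Rightarrow> real) \<Rightarrow> (real \<Rightarrow> real) \<Rightarrow> bool" where
  "weight a \<phi> P Q \<longleftrightarrow> \<phi> \<in> borel_measurable borel \<and> P \<in> borel_measurable borel \<and> filterlim \<phi> at_top at_top \<and>
     continuous_on {a..} Q \<and>
     (\<forall>w\<ge>a. (\<phi> has_real_derivative P w) (at w) \<and> (P has_real_derivative Q w) (at w) \<and> 0 < P w \<and> 0 \<le> Q w)"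

lemma weight_continuous:
  assumes "weight a \<phi> P Q"
  shows "continuous_on {a..} \<phi>" "continuous_on {a..} P" "continuous_on {a..} Q"
  using assms unfolding weight_def
  by (auto intro!: continuous_at_imp_continuous_on DERIV_isCont)

lemma weight_mono:
  assumes w: "weight a \<phi> P Q" and "a \<le> x" "x \<le> y"
  shows "P x \<le> P y"
proof (rule DERIV_nonneg_imp_nondecreasing[OF assms(3)])
  fix z assume "x \<le> z" "z \<le> y"
  then show "\<exists>d. (P has_real_derivative d) (at z) \<and> 0 \<le> d"
    using assms unfolding weight_def by (intro exI[of _ "Q z"]) auto
qed

text \<open>Cauchy-Schwarz with the splitting \<open>sqrt (k p) * (sqrt (k / p) * g)\<close>, where \<open>k\<close> is the kernel and
  \<open>\<integral> k(w, s) p(s) ds = 1\<close>, followed by Tonelli and \<open>p(w) \<le> p(s)\<close>.\<close>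

lemma kernel_estimate:
  fixes g :: "real \<Rightarrow> real" and p \<Phi> :: "real \<Rightarrow> real"
  assumes meas [measurable]: "\<Phi> \<in> borel_measurable borel" "p \<in> borel_measurable borel" "g \<in> borel_measurable borel"
    and lim: "filterlim \<Phi> at_top at_top"
    and deriv: "\<And>w. a \<le> w \<Longrightarrow> (\<Phi> has_real_derivative p w) (at w)"
    and pos: "\<And>w. a \<le> w \<Longrightarrow> 0 < p w"
    and mono: "\<And>x y. a \<le> x \<Longrightarrow> x \<le> y \<Longrightarrow> p x \<le> p y"
  shows "(\<integral>\<^sup>+w. indicator {a..} w * (ennreal (p w) * (\<integral>\<^sup>+s. indicator {w..} s * ennreal (exp (\<Phi> w - \<Phi> s) * \<bar>g s\<bar>) \<partial>lborel))\<^sup>2 \<partial>lborel)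
    \<le> (\<integral>\<^sup>+s. indicator {a..} s * ennreal ((g s)\<^sup>2) \<partial>lborel)"
proof -
  define k where "k w s = exp (\<Phi> w - \<Phi> s)" for w s
  have [measurable]: "(\<lambda>x. k (fst x) (snd x)) \<in> borel_measurable (borel \<Otimes>\<^sub>M borel)" "k w \<in> borel_measurable borel" for w
    unfolding k_def by measurable
  have 1: "(\<integral>\<^sup>+s. indicator {w..} s * ennreal (k w s * \<bar>g s\<bar>) \<partial>lborel)\<^sup>2 \<le>
    (\<integral>\<^sup>+s. indicator {w..} s * ennreal (k w s * (g s)\<^sup>2 / p s) \<partial>lborel)" if w: "a \<le> w" for w
  proof -
    define f1 f2 where "f1 s = indicator {w..} s * ennreal (sqrt (k w s * p s))"
      and "f2 s = indicator {w..} s * ennreal (sqrt (k w s / p s) * \<bar>g s\<bar>)" for s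
    have [measurable]: "f1 \<in> borel_measurable lborel" "f2 \<in> borel_measurable lborel"
      unfolding f1_def f2_def by measurable
    have m: "indicator {w..} s * ennreal (k w s * \<bar>g s\<bar>) = f1 s * f2 s" for s
    proof (cases "s \<ge> w")
      case True
      then have p: "p s > 0" using pos w by simp
      have "sqrt (k w s * p s) * (sqrt (k w s / p s) * \<bar>g s\<bar>) = sqrt ((k w s)\<^sup>2) * \<bar>g s\<bar>"
        using p unfolding mult.assoc[symmetric] real_sqrt_mult[symmetric] by (simp add: power2_eq_square)
      then have e: "sqrt (k w s * p s) * (sqrt (k w s / p s) * \<bar>g s\<bar>) = k w s * \<bar>g s\<bar>"
        by (simp add: k_def)
      have "f1 s * f2 s = ennreal (sqrt (k w s * p s)) * ennreal (sqrt (k w s / p s) * \<bar>g s\<bar>)"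
        using True by (simp add: f1_def f2_def)
      also have "\<dots> = ennreal (k w s * \<bar>g s\<bar>)"
        unfolding e[symmetric] by (rule ennreal_mult[symmetric]) (use p in \<open>auto simp: k_def\<close>)
      finally show ?thesis using True by simp
    qed (simp add: f1_def f2_def)
    have s1: "(f1 s)\<^sup>2 = ennreal (k w s * p s) * indicator {w..} s" for s
    proof (cases "s \<ge> w")
      case True
      then have p: "p s > 0" using pos w by simp
      then show ?thesis using True by (simp add: f1_def ennreal_power k_def)
    qed (simp add: f1_def)
    have s2: "(f2 s)\<^sup>2 = indicator {w..} s * ennreal (k w s * (g s)\<^sup>2 / p s)" for s
    proof (cases "s \<ge> w")
      case True
      then have p: "p s > 0" using pos w by simp
      then show ?thesis using True by (simp add: f2_def ennreal_power k_def power_mult_distrib)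
    qed (simp add: f2_def)
    have "(\<integral>\<^sup>+s. (f1 s)\<^sup>2 \<partial>lborel) = ennreal (0 - (- k w w))"
      unfolding s1
    proof (rule nn_integral_FTC_atLeast[where F="\<lambda>s. - k w s" and T=0])
      show "((\<lambda>s. - k w s) has_real_derivative k w s * p s) (at s)" if "w \<le> s" for s
        unfolding k_def using w that by (auto intro!: derivative_eq_intros deriv)
      show "0 \<le> k w s * p s" if "w \<le> s" for s using pos[of s] w that by (simp add: k_def)
      have "((\<lambda>s. exp (- \<Phi> s)) \<longlongrightarrow> 0) at_top"
        using lim by (intro filterlim_compose[OF exp_at_bot] filterlim_compose[OF filterlim_uminus_at_bot_at_top])
      then have "((\<lambda>s. - (exp (\<Phi> w) * exp (- \<Phi> s))) \<longlongrightarrow> - (exp (\<Phi> w) * 0)) at_top"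
        by (intro tendsto_intros)
      then show "((\<lambda>s. - k w s) \<longlongrightarrow> 0) at_top"
        by (simp add: k_def exp_diff exp_minus field_simps)
    qed measurable
    also have "\<dots> = 1" by (simp add: k_def)
    finally have f1: "(\<integral>\<^sup>+s. (f1 s)\<^sup>2 \<partial>lborel) = 1" .
    show ?thesis unfolding m s2[symmetric]
      using Cauchy_Schwarz_nn_integral[of f1 lborel f2] by (simp add: f1)
  qed
  have "(\<integral>\<^sup>+w. indicator {a..} w * (ennreal (p w) * (\<integral>\<^sup>+s. indicator {w..} s * ennreal (k w s * \<bar>g s\<bar>) \<partial>lborel))\<^sup>2 \<partial>lborel)
    \<le> (\<integral>\<^sup>+w. (\<integral>\<^sup>+s. indicator {a..} s * (ennreal ((g s)\<^sup>2) * (ennreal (k w s * p w) * indicator {a..s} w)) \<partial>lborel) \<partial>lborel)"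
  proof (rule nn_integral_mono)
    fix w
    show "indicator {a..} w * (ennreal (p w) * (\<integral>\<^sup>+s. indicator {w..} s * ennreal (k w s * \<bar>g s\<bar>) \<partial>lborel))\<^sup>2 \<le>
      (\<integral>\<^sup>+s. indicator {a..} s * (ennreal ((g s)\<^sup>2) * (ennreal (k w s * p w) * indicator {a..s} w)) \<partial>lborel)"
    proof (cases "a \<le> w")
      case True
      have "(ennreal (p w) * (\<integral>\<^sup>+s. indicator {w..} s * ennreal (k w s * \<bar>g s\<bar>) \<partial>lborel))\<^sup>2 \<le>
        (ennreal (p w))\<^sup>2 * (\<integral>\<^sup>+s. indicator {w..} s * ennreal (k w s * (g s)\<^sup>2 / p s) \<partial>lborel)"
        unfolding power_mult_distrib by (intro mult_left_mono 1 True) simp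
      also have "\<dots> = (\<integral>\<^sup>+s. (ennreal (p w))\<^sup>2 * (indicator {w..} s * ennreal (k w s * (g s)\<^sup>2 / p s)) \<partial>lborel)"
        by (intro nn_integral_cmult[symmetric]) measurable
      also have "\<dots> \<le> (\<integral>\<^sup>+s. indicator {a..} s * (ennreal ((g s)\<^sup>2) * (ennreal (k w s * p w) * indicator {a..s} w)) \<partial>lborel)"
      proof (rule nn_integral_mono)
        fix s
        show "(ennreal (p w))\<^sup>2 * (indicator {w..} s * ennreal (k w s * (g s)\<^sup>2 / p s)) \<le>
          indicator {a..} s * (ennreal ((g s)\<^sup>2) * (ennreal (k w s * p w) * indicator {a..s} w))"
        proof (cases "w \<le> s")
          case ws: True
          have p: "0 < p w" "p w \<le> p s" using pos mono True ws by auto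
          then have ps: "p s > 0" by simp
          have "(p w)\<^sup>2 * (k w s * (g s)\<^sup>2 / p s) = (k w s * (g s)\<^sup>2 * p w) * (p w / p s)"
            by (simp add: power2_eq_square)
          also have "\<dots> \<le> (k w s * (g s)\<^sup>2 * p w) * 1"
            using p ps by (intro mult_left_mono) (auto simp: k_def)
          finally have "(p w)\<^sup>2 * (k w s * (g s)\<^sup>2 / p s) \<le> (g s)\<^sup>2 * (k w s * p w)" by (simp add: mult_ac)
          then have "ennreal ((p w)\<^sup>2 * (k w s * (g s)\<^sup>2 / p s)) \<le> ennreal ((g s)\<^sup>2 * (k w s * p w))"
            by (rule ennreal_leI)
          moreover have "(ennreal (p w))\<^sup>2 * ennreal (k w s * (g s)\<^sup>2 / p s) = ennreal ((p w)\<^sup>2 * (k w s * (g s)\<^sup>2 / p s))"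
            by (simp only: ennreal_power[OF less_imp_le[OF p(1)]] ennreal_mult'[OF zero_le_power2])
          moreover have "ennreal ((g s)\<^sup>2) * ennreal (k w s * p w) = ennreal ((g s)\<^sup>2 * (k w s * p w))"
            by (rule ennreal_mult'[symmetric]) simp
          ultimately show ?thesis using True ws by simp
        qed (simp add: indicator_def)
      qed
      finally show ?thesis using True by simp
    qed simp
  qed
  also have "\<dots> = (\<integral>\<^sup>+s. (\<integral>\<^sup>+w. indicator {a..} s * (ennreal ((g s)\<^sup>2) * (ennreal (k w s * p w) * indicator {a..s} w)) \<partial>lborel) \<partial>lborel)"
    by (rule lborel_pair.Fubini') (auto simp: split_beta' k_def indicator_def[of "{a.._}"])
  also have "\<dots> \<le> (\<integral>\<^sup>+s. indicator {a..} s * ennreal ((g s)\<^sup>2) \<partial>lborel)"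
  proof (rule nn_integral_mono)
    fix s
    show "(\<integral>\<^sup>+w. indicator {a..} s * (ennreal ((g s)\<^sup>2) * (ennreal (k w s * p w) * indicator {a..s} w)) \<partial>lborel) \<le>
      indicator {a..} s * ennreal ((g s)\<^sup>2)"
    proof (cases "a \<le> s")
      case True
      have km: "(\<lambda>w. k w s * p w) \<in> borel_measurable borel" unfolding k_def by measurable
      have "(\<integral>\<^sup>+w. ennreal (k w s * p w) * indicator {a..s} w \<partial>lborel) = ennreal (k s s - k a s)"
      proof (rule nn_integral_FTC_Icc[OF km _ _ True, where F="\<lambda>w. k w s"])
        show "((\<lambda>w. k w s) has_real_derivative k w s * p w) (at w)" if "w \<in> {a..s}" for w
          unfolding k_def using that by (auto intro!: derivative_eq_intros deriv)
        show "0 \<le> k w s * p w" if "w \<in> {a..s}" for w using pos[of w] that by (simp add: k_def)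
      qed
      also have "\<dots> \<le> 1" by (simp add: k_def)
      finally have le: "(\<integral>\<^sup>+w. ennreal (k w s * p w) * indicator {a..s} w \<partial>lborel) \<le> 1" .
      have "(\<integral>\<^sup>+w. indicator {a..} s * (ennreal ((g s)\<^sup>2) * (ennreal (k w s * p w) * indicator {a..s} w)) \<partial>lborel) =
        ennreal ((g s)\<^sup>2) * (\<integral>\<^sup>+w. ennreal (k w s * p w) * indicator {a..s} w \<partial>lborel)"
        using True km by (simp add: nn_integral_cmult)
      also have "\<dots> \<le> ennreal ((g s)\<^sup>2) * 1" using le by (rule mult_left_mono) simp
      finally show ?thesis using True by simp
    qed simp
  qed
  finally show ?thesis unfolding k_def .
qed

lemma ennreal_add_le:
  assumes "0 \<le> x" shows "ennreal (x + y) \<le> ennreal x + ennreal y"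
proof (cases "0 \<le> y")
  case False
  then have "ennreal (x + y) \<le> ennreal x" by (intro ennreal_leI) simp
  then show ?thesis using False by (simp add: ennreal_neg)
qed (use assms in simp)

text \<open>The derivative of (P + \<mu>)^2 (P - \<mu>) is Q (P + \<mu>) (3 P - \<mu>); this is the
  origin of the second term of \<open>W\<close>. Differentiating \<open>f\<close> along V' = X -
  \<mu> V also produces 2 (P + \<mu>)^2 (P - \<mu>)^2 |V|^2 and a cross term with X. Half of the
  former is kept for \<open>W\<close>; the other half, the cross term and the X-term combine to the
  square (P + \<mu>)^2 |(P - \<mu>) V + X|^2, which is dropped.\<close>

lemma energy_boundary_inequality:
  fixes V X :: "real \<Rightarrow> complex"
  assumes wt: "weight a \<phi> P Q"
    and V: "\<And>w. a \<le> w \<Longrightarrow> (V has_vector_derivative (X w - of_real \<mu> * V w)) (at w)"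
    and X: "continuous_on {a..} X"
    and ar: "a \<le> r"
  defines "f \<equiv> \<lambda>w. (P w + \<mu>)\<^sup>2 * (P w - \<mu>) * exp (2 * \<phi> w) * (norm (V w))\<^sup>2"
    and "W \<equiv> \<lambda>w. (P w + \<mu>)\<^sup>2 * (P w - \<mu>)\<^sup>2 + Q w * (P w + \<mu>) * (3 * P w - \<mu>)"
  assumes W0: "\<And>w. a \<le> w \<Longrightarrow> 0 \<le> W w"
  shows "(\<integral>\<^sup>+w. indicator {a..r} w * ennreal (W w * exp (2 * \<phi> w) * (norm (V w))\<^sup>2) \<partial>lborel) \<le>
    (\<integral>\<^sup>+w. indicator {a..r} w * ennreal ((P w + \<mu>)\<^sup>2 * exp (2 * \<phi> w) * (norm (X w))\<^sup>2) \<partial>lborel) + ennreal (f r - f a)"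
proof -
  define D where "D w = exp (2 * \<phi> w) * (Q w * (P w + \<mu>) * (3 * P w - \<mu>) * (norm (V w))\<^sup>2 + 2 * (P w + \<mu>)\<^sup>2 * (P w - \<mu>)\<^sup>2 * (norm (V w))\<^sup>2
     + 2 * (P w + \<mu>)\<^sup>2 * (P w - \<mu>) * (V w \<bullet> X w))" for w
  have contV: "continuous_on {a..} V"
    using has_vector_derivative_continuous[OF V] by (intro continuous_at_imp_continuous_on) auto
  have Vn: "((\<lambda>w. V w \<bullet> V w) has_real_derivative 2 * (V w \<bullet> (X w - of_real \<mu> * V w))) (at w)" if "a \<le> w" for w
  proof -
    have "((\<lambda>w. V w \<bullet> V w) has_derivative (\<lambda>h. V w \<bullet> (h *\<^sub>R (X w - of_real \<mu> * V w)) + (h *\<^sub>R (X w - of_real \<mu> * V w)) \<bullet> V w)) (at w)"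
      using V[OF that] unfolding has_vector_derivative_def by (intro has_derivative_inner)
    then show ?thesis
      unfolding has_field_derivative_def
      by (rule has_derivative_eq_rhs) (auto simp: fun_eq_iff inner_commute)
  qed
  have df: "(f has_real_derivative D w) (at w)" if "a \<le> w" for w
  proof -
    have \<phi>': "(\<phi> has_real_derivative P w) (at w)" and P': "(P has_real_derivative Q w) (at w)"
      using wt that by (auto simp: weight_def)
    have m: "V w \<bullet> (of_real \<mu> * V w) = \<mu> * (norm (V w))\<^sup>2"
      by (simp add: inner_mult_right power2_norm_eq_inner flip: scaleR_conv_of_real)
    have "((\<lambda>w. (P w + \<mu>)\<^sup>2 * (P w - \<mu>) * exp (2 * \<phi> w) * (V w \<bullet> V w)) has_real_derivative
      ((2 * (P w + \<mu>) * Q w * (P w - \<mu>) + (P w + \<mu>)\<^sup>2 * Q w) * exp (2 * \<phi> w) + (P w + \<mu>)\<^sup>2 * (P w - \<mu>) * (exp (2 * \<phi> w) * (2 * P w))) * (V w \<bullet> V w)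
       + (P w + \<mu>)\<^sup>2 * (P w - \<mu>) * exp (2 * \<phi> w) * (2 * (V w \<bullet> (X w - of_real \<mu> * V w)))) (at w)"
      by (auto intro!: derivative_eq_intros \<phi>' P' Vn[OF that] simp: algebra_simps)
    also have "((2 * (P w + \<mu>) * Q w * (P w - \<mu>) + (P w + \<mu>)\<^sup>2 * Q w) * exp (2 * \<phi> w) + (P w + \<mu>)\<^sup>2 * (P w - \<mu>) * (exp (2 * \<phi> w) * (2 * P w))) * (V w \<bullet> V w)
       + (P w + \<mu>)\<^sup>2 * (P w - \<mu>) * exp (2 * \<phi> w) * (2 * (V w \<bullet> (X w - of_real \<mu> * V w))) = D w"
      unfolding D_def inner_diff_right m power2_norm_eq_inner[symmetric] by (simp add: power2_eq_square algebra_simps)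
    finally show ?thesis unfolding f_def power2_norm_eq_inner .
  qed
  define A B where "A w = W w * exp (2 * \<phi> w) * (norm (V w))\<^sup>2" 
    and "B w = (P w + \<mu>)\<^sup>2 * exp (2 * \<phi> w) * (norm (X w))\<^sup>2" for w
  have AB: "A w \<le> B w + D w" if "a \<le> w" for w
  proof -
    have "B w + D w - A w = exp (2 * \<phi> w) * ((P w + \<mu>)\<^sup>2 * ((norm ((P w - \<mu>) *\<^sub>R V w + X w))\<^sup>2))"
      unfolding A_def B_def D_def W_def power2_norm_eq_inner
      by (simp add: inner_add_left inner_add_right inner_commute power2_eq_square algebra_simps)
    also have "\<dots> \<ge> 0" by simp
    finally show ?thesis by simp
  qed
  note contw = weight_continuous[OF wt]
  have sub: "{a..r} \<subseteq> {a..}" by auto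
  have cA: "continuous_on {a..r} A" unfolding A_def W_def
    by (intro continuous_intros continuous_on_subset[OF contw(1) sub] continuous_on_subset[OF contw(2) sub]
        continuous_on_subset[OF contw(3) sub] continuous_on_subset[OF contV sub])
  have cB: "continuous_on {a..r} B" unfolding B_def
    by (intro continuous_intros continuous_on_subset[OF contw(1) sub] continuous_on_subset[OF contw(2) sub]
        continuous_on_subset[OF contw(3) sub] continuous_on_subset[OF X sub])
  have cD: "continuous_on {a..r} D" unfolding D_def
    by (intro continuous_intros continuous_on_subset[OF contw(1) sub] continuous_on_subset[OF contw(2) sub]
        continuous_on_subset[OF contw(3) sub] continuous_on_subset[OF X sub] continuous_on_subset[OF contV sub])
  have iA: "integrable lborel (\<lambda>w. indicator {a..r} w *\<^sub>R A w)" and iB: "integrable lborel (\<lambda>w. indicator {a..r} w *\<^sub>R B w)"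
    and iD: "integrable lborel (\<lambda>w. indicator {a..r} w *\<^sub>R D w)"
    using borel_integrable_atLeastAtMost'[OF cA] borel_integrable_atLeastAtMost'[OF cB] borel_integrable_atLeastAtMost'[OF cD]
    by (auto simp: set_integrable_def)
  have D: "(LINT w|lborel. indicator {a..r} w *\<^sub>R D w) = f r - f a"
  proof (rule integral_FTC_Icc[OF ar _ cD])
    show "(f has_vector_derivative D w) (at w within {a..r})" if "a \<le> w" for w
      unfolding has_real_derivative_iff_has_vector_derivative[symmetric]
      by (rule has_field_derivative_at_within[OF df[OF that]])
  qed
  have "(LINT w|lborel. indicator {a..r} w *\<^sub>R A w) \<le> (LINT w|lborel. indicator {a..r} w *\<^sub>R B w + indicator {a..r} w *\<^sub>R D w)"
    using AB by (intro integral_mono iA Bochner_Integration.integrable_add iB iD) (auto simp: indicator_def)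
  also have "\<dots> = (LINT w|lborel. indicator {a..r} w *\<^sub>R B w) + (f r - f a)"
    using iB iD D by simp
  finally have "ennreal (LINT w|lborel. indicator {a..r} w *\<^sub>R A w) \<le> ennreal ((LINT w|lborel. indicator {a..r} w *\<^sub>R B w) + (f r - f a))"
    by (rule ennreal_leI)
  also have "\<dots> \<le> ennreal (LINT w|lborel. indicator {a..r} w *\<^sub>R B w) + ennreal (f r - f a)"
    by (rule ennreal_add_le, intro integral_nonneg_AE AE_I2) (auto simp: B_def)
  finally have "ennreal (LINT w|lborel. indicator {a..r} w *\<^sub>R A w) \<le> ennreal (LINT w|lborel. indicator {a..r} w *\<^sub>R B w) + ennreal (f r - f a)" .
  moreover have "(\<integral>\<^sup>+w. ennreal (indicator {a..r} w *\<^sub>R A w) \<partial>lborel) = ennreal (LINT w|lborel. indicator {a..r} w *\<^sub>R A w)"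
    by (rule nn_integral_eq_integral[OF iA]) (use W0 in \<open>auto simp: A_def indicator_def\<close>)
  moreover have "(\<integral>\<^sup>+w. ennreal (indicator {a..r} w *\<^sub>R B w) \<partial>lborel) = ennreal (LINT w|lborel. indicator {a..r} w *\<^sub>R B w)"
    by (rule nn_integral_eq_integral[OF iB]) (auto simp: B_def indicator_def)
  moreover have "ennreal (indicator {a..r} w *\<^sub>R y) = indicator {a..r} w * ennreal y" for w y
    by (simp add: indicator_def)
  ultimately show ?thesis by (simp add: A_def B_def)
qed

lemma emeasure_lborel_Ici: "emeasure lborel {x::real..} = \<infinity>"
proof (rule ccontr)
  assume "\<not> ?thesis"
  then obtain B where B: "emeasure lborel {x..} = ennreal B" "B \<ge> 0" by (cases "emeasure lborel {x..}") auto
  have "ennreal (B + 1) = emeasure lborel {x..x + (B + 1)}" using B(2) by simp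
  also have "\<dots> \<le> emeasure lborel {x..}" by (intro emeasure_mono) auto
  finally show False using B by (simp add: ennreal_le_iff2)
qed

text \<open>Supplies arbitrarily large cut-off points at which a boundary term with finite integral
  is negligible, although it need not tend to 0.\<close>

lemma frequently_small_of_finite_nn_integral:
  fixes g :: "real \<Rightarrow> real"
  assumes fin: "(\<integral>\<^sup>+w. indicator {a..} w * ennreal (g w) \<partial>lborel) < \<infinity>" and "\<epsilon> > 0"
  shows "\<exists>r\<ge>R. g r < \<epsilon>"
proof (rule ccontr)
  assume "\<not> ?thesis"
  then have g: "\<epsilon> \<le> g r" if "r \<ge> R" for r using that by force
  have "(\<integral>\<^sup>+w. ennreal \<epsilon> * indicator {max a R..} w \<partial>lborel) \<le> (\<integral>\<^sup>+w. indicator {a..} w * ennreal (g w) \<partial>lborel)"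
    using g by (intro nn_integral_mono) (auto simp: indicator_def intro!: ennreal_leI)
  moreover have "(\<integral>\<^sup>+w. ennreal \<epsilon> * indicator {max a R..} w \<partial>lborel) = \<infinity>"
    using \<open>\<epsilon> > 0\<close> emeasure_lborel_Ici by (simp add: nn_integral_cmult_indicator ennreal_mult_eq_top_iff)
  ultimately show False using fin by simp
qed

text \<open>The boundary term at the far end is at most (P + \<mu>)^3 exp(2 \<phi>) |V|^2, small
  along a sequence by \<open>fin\<close>. The one at a enters as - f a, which is positive only when
  P a < \<mu>; then (P a + \<mu>)^2 (\<mu> - P a) \<le> (2 \<mu>)^2 \<mu>. So the constant 4 \<mu>^3
  contains \<mu> and not P, which keeps the final constant free of the weight.\<close>

lemma energy_estimate:
  fixes V X :: "real \<Rightarrow> complex"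
  assumes wt: "weight a \<phi> P Q"
    and V: "\<And>w. a \<le> w \<Longrightarrow> (V has_vector_derivative (X w - of_real \<mu> * V w)) (at w)"
    and X: "continuous_on {a..} X" and \<mu>: "0 \<le> \<mu>"
    and W: "\<And>w. a \<le> w \<Longrightarrow> m \<le> (P w + \<mu>)\<^sup>2 * (P w - \<mu>)\<^sup>2 + Q w * (P w + \<mu>) * (3 * P w - \<mu>)"
    and m: "0 \<le> m"
    and fin: "(\<integral>\<^sup>+w. indicator {a..} w * ennreal ((P w + \<mu>) ^ 3 * exp (2 * \<phi> w) * (norm (V w))\<^sup>2) \<partial>lborel) < \<infinity>"
  shows "(\<integral>\<^sup>+w. indicator {a..} w * ennreal (m * exp (2 * \<phi> w) * (norm (V w))\<^sup>2) \<partial>lborel) \<le>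
    (\<integral>\<^sup>+w. indicator {a..} w * ennreal ((P w + \<mu>)\<^sup>2 * exp (2 * \<phi> w) * (norm (X w))\<^sup>2) \<partial>lborel) +
    ennreal (4 * \<mu> ^ 3 * exp (2 * \<phi> a) * (norm (V a))\<^sup>2)"
    (is "?A \<le> ?B + ?C")
proof -
  define f where "f w = (P w + \<mu>)\<^sup>2 * (P w - \<mu>) * exp (2 * \<phi> w) * (norm (V w))\<^sup>2" for w
  have P: "0 < P w" if "a \<le> w" for w using wt that by (auto simp: weight_def)
  have fa: "- f a \<le> 4 * \<mu> ^ 3 * exp (2 * \<phi> a) * (norm (V a))\<^sup>2"
  proof -
    have "(P a + \<mu>)\<^sup>2 * (\<mu> - P a) \<le> 4 * \<mu> ^ 3"
    proof (cases "P a \<le> \<mu>")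
      case True
      have "(P a + \<mu>)\<^sup>2 * (\<mu> - P a) \<le> (2 * \<mu>)\<^sup>2 * \<mu>"
        using True P[of a] \<mu> by (intro mult_mono power_mono) auto
      then show ?thesis by (simp add: power2_eq_square power3_eq_cube)
    next
      case False
      then have "(P a + \<mu>)\<^sup>2 * (\<mu> - P a) \<le> 0" by (intro mult_nonneg_nonpos) auto
      also have "0 \<le> 4 * \<mu> ^ 3" using \<mu> by simp
      finally show ?thesis .
    qed
    then have "(P a + \<mu>)\<^sup>2 * (\<mu> - P a) * (exp (2 * \<phi> a) * (norm (V a))\<^sup>2) \<le> 4 * \<mu> ^ 3 * (exp (2 * \<phi> a) * (norm (V a))\<^sup>2)"
      by (intro mult_right_mono) auto
    then show ?thesis by (simp add: f_def algebra_simps)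
  qed
  have fle: "f w \<le> (P w + \<mu>) ^ 3 * exp (2 * \<phi> w) * (norm (V w))\<^sup>2" if "a \<le> w" for w
  proof -
    have "(P w + \<mu>)\<^sup>2 * (P w - \<mu>) \<le> (P w + \<mu>)\<^sup>2 * (P w + \<mu>)"
      using \<mu> by (intro mult_left_mono) auto
    then have "(P w + \<mu>)\<^sup>2 * (P w - \<mu>) * (exp (2 * \<phi> w) * (norm (V w))\<^sup>2) \<le> (P w + \<mu>) ^ 3 * (exp (2 * \<phi> w) * (norm (V w))\<^sup>2)"
      by (intro mult_right_mono) (auto simp: power2_eq_square power3_eq_cube)
    then show ?thesis by (simp add: f_def mult_ac)
  qed
  have part: "(\<integral>\<^sup>+w. indicator {a..a + real n} w * ennreal (m * exp (2 * \<phi> w) * (norm (V w))\<^sup>2) \<partial>lborel) \<le> ?B + ?C" for n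
  proof (rule ennreal_le_epsilon)
    fix e :: real assume e: "0 < e"
    obtain r where r: "r \<ge> a + real n" "(P r + \<mu>) ^ 3 * exp (2 * \<phi> r) * (norm (V r))\<^sup>2 < e"
      using frequently_small_of_finite_nn_integral[OF fin e] by blast
    then have ar: "a \<le> r" by simp
    have W0: "0 \<le> (P w + \<mu>)\<^sup>2 * (P w - \<mu>)\<^sup>2 + Q w * (P w + \<mu>) * (3 * P w - \<mu>)" if "a \<le> w" for w
      using W[OF that] m by simp
    have "(\<integral>\<^sup>+w. indicator {a..a + real n} w * ennreal (m * exp (2 * \<phi> w) * (norm (V w))\<^sup>2) \<partial>lborel) \<le>
      (\<integral>\<^sup>+w. indicator {a..r} w * ennreal (((P w + \<mu>)\<^sup>2 * (P w - \<mu>)\<^sup>2 + Q w * (P w + \<mu>) * (3 * P w - \<mu>)) * exp (2 * \<phi> w) * (norm (V w))\<^sup>2) \<partial>lborel)"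
      using r(1) W by (intro nn_integral_mono) (auto simp: indicator_def intro!: ennreal_leI mult_right_mono)
    also have "\<dots> \<le> (\<integral>\<^sup>+w. indicator {a..r} w * ennreal ((P w + \<mu>)\<^sup>2 * exp (2 * \<phi> w) * (norm (X w))\<^sup>2) \<partial>lborel) + ennreal (f r - f a)"
      unfolding f_def by (rule energy_boundary_inequality[OF wt V X ar W0])
    also have "\<dots> \<le> ?B + (?C + ennreal e)"
    proof (rule add_mono)
      show "(\<integral>\<^sup>+w. indicator {a..r} w * ennreal ((P w + \<mu>)\<^sup>2 * exp (2 * \<phi> w) * (norm (X w))\<^sup>2) \<partial>lborel) \<le> ?B"
        by (intro nn_integral_mono) (auto simp: indicator_def)
      have "f r - f a \<le> e + 4 * \<mu> ^ 3 * exp (2 * \<phi> a) * (norm (V a))\<^sup>2"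
        using fle[OF ar] r(2) fa by simp
      then have "ennreal (f r - f a) \<le> ennreal (4 * \<mu> ^ 3 * exp (2 * \<phi> a) * (norm (V a))\<^sup>2 + e)"
        by (intro ennreal_leI) simp
      also have "\<dots> = ?C + ennreal e" using \<mu> e by (intro ennreal_plus) auto
      finally show "ennreal (f r - f a) \<le> ?C + ennreal e" .
    qed
    finally show "(\<integral>\<^sup>+w. indicator {a..a + real n} w * ennreal (m * exp (2 * \<phi> w) * (norm (V w))\<^sup>2) \<partial>lborel) \<le> ?B + ?C + ennreal e"
      by (simp add: add.assoc)
  qed
  have contV: "continuous_on {a..} V"
    using has_vector_derivative_continuous[OF V] by (intro continuous_at_imp_continuous_on) auto
  have meas: "(\<lambda>w. indicator {a..a + real n} w * ennreal (m * exp (2 * \<phi> w) * (norm (V w))\<^sup>2)) \<in> borel_measurable lborel" for n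
  proof -
    have "continuous_on {a..a + real n} (\<lambda>w. m * exp (2 * \<phi> w) * (norm (V w))\<^sup>2)"
      by (intro continuous_intros continuous_on_subset[OF weight_continuous(1)[OF wt]] continuous_on_subset[OF contV]) auto
    then have "(\<lambda>w. indicator {a..a + real n} w *\<^sub>R (m * exp (2 * \<phi> w) * (norm (V w))\<^sup>2)) \<in> borel_measurable borel"
      by (intro borel_measurable_continuous_on_indicator) auto
    then have "(\<lambda>w. ennreal (indicator {a..a + real n} w *\<^sub>R (m * exp (2 * \<phi> w) * (norm (V w))\<^sup>2))) \<in> borel_measurable borel"
      by measurable
    moreover have "ennreal (indicator {a..a + real n} w *\<^sub>R y) = indicator {a..a + real n} w * ennreal y" for w y
      by (simp add: indicator_def)
    ultimately show ?thesis by simp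
  qed
  have "?A = (\<integral>\<^sup>+w. (SUP n. indicator {a..a + real n} w * ennreal (m * exp (2 * \<phi> w) * (norm (V w))\<^sup>2)) \<partial>lborel)"
  proof (rule nn_integral_cong)
    fix w
    have "(SUP n. indicator {a..a + real n} w * ennreal y) = indicator {a..} w * ennreal y" for y
    proof (cases "a \<le> w")
      case True
      obtain n where n: "w - a \<le> real n" using real_arch_simple by blast
      have "(SUP n. indicator {a..a + real n} w * ennreal y) = ennreal y"
      proof (rule antisym)
        show "(SUP n. indicator {a..a + real n} w * ennreal y) \<le> ennreal y"
          by (intro SUP_least) (auto simp: indicator_def)
        show "ennreal y \<le> (SUP n. indicator {a..a + real n} w * ennreal y)"
          using n True by (intro SUP_upper2[of n]) auto
      qed
      then show ?thesis using True by simp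
    qed simp
    then show "indicator {a..} w * ennreal (m * exp (2 * \<phi> w) * (norm (V w))\<^sup>2) = (SUP n. indicator {a..a + real n} w * ennreal (m * exp (2 * \<phi> w) * (norm (V w))\<^sup>2))"
      by simp
  qed
  also have "\<dots> = (SUP n. (\<integral>\<^sup>+w. indicator {a..a + real n} w * ennreal (m * exp (2 * \<phi> w) * (norm (V w))\<^sup>2) \<partial>lborel))"
    by (intro nn_integral_monotone_convergence_SUP meas) (auto simp: incseq_def le_fun_def indicator_def)
  also have "\<dots> \<le> ?B + ?C" by (intro SUP_least part)
  finally show ?thesis .
qed

section \<open>From the weak mode equation to a classical first-order system\<close>

definition loc_int :: "(real \<Rightarrow> complex) \<Rightarrow> bool" where
  "loc_int U \<longleftrightarrow> U \<in> borel_measurable borel \<and> (\<forall>a b. set_integrable lborel {a..b} U)"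

lemma loc_int_continuous_mult:
  assumes U: "loc_int U" and g: "continuous_on UNIV (g :: real \<Rightarrow> complex)"
  shows "loc_int (\<lambda>x. g x * U x)"
  unfolding loc_int_def
proof (intro conjI allI)
  have [measurable]: "U \<in> borel_measurable borel" "g \<in> borel_measurable borel"
    using U g by (auto simp: loc_int_def intro: borel_measurable_continuous_onI)
  show "(\<lambda>x. g x * U x) \<in> borel_measurable borel" by measurable
  fix a b :: real
  have "compact (g ` {a..b})" using g continuous_on_subset by (intro compact_continuous_image) blast+
  then have "bounded (g ` {a..b})" by (rule compact_imp_bounded)
  then obtain B where B: "\<forall>y\<in>g ` {a..b}. norm y \<le> B" unfolding bounded_iff by blast
  have "integrable lborel (\<lambda>x. indicator {a..b} x *\<^sub>R U x)"
    using U by (auto simp: loc_int_def set_integrable_def)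
  then have "integrable lborel (\<lambda>x. B *\<^sub>R (indicator {a..b} x *\<^sub>R U x))"
    by (rule integrable_scaleR_right)
  then show "set_integrable lborel {a..b} (\<lambda>x. g x * U x)"
    unfolding set_integrable_def
  proof (rule Bochner_Integration.integrable_bound)
    show "AE x in lborel. norm (indicator {a..b} x *\<^sub>R (g x * U x)) \<le> norm (B *\<^sub>R (indicator {a..b} x *\<^sub>R U x))"
    proof (rule AE_I2)
      fix x
      have "norm (g x) * norm (U x) \<le> \<bar>B\<bar> * norm (U x)" if "x \<in> {a..b}"
        using B that by (intro mult_right_mono) (fastforce intro: order_trans[OF _ abs_ge_self])+
      then show "norm (indicator {a..b} x *\<^sub>R (g x * U x)) \<le> norm (B *\<^sub>R (indicator {a..b} x *\<^sub>R U x))"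
        by (auto simp: indicator_def norm_mult)
    qed
  qed measurable
qed

lemma loc_int_add: "loc_int U \<Longrightarrow> loc_int V \<Longrightarrow> loc_int (\<lambda>x. U x + V x)"
  unfolding loc_int_def by (auto intro: set_integral_add(1))

lemma loc_int_test: "loc_int U \<Longrightarrow> test_seq c D \<Longrightarrow> integrable lborel (\<lambda>x. U x * of_real (D n x))"
  by (rule integrable_mult_test_seq) (auto simp: loc_int_def)

lemma continuous_on_exp_of_real: "continuous_on UNIV (\<lambda>x::real. complex_of_real (exp (\<mu> * x)))"
  by (intro continuous_intros)

lemma set_integral_eq_integral_Icc:
  assumes "loc_int G" shows "(LINT t:{c..x}|lborel. G t) = integral {c..x} G" "G integrable_on {c..x}"
  using assms set_borel_integral_eq_integral[of "{c..x}" G] by (auto simp: loc_int_def)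

lemma continuous_on_primitive:
  assumes "loc_int G" shows "continuous_on {c..} (\<lambda>x. LINT t:{c..x}|lborel. G t)"
proof -
  have "continuous_on {c..B} (\<lambda>x. LINT t:{c..x}|lborel. G t)" for B
    unfolding set_integral_eq_integral_Icc[OF assms]
    by (rule indefinite_integral_continuous_1) (rule set_integral_eq_integral_Icc[OF assms])
  then have "continuous (at x within {c..}) (\<lambda>x. LINT t:{c..x}|lborel. G t)" if "x \<ge> c" for x
  proof -
    have "continuous (at x within {c..x+1}) (\<lambda>x. LINT t:{c..x}|lborel. G t)"
      using \<open>\<And>B. continuous_on {c..B} _\<close>[of "x+1"] that by (auto simp: continuous_on_eq_continuous_within)
    moreover have "at x within {c..x+1} = at x within {c..}"
      by (rule at_within_nhd[of _ "{x-1<..<x+1}"]) auto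
    ultimately show ?thesis by simp
  qed
  then show ?thesis by (auto simp: continuous_on_eq_continuous_within)
qed

lemma L2_imp_limit_zero:
  fixes X Y :: "real \<Rightarrow> complex"
  assumes X: "integrable lborel (\<lambda>w. (norm (X w))\<^sup>2)" "X \<in> borel_measurable borel"
    and ae: "AE w in lborel. b < w \<longrightarrow> norm (Y w) \<le> norm (X w)"
    and lim: "(Y \<longlongrightarrow> L) at_top"
  shows "L = 0"
proof (rule ccontr)
  assume "L \<noteq> 0"
  then have L: "norm L > 0" by simp
  have "((\<lambda>w. norm (Y w)) \<longlongrightarrow> norm L) at_top" using lim by (rule tendsto_norm)
  then have "eventually (\<lambda>w. norm L / 2 < norm (Y w)) at_top"
    using L by (intro order_tendstoD) auto
  then obtain w0 where w0: "\<And>w. w \<ge> w0 \<Longrightarrow> norm L / 2 < norm (Y w)" by (auto simp: eventually_at_top_linorder)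
  define c where "c = max w0 (b + 1)"
  have "(\<integral>\<^sup>+w. ennreal ((norm L / 2)\<^sup>2) * indicator {c..} w \<partial>lborel) \<le> (\<integral>\<^sup>+w. ennreal ((norm (X w))\<^sup>2) \<partial>lborel)"
  proof (rule nn_integral_mono_AE, use ae in eventually_elim)
    case (elim w)
    have "(norm L / 2)\<^sup>2 \<le> (norm (X w))\<^sup>2" if "c \<le> w"
      using elim w0[of w] that L by (intro power_mono) (auto simp: c_def)
    then show ?case by (auto simp: indicator_def intro: ennreal_leI)
  qed
  also have "\<dots> < \<infinity>"
    using X(1) by (simp add: integrable_iff_bounded)
  finally have "emeasure lborel {c..} < \<infinity>"
    using L by (auto simp: nn_integral_cmult_indicator ennreal_mult_less_top)
  moreover have "emeasure lborel {c..} = \<infinity>" by (rule emeasure_lborel_Ici)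
  ultimately show False by simp
qed

text \<open>The equation \<open>U'' = \<mu>\<^sup>2 U + F\<close> is solved as the system \<open>U' = X - \<mu> U\<close>, \<open>X' = \<mu> X + F\<close>; since
  \<open>X\<close> is square integrable, its growing mode is absent and \<open>X\<close> is determined by \<open>F\<close>.\<close>

lemma mode_regularity:
  fixes U U1 F :: "real \<Rightarrow> complex"
  assumes U: "loc_int U" and U1: "loc_int U1" and F: "integrable lborel F"
    and L2: "integrable lborel (\<lambda>w. (norm (U1 w + of_real \<mu> * U w))\<^sup>2)"
    and weak1: "\<And>D. test_seq b D \<Longrightarrow> (LINT w|lborel. U w * of_real (D 1 w)) = - (LINT w|lborel. U1 w * of_real (D 0 w))"
    and weak2: "\<And>D. test_seq b D \<Longrightarrow> (LINT w|lborel. U w * of_real (D 2 w)) = (LINT w|lborel. (of_real (\<mu>\<^sup>2) * U w + F w) * of_real (D 0 w))"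
    and \<mu>: "0 \<le> \<mu>" and b: "0 \<le> b"
  obtains V X :: "real \<Rightarrow> complex" where "AE w in lborel. b < w \<longrightarrow> U w = V w"
    and "\<And>w. b < w \<Longrightarrow> (V has_vector_derivative (X w - of_real \<mu> * V w)) (at w)"
    and "continuous_on {b..} X"
    and "\<And>w. b \<le> w \<Longrightarrow> norm (X w) \<le> (LINT s:{w..}|lborel. exp (\<mu> * (w - s)) * norm (F s))"
proof -
  define X0 where "X0 w = U1 w + of_real \<mu> * U w" for w
  define e where "e c x = complex_of_real (exp (c * x))" for c x :: real
  have e_cont: "continuous_on UNIV (e c)" for c unfolding e_def by (rule continuous_on_exp_of_real)
  have e_add: "e c x * e (- c) x = 1" for c x by (simp add: e_def exp_minus)
  have [measurable]: "e c \<in> borel_measurable borel" for c by (intro borel_measurable_continuous_onI e_cont)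
  have Fl: "loc_int F"
    using F integrable_mult_indicator[OF _ F] by (auto simp: loc_int_def set_integrable_def)
  have \<mu>U: "loc_int (\<lambda>w. of_real \<mu> * U w)" by (rule loc_int_continuous_mult[OF U]) (rule continuous_on_const)
  have X0: "loc_int X0" unfolding X0_def by (rule loc_int_add[OF U1 \<mu>U])
  have ml: "loc_int (\<lambda>w. e c w * f w)" if "loc_int f" for c f
    by (rule loc_int_continuous_mult[OF that e_cont])
  have meas [measurable]: "U \<in> borel_measurable borel" "U1 \<in> borel_measurable borel" "F \<in> borel_measurable borel" "X0 \<in> borel_measurable borel"
    using U U1 Fl X0 by (auto simp: loc_int_def)
  \<comment> \<open>Integrating factor for X' = \<mu> X + F: the product exp(-\<mu> w) X has
    derivative exp(-\<mu> w) F. Weakly, this means testing with exp(-\<mu> w) D.\<close>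
  define G where "G w = e (-\<mu>) w * F w" for w
  have G: "loc_int G" unfolding G_def by (rule ml[OF Fl])
  have "\<exists>k. AE x in lborel. b < x \<longrightarrow> e (-\<mu>) x * X0 x = k + (LINT t:{b..x}|lborel. G t)"
  proof (rule weak_primitive)
    show "(\<lambda>x. e (-\<mu>) x * X0 x) \<in> borel_measurable borel" "\<And>a b. set_integrable lborel {a..b} (\<lambda>x. e (-\<mu>) x * X0 x)"
      using ml[OF X0] by (auto simp: loc_int_def)
    show "G \<in> borel_measurable borel" "\<And>a b. set_integrable lborel {a..b} G"
      using G by (auto simp: loc_int_def)
    fix D assume D: "test_seq b D"
    obtain E where E: "test_seq b E" "\<And>x. E 0 x = exp (-\<mu> * x) * D 0 x" "\<And>x. E 1 x = exp (-\<mu> * x) * (D 1 x + (-\<mu>) * D 0 x)"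
      using test_seq_exp_mult[OF D, of "-\<mu>"] by blast
    note i = loc_int_test[OF U E(1)] loc_int_test[OF U1 E(1)] loc_int_test[OF Fl E(1)]
    have w2: "(LINT w|lborel. U w * of_real (E 2 w)) = - (LINT w|lborel. U1 w * of_real (E 1 w))"
      using weak1[OF test_seq_shift[OF E(1)]] by (simp add: numeral_2_eq_2)
    have "(LINT x|lborel. e (-\<mu>) x * X0 x * of_real (D 1 x)) =
      (LINT x|lborel. U1 x * of_real (E 1 x) + of_real \<mu> * (U x * of_real (E 1 x)) + of_real \<mu> * (U1 x * of_real (E 0 x))
         + of_real (\<mu>\<^sup>2) * (U x * of_real (E 0 x)))"
      by (rule Bochner_Integration.integral_cong) (auto simp: X0_def e_def E(2) E(3)[unfolded One_nat_def] power2_eq_square algebra_simps)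
    also have "\<dots> = (LINT x|lborel. U1 x * of_real (E 1 x)) + of_real \<mu> * (LINT x|lborel. U x * of_real (E 1 x))
       + of_real \<mu> * (LINT x|lborel. U1 x * of_real (E 0 x)) + of_real (\<mu>\<^sup>2) * (LINT x|lborel. U x * of_real (E 0 x))"
      using i by simp
    also have "\<dots> = of_real (\<mu>\<^sup>2) * (LINT x|lborel. U x * of_real (E 0 x)) - (LINT x|lborel. (of_real (\<mu>\<^sup>2) * U x + F x) * of_real (E 0 x))"
      using w2 weak2[OF E(1)] weak1[OF E(1)] by simp
    also have "(LINT x|lborel. (of_real (\<mu>\<^sup>2) * U x + F x) * of_real (E 0 x)) =
      (LINT x|lborel. of_real (\<mu>\<^sup>2) * (U x * of_real (E 0 x)) + F x * of_real (E 0 x))"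
      by (simp add: algebra_simps)
    also have "\<dots> = of_real (\<mu>\<^sup>2) * (LINT x|lborel. U x * of_real (E 0 x)) + (LINT x|lborel. F x * of_real (E 0 x))"
      using i by simp
    also have "(LINT x|lborel. F x * of_real (E 0 x)) = (LINT x|lborel. G x * of_real (D 0 x))"
      by (simp add: G_def E(2) e_def mult_ac)
    finally show "(LINT x|lborel. e (-\<mu>) x * X0 x * of_real (D 1 x)) = - (LINT x|lborel. G x * of_real (D 0 x))"
      by simp
  qed
  then obtain k where k: "AE x in lborel. b < x \<longrightarrow> e (-\<mu>) x * X0 x = k + (LINT t:{b..x}|lborel. G t)" by blast
  define Y where "Y x = k + (LINT t:{b..x}|lborel. G t)" for x
  define X where "X x = e \<mu> x * Y x" for x
  have X0X: "AE x in lborel. b < x \<longrightarrow> X0 x = X x"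
    using k
  proof eventually_elim
    case (elim x)
    show ?case
    proof
      assume "b < x"
      then have "X x = e \<mu> x * (e (-\<mu>) x * X0 x)" using elim by (simp add: X_def Y_def)
      also have "\<dots> = X0 x" by (simp only: mult.assoc[symmetric] e_add mult_1_left)
      finally show "X0 x = X x" by simp
    qed
  qed
  have Ycont: "continuous_on {b..} Y" unfolding Y_def
    by (intro continuous_intros continuous_on_primitive G)
  have Xcont: "continuous_on {b..} X" unfolding X_def
    by (intro continuous_intros Ycont continuous_on_subset[OF e_cont]) auto
  have Gi: "set_integrable lborel {w..} G" if "b \<le> w" for w
    unfolding set_integrable_def
  proof (rule Bochner_Integration.integrable_bound[OF F])
    show "AE x in lborel. norm (indicator {w..} x *\<^sub>R G x) \<le> norm (F x)"
      using that b \<mu> by (intro AE_I2) (auto simp: indicator_def G_def e_def norm_mult intro!: mult_left_le_one_le)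
  qed (simp add: G_def)
  have lim: "(Y \<longlongrightarrow> k + (LINT t:{b..}|lborel. G t)) at_top"
    unfolding Y_def by (intro tendsto_intros tendsto_set_lebesgue_integral_at_top Gi) auto
  \<comment> \<open>The limit of \<open>Y\<close> at infinity is the coefficient of exp(\<mu> w) in
    X. Since exp(\<mu> w) \<ge> 1 for w > b \<ge> 0, \<open>Y\<close> is dominated by the square
    integrable \<open>X0\<close>, so this limit is 0 and X is an integral of F from infinity. The
    bound also covers \<mu> = 0.\<close>
  have "k + (LINT t:{b..}|lborel. G t) = 0"
  proof (rule L2_imp_limit_zero[OF _ _ _ lim])
    show "integrable lborel (\<lambda>w. (norm (X0 w))\<^sup>2)" using L2 by (simp add: X0_def)
    show "AE w in lborel. b < w \<longrightarrow> norm (Y w) \<le> norm (X0 w)"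
      using X0X
    proof eventually_elim
      case (elim w)
      have "1 * norm (Y w) \<le> norm (e \<mu> w) * norm (Y w)" if "b < w"
        using that b \<mu> by (intro mult_right_mono) (auto simp: e_def)
      then show ?case using elim by (auto simp: X_def norm_mult)
    qed
  qed measurable
  then have keq: "k = - (LINT t:{b..}|lborel. G t)" by (simp add: add_eq_0_iff2)
  have Xbound: "norm (X w) \<le> (LINT s:{w..}|lborel. exp (\<mu> * (w - s)) * norm (F s))" if w: "b \<le> w" for w
  proof -
    have "{b..} = {b..w} \<union> {w<..}" using w by auto
    have "(LINT t:{b..}|lborel. G t) = (LINT t:{b..w}|lborel. G t) + (LINT t:{w<..}|lborel. G t)"
      unfolding \<open>{b..} = _\<close> by (rule set_integral_Un) (use w in \<open>auto intro!: set_integrable_subset[OF Gi[of b]]\<close>)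
    then have "Y w = - (LINT t:{w<..}|lborel. G t)" by (simp add: Y_def keq)
    also have "(LINT t:{w<..}|lborel. G t) = (LINT t:{w..}|lborel. G t)"
      unfolding set_lebesgue_integral_def
    proof (rule integral_cong_AE)
      show "AE t in lborel. indicator {w<..} t *\<^sub>R G t = indicator {w..} t *\<^sub>R G t"
        using AE_lborel_singleton[of w] by eventually_elim (auto simp: indicator_def)
    qed (auto simp: G_def)
    finally have Yw: "Y w = - (LINT t:{w..}|lborel. G t)" .
    have "norm (X w) = norm (e \<mu> w * (LINT t:{w..}|lborel. G t))" by (simp add: X_def Yw norm_mult)
    also have "e \<mu> w * (LINT t:{w..}|lborel. G t) = (LINT t|lborel. e \<mu> w * (indicator {w..} t *\<^sub>R G t))"
      unfolding set_lebesgue_integral_def by (rule integral_mult_right_zero[symmetric])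
    also have "norm \<dots> \<le> (LINT t|lborel. norm (e \<mu> w * (indicator {w..} t *\<^sub>R G t)))"
      by (rule integral_norm_bound)
    also have "\<dots> = (LINT s:{w..}|lborel. exp (\<mu> * (w - s)) * norm (F s))"
      unfolding set_lebesgue_integral_def
    proof (rule Bochner_Integration.integral_cong)
      fix t
      have "exp (\<mu> * (w - t)) = exp (\<mu> * w) * exp (- \<mu> * t)"
        by (simp add: right_diff_distrib flip: exp_add)
      then have ee: "e \<mu> w * G t = of_real (exp (\<mu> * (w - t))) * F t" by (simp add: G_def e_def)
      show "norm (e \<mu> w * (indicator {w..} t *\<^sub>R G t)) = indicator {w..} t *\<^sub>R (exp (\<mu> * (w - t)) * norm (F t))"
        unfolding mult_scaleR_right ee by (simp only: norm_scaleR norm_mult norm_of_real) simp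
    qed simp
    finally show ?thesis .
  qed
  \<comment> \<open>The second integration, for U' = X - \<mu> U, with integrating factor exp(\<mu>
    w). It runs forward from b, since the homogeneous solution exp(-\<mu> w) is not excluded by
    decay.\<close>
  define G2 where "G2 w = e \<mu> w * X0 w" for w
  have G2: "loc_int G2" unfolding G2_def by (rule ml[OF X0])
  have "\<exists>k. AE x in lborel. b < x \<longrightarrow> e \<mu> x * U x = k + (LINT t:{b..x}|lborel. G2 t)"
  proof (rule weak_primitive)
    show "(\<lambda>x. e \<mu> x * U x) \<in> borel_measurable borel" "\<And>a b. set_integrable lborel {a..b} (\<lambda>x. e \<mu> x * U x)"
      using ml[OF U] by (auto simp: loc_int_def)
    show "G2 \<in> borel_measurable borel" "\<And>a b. set_integrable lborel {a..b} G2"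
      using G2 by (auto simp: loc_int_def)
    fix D assume D: "test_seq b D"
    obtain E where E: "test_seq b E" "\<And>x. E 0 x = exp (\<mu> * x) * D 0 x" "\<And>x. E 1 x = exp (\<mu> * x) * (D 1 x + \<mu> * D 0 x)"
      using test_seq_exp_mult[OF D, of "\<mu>"] by blast
    note i = loc_int_test[OF U E(1)] loc_int_test[OF U1 E(1)]
    have "(LINT x|lborel. e \<mu> x * U x * of_real (D 1 x)) =
      (LINT x|lborel. U x * of_real (E 1 x) - of_real \<mu> * (U x * of_real (E 0 x)))"
      by (rule Bochner_Integration.integral_cong) (auto simp: e_def E(2) E(3)[unfolded One_nat_def] algebra_simps)
    also have "\<dots> = - (LINT x|lborel. U1 x * of_real (E 0 x)) - of_real \<mu> * (LINT x|lborel. U x * of_real (E 0 x))"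
      using i weak1[OF E(1)] by simp
    also have "\<dots> = - (LINT x|lborel. U1 x * of_real (E 0 x) + of_real \<mu> * (U x * of_real (E 0 x)))"
      using i by simp
    also have "(LINT x|lborel. U1 x * of_real (E 0 x) + of_real \<mu> * (U x * of_real (E 0 x))) = (LINT x|lborel. G2 x * of_real (D 0 x))"
      by (rule Bochner_Integration.integral_cong) (auto simp: e_def E(2) G2_def X0_def algebra_simps)
    finally show "(LINT x|lborel. e \<mu> x * U x * of_real (D 1 x)) = - (LINT x|lborel. G2 x * of_real (D 0 x))" .
  qed
  then obtain k2 where k2: "AE x in lborel. b < x \<longrightarrow> e \<mu> x * U x = k2 + (LINT t:{b..x}|lborel. G2 t)" by blast
  define H where "H x = k2 + integral {b..x} (\<lambda>t. e \<mu> t * X t)" for x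
  define V where "V x = e (-\<mu>) x * H x" for x
  have G2eq: "(LINT t:{b..x}|lborel. G2 t) = integral {b..x} (\<lambda>t. e \<mu> t * X t)" for x
  proof -
    have c: "continuous_on {b..x} (\<lambda>t. e \<mu> t * X t)"
      by (intro continuous_intros continuous_on_subset[OF e_cont] continuous_on_subset[OF Xcont]) auto
    have "(LINT t:{b..x}|lborel. G2 t) = (LINT t:{b..x}|lborel. e \<mu> t * X t)"
      unfolding set_lebesgue_integral_def
    proof (rule integral_cong_AE)
      show "AE t in lborel. indicator {b..x} t *\<^sub>R G2 t = indicator {b..x} t *\<^sub>R (e \<mu> t * X t)"
        using X0X AE_lborel_singleton[of b] by eventually_elim (auto simp: indicator_def G2_def)
      show "(\<lambda>t. indicator {b..x} t *\<^sub>R (e \<mu> t * X t)) \<in> borel_measurable lborel"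
        using borel_measurable_continuous_on_indicator[OF _ c] by simp
    qed (simp add: G2_def)
    also have "\<dots> = integral {b..x} (\<lambda>t. e \<mu> t * X t)"
      by (rule set_borel_integral_eq_integral(2)[OF borel_integrable_atLeastAtMost'[OF c]])
    finally show ?thesis .
  qed
  have UV: "AE x in lborel. b < x \<longrightarrow> U x = V x"
    using k2
  proof eventually_elim
    case (elim x)
    show ?case
    proof
      assume "b < x"
      then have "V x = e (-\<mu>) x * (e \<mu> x * U x)" using elim by (simp add: V_def H_def G2eq)
      also have "\<dots> = U x" using e_add[of "-\<mu>" x] by (simp only: mult.assoc[symmetric] minus_minus mult_1_left)
      finally show "U x = V x" by simp
    qed
  qed
  have dV: "(V has_vector_derivative (X w - of_real \<mu> * V w)) (at w)" if w: "b < w" for w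
  proof -
    have c: "continuous_on {b..w+1} (\<lambda>t. e \<mu> t * X t)"
      by (intro continuous_intros continuous_on_subset[OF e_cont] continuous_on_subset[OF Xcont]) auto
    have "((\<lambda>u. integral {b..u} (\<lambda>t. e \<mu> t * X t)) has_vector_derivative e \<mu> w * X w) (at w within {b..w+1})"
      by (rule integral_has_vector_derivative[OF c]) (use w in auto)
    then have "((\<lambda>u. integral {b..u} (\<lambda>t. e \<mu> t * X t)) has_vector_derivative e \<mu> w * X w) (at w within {b<..<w+1})"
      by (rule has_vector_derivative_within_subset) auto
    then have "((\<lambda>u. integral {b..u} (\<lambda>t. e \<mu> t * X t)) has_vector_derivative e \<mu> w * X w) (at w)"
      by (subst (asm) at_within_open) (use w in auto)
    then have dH: "(H has_vector_derivative e \<mu> w * X w) (at w)"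
      unfolding H_def by (auto intro!: derivative_eq_intros)
    have de: "(e (-\<mu>) has_vector_derivative (of_real (-\<mu>) * e (-\<mu>) w)) (at w)"
    proof -
      have "((\<lambda>x. exp (-\<mu> * x)) has_real_derivative (exp (-\<mu> * w) * (-\<mu>))) (at w)"
        by (auto intro!: derivative_eq_intros)
      have eeq: "e (-\<mu>) = (\<lambda>x. complex_of_real (exp (-\<mu> * x)))" by (simp add: e_def fun_eq_iff)
      from has_vector_derivative_of_real[OF \<open>(_ has_real_derivative _) _\<close>]
      have "(e (-\<mu>) has_vector_derivative complex_of_real (exp (-\<mu> * w) * (-\<mu>))) (at w)"
        unfolding eeq .
      also have "complex_of_real (exp (-\<mu> * w) * (-\<mu>)) = of_real (-\<mu>) * e (-\<mu>) w"
        by (simp add: e_def mult.commute)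
      finally show ?thesis .
    qed
    have "(V has_vector_derivative (e (-\<mu>) w * (e \<mu> w * X w) + of_real (-\<mu>) * e (-\<mu>) w * H w)) (at w)"
      unfolding V_def by (rule has_vector_derivative_mult[OF de dH])
    also have "e (-\<mu>) w * (e \<mu> w * X w) + of_real (-\<mu>) * e (-\<mu>) w * H w = X w - of_real \<mu> * V w"
      using e_add[of "-\<mu>" w] by (simp add: V_def mult.assoc[symmetric])
    finally show ?thesis .
  qed
  show ?thesis by (rule that[OF UV dV Xcont Xbound])
qed

text \<open>\<open>kernel_estimate\<close> bounds the term with X in the energy estimate by F. The
  representative \<open>V\<close> is fixed before a and the weight, so its value at a is a pointwise
  quantity shared by all weights.\<close>

lemma mode_carleman:
  fixes U U1 F :: "real \<Rightarrow> complex"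
  assumes U: "loc_int U" and U1: "loc_int U1" and F: "integrable lborel F"
    and L2: "integrable lborel (\<lambda>w. (norm (U1 w + of_real \<mu> * U w))\<^sup>2)"
    and weak1: "\<And>D. test_seq b D \<Longrightarrow> (LINT w|lborel. U w * of_real (D 1 w)) = - (LINT w|lborel. U1 w * of_real (D 0 w))"
    and weak2: "\<And>D. test_seq b D \<Longrightarrow> (LINT w|lborel. U w * of_real (D 2 w)) = (LINT w|lborel. (of_real (\<mu>\<^sup>2) * U w + F w) * of_real (D 0 w))"
    and \<mu>: "0 \<le> \<mu>" and b: "0 \<le> b"
  obtains V :: "real \<Rightarrow> complex" where "AE w in lborel. b < w \<longrightarrow> U w = V w"
    and "\<And>a \<phi> P Q m. b < a \<Longrightarrow> weight a \<phi> P Q \<Longrightarrow> 0 \<le> m \<Longrightarrow>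
      (\<And>w. a \<le> w \<Longrightarrow> m \<le> (P w + \<mu>)\<^sup>2 * (P w - \<mu>)\<^sup>2 + Q w * (P w + \<mu>) * (3 * P w - \<mu>)) \<Longrightarrow>
      (\<integral>\<^sup>+w. indicator {a..} w * ennreal ((P w + \<mu>) ^ 3 * exp (2 * \<phi> w) * (norm (U w))\<^sup>2) \<partial>lborel) < \<infinity> \<Longrightarrow>
      (\<integral>\<^sup>+w. indicator {a..} w * ennreal (m * exp (2 * \<phi> w) * (norm (U w))\<^sup>2) \<partial>lborel) \<le>
      (\<integral>\<^sup>+w. indicator {a..} w * ennreal (exp (2 * \<phi> w) * (norm (F w))\<^sup>2) \<partial>lborel) +
      ennreal (4 * \<mu> ^ 3 * exp (2 * \<phi> a) * (norm (V a))\<^sup>2)"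
proof -
  obtain V X :: "real \<Rightarrow> complex" where UV: "AE w in lborel. b < w \<longrightarrow> U w = V w"
    and dV: "\<And>w. b < w \<Longrightarrow> (V has_vector_derivative (X w - of_real \<mu> * V w)) (at w)"
    and Xc: "continuous_on {b..} X"
    and Xb: "\<And>w. b \<le> w \<Longrightarrow> norm (X w) \<le> (LINT s:{w..}|lborel. exp (\<mu> * (w - s)) * norm (F s))"
    by (rule mode_regularity[OF assms], assumption, assumption, rule that; assumption)
  show ?thesis
  proof (rule that[OF UV])
    fix a m :: real and \<phi> P Q :: "real \<Rightarrow> real"
    assume ba: "b < a" and wt: "weight a \<phi> P Q" and m: "0 \<le> m"
      and W: "\<And>w. a \<le> w \<Longrightarrow> m \<le> (P w + \<mu>)\<^sup>2 * (P w - \<mu>)\<^sup>2 + Q w * (P w + \<mu>) * (3 * P w - \<mu>)"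
      and fin: "(\<integral>\<^sup>+w. indicator {a..} w * ennreal ((P w + \<mu>) ^ 3 * exp (2 * \<phi> w) * (norm (U w))\<^sup>2) \<partial>lborel) < \<infinity>"
    have UVa: "AE w in lborel. indicator {a..} w * ennreal (h w * (norm (U w))\<^sup>2) = indicator {a..} w * ennreal (h w * (norm (V w))\<^sup>2)" for h :: "real \<Rightarrow> real"
      using UV by eventually_elim (use ba in \<open>auto simp: indicator_def\<close>)
    have [measurable]: "\<phi> \<in> borel_measurable borel" "P \<in> borel_measurable borel" "F \<in> borel_measurable borel"
      using wt F by (auto simp: weight_def)
    have fin': "(\<integral>\<^sup>+w. indicator {a..} w * ennreal ((P w + \<mu>) ^ 3 * exp (2 * \<phi> w) * (norm (V w))\<^sup>2) \<partial>lborel) < \<infinity>"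
      using fin nn_integral_cong_AE[OF UVa[of "\<lambda>w. (P w + \<mu>) ^ 3 * exp (2 * \<phi> w)"]] by simp
    have dVa: "(V has_vector_derivative (X w - of_real \<mu> * V w)) (at w)" if "a \<le> w" for w
      using dV that ba by simp
    have Xca: "continuous_on {a..} X" using Xc by (rule continuous_on_subset) (use ba in auto)
    have "(\<integral>\<^sup>+w. indicator {a..} w * ennreal (m * exp (2 * \<phi> w) * (norm (U w))\<^sup>2) \<partial>lborel) =
      (\<integral>\<^sup>+w. indicator {a..} w * ennreal (m * exp (2 * \<phi> w) * (norm (V w))\<^sup>2) \<partial>lborel)"
      by (rule nn_integral_cong_AE[OF UVa[of "\<lambda>w. m * exp (2 * \<phi> w)"]])
    also have "\<dots> \<le> (\<integral>\<^sup>+w. indicator {a..} w * ennreal ((P w + \<mu>)\<^sup>2 * exp (2 * \<phi> w) * (norm (X w))\<^sup>2) \<partial>lborel) +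
      ennreal (4 * \<mu> ^ 3 * exp (2 * \<phi> a) * (norm (V a))\<^sup>2)"
      by (rule energy_estimate[OF wt dVa Xca \<mu> W m fin'])
    also have "(\<integral>\<^sup>+w. indicator {a..} w * ennreal ((P w + \<mu>)\<^sup>2 * exp (2 * \<phi> w) * (norm (X w))\<^sup>2) \<partial>lborel) \<le>
      (\<integral>\<^sup>+w. indicator {a..} w * ennreal (exp (2 * \<phi> w) * (norm (F w))\<^sup>2) \<partial>lborel)"
    proof -
      \<comment> \<open>Multiplication by exp \<phi> turns the kernel exp(\<mu> (w - s)) into
        exp(\<Phi> w - \<Phi> s). The derivative of \<Phi> is P + \<mu>, exactly the factor attached
        to X by the energy estimate, so the two estimates match without loss.\<close>
      define \<Phi> p g where "\<Phi> w = \<phi> w + \<mu> * w" and "p w = P w + \<mu>" and "g w = exp (\<phi> w) * norm (F w)" for w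
      have [measurable]: "\<Phi> \<in> borel_measurable borel" "p \<in> borel_measurable borel" "g \<in> borel_measurable borel"
        unfolding \<Phi>_def p_def g_def by measurable
      have lim: "filterlim \<Phi> at_top at_top"
      proof (rule filterlim_at_top_mono)
        show "filterlim \<phi> at_top at_top" using wt by (simp add: weight_def)
        show "\<forall>\<^sub>F w in at_top. \<phi> w \<le> \<Phi> w"
          using eventually_ge_at_top[of 0] by eventually_elim (use \<mu> in \<open>simp add: \<Phi>_def\<close>)
      qed
      have *: "indicator {a..} w * ennreal ((P w + \<mu>)\<^sup>2 * exp (2 * \<phi> w) * (norm (X w))\<^sup>2) \<le>
        indicator {a..} w * (ennreal (p w) * (\<integral>\<^sup>+s. indicator {w..} s * ennreal (exp (\<Phi> w - \<Phi> s) * \<bar>g s\<bar>) \<partial>lborel))\<^sup>2" for w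
      proof (cases "a \<le> w")
        case True
        have i: "integrable lborel (\<lambda>s. indicator {w..} s *\<^sub>R (exp (\<mu> * (w - s)) * norm (F s)))"
        proof (rule Bochner_Integration.integrable_bound[OF F])
          show "AE s in lborel. norm (indicator {w..} s *\<^sub>R (exp (\<mu> * (w - s)) * norm (F s))) \<le> norm (F s)"
            using \<mu> by (intro AE_I2) (auto simp: indicator_def intro!: mult_left_le_one_le mult_nonneg_nonpos)
        qed measurable
        have "ennreal (exp (\<phi> w) * norm (X w)) \<le> ennreal (exp (\<phi> w) * (LINT s:{w..}|lborel. exp (\<mu> * (w - s)) * norm (F s)))"
          using Xb[of w] True ba by (intro ennreal_leI mult_left_mono) auto
        also have "\<dots> = ennreal (exp (\<phi> w)) * (\<integral>\<^sup>+s. ennreal (indicator {w..} s *\<^sub>R (exp (\<mu> * (w - s)) * norm (F s))) \<partial>lborel)"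
          unfolding set_lebesgue_integral_def
          by (subst nn_integral_eq_integral[OF i]) (auto simp: ennreal_mult')
        also have "\<dots> = (\<integral>\<^sup>+s. ennreal (exp (\<phi> w)) * ennreal (indicator {w..} s *\<^sub>R (exp (\<mu> * (w - s)) * norm (F s))) \<partial>lborel)"
          by (rule nn_integral_cmult[symmetric]) measurable
        also have "\<dots> = (\<integral>\<^sup>+s. indicator {w..} s * ennreal (exp (\<Phi> w - \<Phi> s) * \<bar>g s\<bar>) \<partial>lborel)"
        proof (rule nn_integral_cong)
          fix s
          have "exp (\<phi> w) * (exp (\<mu> * (w - s)) * norm (F s)) = exp (\<Phi> w - \<Phi> s) * \<bar>g s\<bar>"
            unfolding g_def \<Phi>_def abs_mult mult.assoc[symmetric] by (simp add: algebra_simps flip: exp_add)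
          moreover have "ennreal (exp (\<phi> w)) * ennreal (indicator {w..} s *\<^sub>R y) = indicator {w..} s * ennreal (exp (\<phi> w) * y)" for y
            by (auto simp: indicator_def ennreal_mult')
          ultimately show "ennreal (exp (\<phi> w)) * ennreal (indicator {w..} s *\<^sub>R (exp (\<mu> * (w - s)) * norm (F s))) =
            indicator {w..} s * ennreal (exp (\<Phi> w - \<Phi> s) * \<bar>g s\<bar>)" by simp
        qed
        finally have le: "ennreal (exp (\<phi> w) * norm (X w)) \<le> (\<integral>\<^sup>+s. indicator {w..} s * ennreal (exp (\<Phi> w - \<Phi> s) * \<bar>g s\<bar>) \<partial>lborel)" .
        have p0: "0 \<le> p w" using wt True \<mu> by (simp add: weight_def p_def add_pos_nonneg less_imp_le)
        have "(P w + \<mu>)\<^sup>2 * exp (2 * \<phi> w) * (norm (X w))\<^sup>2 = (p w * (exp (\<phi> w) * norm (X w)))\<^sup>2"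
          by (simp add: p_def power_mult_distrib exp_double)
        then have "ennreal ((P w + \<mu>)\<^sup>2 * exp (2 * \<phi> w) * (norm (X w))\<^sup>2) = (ennreal (p w) * ennreal (exp (\<phi> w) * norm (X w)))\<^sup>2"
          using p0 by (simp add: ennreal_power[symmetric] ennreal_mult)
        also have "\<dots> \<le> (ennreal (p w) * (\<integral>\<^sup>+s. indicator {w..} s * ennreal (exp (\<Phi> w - \<Phi> s) * \<bar>g s\<bar>) \<partial>lborel))\<^sup>2"
          using le by (intro power_mono mult_left_mono) auto
        finally show ?thesis using True by simp
      qed simp
      have "(\<integral>\<^sup>+w. indicator {a..} w * ennreal ((P w + \<mu>)\<^sup>2 * exp (2 * \<phi> w) * (norm (X w))\<^sup>2) \<partial>lborel) \<le>
        (\<integral>\<^sup>+w. indicator {a..} w * (ennreal (p w) * (\<integral>\<^sup>+s. indicator {w..} s * ennreal (exp (\<Phi> w - \<Phi> s) * \<bar>g s\<bar>) \<partial>lborel))\<^sup>2 \<partial>lborel)"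
        by (rule nn_integral_mono) (rule *)
      also have "\<dots> \<le> (\<integral>\<^sup>+s. indicator {a..} s * ennreal ((g s)\<^sup>2) \<partial>lborel)"
      proof (rule kernel_estimate[OF _ _ _ lim])
        show "(\<Phi> has_real_derivative p w) (at w)" if "a \<le> w" for w
          using wt that unfolding \<Phi>_def p_def weight_def by (auto intro!: derivative_eq_intros)
        show "0 < p w" if "a \<le> w" for w using wt that \<mu> by (simp add: weight_def p_def add_pos_nonneg)
        show "p x \<le> p y" if "a \<le> x" "x \<le> y" for x y
          using weight_mono[OF wt that] by (simp add: p_def)
      qed measurable
      also have "\<dots> = (\<integral>\<^sup>+w. indicator {a..} w * ennreal (exp (2 * \<phi> w) * (norm (F w))\<^sup>2) \<partial>lborel)"
        by (simp add: g_def power_mult_distrib exp_double)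
      finally show ?thesis .
    qed
    finally show "(\<integral>\<^sup>+w. indicator {a..} w * ennreal (m * exp (2 * \<phi> w) * (norm (U w))\<^sup>2) \<partial>lborel) \<le>
      (\<integral>\<^sup>+w. indicator {a..} w * ennreal (exp (2 * \<phi> w) * (norm (F w))\<^sup>2) \<partial>lborel) +
      ennreal (4 * \<mu> ^ 3 * exp (2 * \<phi> a) * (norm (V a))\<^sup>2)"
      by (simp add: add_mono)
  qed
qed

section \<open>The Carleman inequality on the half-cylinder\<close>

definition cyl_sq :: "(real \<times> (real ^ 'd) \<Rightarrow> complex) \<Rightarrow> bool" where
  "cyl_sq g \<longleftrightarrow> g \<in> borel_measurable borel \<and> (\<forall>z. z \<notin> cyl_domain \<longrightarrow> g z = 0) \<and>
     integrable lborel (\<lambda>z. (norm (g z))\<^sup>2)"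

definition mode :: "(real \<times> (real ^ 'd) \<Rightarrow> complex) \<Rightarrow> int ^ 'd \<Rightarrow> real \<Rightarrow> complex" where
  "mode g k w = fcoef (\<lambda>y. g (w, y)) k"

text \<open>Taken in \<open>ennreal\<close>, since the slice norm is finite for almost every w only;
  Tonelli and the weighted integrals then carry no integrability side conditions.\<close>

definition slice_sq :: "(real \<times> (real ^ 'd) \<Rightarrow> complex) \<Rightarrow> real \<Rightarrow> ennreal" where
  "slice_sq g w = (\<integral>\<^sup>+y. ennreal ((norm (g (w, y)))\<^sup>2) \<partial>lborel)"

definition freq_sq :: "int ^ 'd \<Rightarrow> real" where
  "freq_sq k = (\<Sum>j\<in>UNIV. (of_int (k $ j))\<^sup>2)"

abbreviation tensor_test :: "(nat \<Rightarrow> real \<Rightarrow> real) \<Rightarrow> nat \<Rightarrow> int ^ 'd \<Rightarrow> real \<times> (real ^ 'd) \<Rightarrow> complex" where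
  "tensor_test D n k z \<equiv> of_real (D n (fst z)) * fexp k (snd z)"

lemma freq_sq_nonneg: "0 \<le> freq_sq k"
  by (simp add: freq_sq_def sum_nonneg)

lemma freq_sq_uminus [simp]: "freq_sq (- k) = freq_sq k"
  by (simp add: freq_sq_def)

lemma cyl_sq_measurable:
  assumes "cyl_sq g"
  shows "g \<in> borel_measurable borel" "g \<in> borel_measurable (lborel \<Otimes>\<^sub>M lborel)" "g \<in> borel_measurable (borel \<Otimes>\<^sub>M borel)"
  using assms by (auto simp: cyl_sq_def lborel_prod borel_prod)

lemma slice_sq_measurable [measurable]:
  assumes "cyl_sq g" shows "slice_sq g \<in> borel_measurable borel"
proof -
  note [measurable] = cyl_sq_measurable[OF assms]
  have "(\<lambda>w. \<integral>\<^sup>+y. ennreal ((norm (g (w, y)))\<^sup>2) \<partial>lborel) \<in> borel_measurable lborel"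
    by measurable
  then show ?thesis by (simp add: slice_sq_def[abs_def])
qed

lemma cyl_sq_slice:
  assumes g: "cyl_sq g"
  shows "AE w in lborel. cell_L2 (\<lambda>y. g (w, y))"
proof -
  note [measurable] = cyl_sq_measurable[OF g]
  have "integrable (lborel \<Otimes>\<^sub>M lborel) (\<lambda>z. (norm (g z))\<^sup>2)"
    using g by (simp add: cyl_sq_def lborel_prod)
  then have "AE w in lborel. integrable lborel (\<lambda>y. (norm (g (w, y)))\<^sup>2)"
    by (rule lborel_pair.AE_integrable_fst')
  then show ?thesis
  proof eventually_elim
    case (elim w)
    have "(\<lambda>y. g (w, y)) \<in> borel_measurable borel" by measurable
    moreover have "g (w, y) = 0" if "y \<notin> torus_cell" for y
      using g that by (auto simp: cyl_sq_def cyl_domain_def)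
    ultimately show ?case using elim by (simp add: cell_L2_def)
  qed
qed

lemma slice_sq_eq:
  assumes "cell_L2 (\<lambda>y. g (w, y))"
  shows "slice_sq g w = ennreal (LINT y|lborel. (norm (g (w, y)))\<^sup>2)"
  unfolding slice_sq_def using assms by (intro nn_integral_eq_integral) (auto simp: cell_L2_def)

lemma bessel_slice:
  fixes g :: "real \<times> (real ^ 'd) \<Rightarrow> complex"
  assumes g: "cell_L2 (\<lambda>y. g (w, y))" and K: "finite K"
  shows "(\<Sum>k\<in>K. ennreal ((norm (mode g k w))\<^sup>2)) \<le> ennreal (cell_vol TYPE('d)) * slice_sq g w"
proof -
  have "(\<Sum>k\<in>K. ennreal ((norm (mode g k w))\<^sup>2)) = ennreal (\<Sum>k\<in>K. (norm (mode g k w))\<^sup>2)"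
    by (rule sum_ennreal) simp
  also have "\<dots> \<le> ennreal (cell_vol TYPE('d) * (LINT y|lborel. (norm (g (w, y)))\<^sup>2))"
    unfolding mode_def by (intro ennreal_leI bessel g K)
  also have "\<dots> = ennreal (cell_vol TYPE('d)) * slice_sq g w"
    unfolding slice_sq_eq[OF g] by (rule ennreal_mult) auto
  finally show ?thesis .
qed

lemma parseval_slice:
  fixes g :: "real \<times> (real ^ 'd) \<Rightarrow> complex"
  assumes g: "cell_L2 (\<lambda>y. g (w, y))"
  shows "(SUP N. \<Sum>k\<in>freq_box N. ennreal ((norm (mode g k w))\<^sup>2)) = ennreal (cell_vol TYPE('d)) * slice_sq g w"
proof (rule LIMSEQ_unique)
  have s: "(\<Sum>k\<in>K. ennreal ((norm (mode g k w))\<^sup>2)) = ennreal (\<Sum>k\<in>K. (norm (mode g k w))\<^sup>2)" for K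
    by (rule sum_ennreal) simp
  have "incseq (\<lambda>N. \<Sum>k\<in>freq_box N. ennreal ((norm (mode g k w))\<^sup>2))"
    unfolding incseq_def by (intro allI impI sum_mono2 finite_freq_box freq_box_mono) auto
  then show "(\<lambda>N. \<Sum>k\<in>freq_box N. ennreal ((norm (mode g k w))\<^sup>2)) \<longlonglongrightarrow> (SUP N. \<Sum>k\<in>freq_box N. ennreal ((norm (mode g k w))\<^sup>2))"
    by (rule LIMSEQ_SUP)
  have "(\<lambda>N. ennreal (\<Sum>k\<in>freq_box N. (norm (mode g k w))\<^sup>2)) \<longlonglongrightarrow> ennreal (cell_vol TYPE('d) * (LINT y|lborel. (norm (g (w, y)))\<^sup>2))"
    unfolding mode_def by (intro tendsto_ennrealI parseval g)
  also have "ennreal (cell_vol TYPE('d) * (LINT y|lborel. (norm (g (w, y)))\<^sup>2)) = ennreal (cell_vol TYPE('d)) * slice_sq g w"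
    unfolding slice_sq_eq[OF g] by (rule ennreal_mult) auto
  finally show "(\<lambda>N. \<Sum>k\<in>freq_box N. ennreal ((norm (mode g k w))\<^sup>2)) \<longlonglongrightarrow> ennreal (cell_vol TYPE('d)) * slice_sq g w"
    unfolding s .
qed

lemma mode_measurable:
  assumes "cyl_sq g" shows "mode g k \<in> borel_measurable borel"
proof -
  note [measurable] = cyl_sq_measurable[OF assms]
  have "(\<lambda>w. LINT y|lborel. g (w, y) * fexp (- k) y) \<in> borel_measurable lborel"
    by measurable
  then show ?thesis by (simp add: mode_def[abs_def] fcoef_def)
qed

lemma mode_L2:
  fixes g :: "real \<times> (real ^ 'd) \<Rightarrow> complex"
  assumes g: "cyl_sq g" shows "integrable lborel (\<lambda>w. (norm (mode g k w))\<^sup>2)"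
proof (rule Bochner_Integration.integrable_bound)
  have "integrable (lborel \<Otimes>\<^sub>M lborel) (\<lambda>z. (norm (g z))\<^sup>2)"
    using g by (simp add: cyl_sq_def lborel_prod)
  then have "integrable lborel (\<lambda>w. LINT y|lborel. (norm (g (w, y)))\<^sup>2)"
    by (rule lborel_pair.integrable_fst')
  then show "integrable lborel (\<lambda>w. cell_vol TYPE('d) * (LINT y|lborel. (norm (g (w, y)))\<^sup>2))"
    by (rule integrable_mult_right)
  show "AE w in lborel. norm ((norm (mode g k w))\<^sup>2) \<le> norm (cell_vol TYPE('d) * (LINT y|lborel. (norm (g (w, y)))\<^sup>2))"
    using cyl_sq_slice[OF g]
  proof eventually_elim
    case (elim w)
    have "(\<Sum>k\<in>{k}. (norm (mode g k w))\<^sup>2) \<le> cell_vol TYPE('d) * (LINT y|lborel. (norm (g (w, y)))\<^sup>2)"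
      unfolding mode_def by (intro bessel elim) auto
    then show ?case by (simp add: abs_mult)
  qed
  show "(\<lambda>w. (norm (mode g k w))\<^sup>2) \<in> borel_measurable lborel"
    using mode_measurable[OF g] by simp
qed

lemma L2_imp_loc_int:
  assumes "U \<in> borel_measurable borel" "integrable lborel (\<lambda>w. (norm (U w))\<^sup>2)"
  shows "loc_int U"
  unfolding loc_int_def set_integrable_def
proof (intro conjI allI)
  note [measurable] = assms(1)
  fix a b :: real
  have "integrable lborel (\<lambda>w. indicator {a..b} w + (norm (U w))\<^sup>2)"
    using assms(2) by (intro Bochner_Integration.integrable_add integrable_real_indicator) (auto simp: emeasure_lborel_Icc_eq)
  then show "integrable lborel (\<lambda>w. indicator {a..b} w *\<^sub>R U w)"
    by (rule Bochner_Integration.integrable_bound)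
      (auto simp: indicator_def le_add_square_half)
qed (rule assms(1))

lemma mode_loc_int: "cyl_sq g \<Longrightarrow> loc_int (mode g k)"
  by (intro L2_imp_loc_int mode_measurable mode_L2)

text \<open>Pairing with \<open>fexp k\<close> selects the mode \<open>- k\<close>, because
  \<open>fcoef\<close> integrates against the conjugate exponential. The sign is harmless later, as
  \<open>freq_sq\<close> is even.\<close>

lemma cyl_sq_test_integral:
  fixes g :: "real \<times> (real ^ 'd) \<Rightarrow> complex"
  assumes g: "cyl_sq g" and D: "test_seq 0 D"
  shows "integrable lborel (\<lambda>z. g z * tensor_test D n k z)" (is ?I)
    and "(LINT z|lborel. g z * tensor_test D n k z) = (LINT w|lborel. mode g (- k) w * of_real (D n w))" (is ?E)
proof -
  note [measurable] = cyl_sq_measurable[OF g] smooth_seq_measurable[OF test_seq_smooth[OF D]]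
  obtain a b where ab: "\<And>n x. D n x \<noteq> 0 \<Longrightarrow> a \<le> x \<and> x \<le> b" using D unfolding test_seq_def by blast
  obtain B where B: "\<And>x. \<bar>D n x\<bar> \<le> B" using test_seq_bounded[OF D] by blast
  have B0: "0 \<le> B" using B[of 0] by simp
  have m: "(\<lambda>z. g z * tensor_test D n k z) \<in> borel_measurable (lborel \<Otimes>\<^sub>M lborel)"
    by measurable
  have S: "{a..b} \<times> (torus_cell :: (real^'d) set) \<in> sets (lborel \<Otimes>\<^sub>M lborel)" by simp
  have "emeasure (lborel \<Otimes>\<^sub>M lborel) ({a..b} \<times> (torus_cell :: (real^'d) set)) = emeasure lborel {a..b} * emeasure lborel (torus_cell :: (real^'d) set)"
    by (rule lborel.emeasure_pair_measure_Times) auto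
  also have "\<dots> < \<infinity>" using emeasure_torus_cell_finite[where 'd='d] by (simp add: ennreal_mult_less_top emeasure_lborel_Icc_eq)
  finally have "integrable (lborel \<Otimes>\<^sub>M lborel) (indicator ({a..b} \<times> (torus_cell :: (real^'d) set)) :: _ \<Rightarrow> real)"
    using S by (intro integrable_real_indicator) auto
  then have "integrable (lborel \<Otimes>\<^sub>M lborel) (\<lambda>z. B * (indicator ({a..b} \<times> (torus_cell :: (real^'d) set)) z + (norm (g z))\<^sup>2))"
    using g by (intro integrable_mult_right Bochner_Integration.integrable_add) (auto simp: cyl_sq_def lborel_prod)
  then have i: "integrable (lborel \<Otimes>\<^sub>M lborel) (\<lambda>z. g z * tensor_test D n k z)"
  proof (rule Bochner_Integration.integrable_bound[OF _ m], intro AE_I2)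
    fix z :: "real \<times> (real^'d)"
    show "norm (g z * tensor_test D n k z) \<le> norm (B * (indicator ({a..b} \<times> (torus_cell :: (real^'d) set)) z + (norm (g z))\<^sup>2))"
    proof (cases "z \<in> {a..b} \<times> torus_cell")
      case True
      have "norm (g z) * \<bar>D n (fst z)\<bar> \<le> (1 + (norm (g z))\<^sup>2) * B"
        using B B0 by (intro mult_mono le_add_square_half) auto
      then show ?thesis using True B0 by (simp add: norm_mult mult.commute)
    next
      case False
      then have "D n (fst z) = 0 \<or> g z = 0"
        using ab[of n "fst z"] g by (cases z) (auto simp: cyl_sq_def cyl_domain_def)
      then show ?thesis by auto
    qed
  qed
  then show ?I by (simp add: lborel_prod)
  have "(LINT z|lborel. g z * tensor_test D n k z) =
     (LINT w|lborel. LINT y|lborel. g (w, y) * (of_real (D n w) * fexp k y))"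
    using lborel_pair.integral_fst'[OF i] by (simp add: lborel_prod)
  also have "\<dots> = (LINT w|lborel. mode g (- k) w * of_real (D n w))"
  proof (rule Bochner_Integration.integral_cong)
    fix w
    have "(LINT y|lborel. g (w, y) * (of_real (D n w) * fexp k y)) = (LINT y|lborel. of_real (D n w) * (g (w, y) * fexp k y))"
      by (simp add: mult_ac)
    also have "\<dots> = of_real (D n w) * (LINT y|lborel. g (w, y) * fexp k y)"
      by (rule integral_mult_right_zero)
    finally show "(LINT y|lborel. g (w, y) * (of_real (D n w) * fexp k y)) = mode g (- k) w * of_real (D n w)"
      by (simp add: mode_def fcoef_def mult.commute)
  qed simp
  finally show ?E .
qed

text \<open>Testing with derivatives makes Z constant, and a square integrable constant on a
  half-line is 0.\<close>

lemma AE_zero_of_test_integrals: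
  fixes Z :: "real \<Rightarrow> complex"
  assumes Z: "Z \<in> borel_measurable borel" "integrable lborel (\<lambda>w. (norm (Z w))\<^sup>2)"
    and 0: "\<And>D. test_seq c D \<Longrightarrow> (LINT w|lborel. Z w * of_real (D 0 w)) = 0"
  shows "AE w in lborel. c < w \<longrightarrow> Z w = 0"
proof -
  have l: "loc_int Z" by (rule L2_imp_loc_int[OF Z])
  have "\<exists>k. AE w in lborel. c < w \<longrightarrow> Z w = k"
  proof (rule weak_const)
    show "set_integrable lborel {a..b} Z" for a b using l by (simp add: loc_int_def)
    show "(LINT w|lborel. Z w * of_real (D 1 w)) = 0" if "test_seq c D" for D
      using 0[OF test_seq_shift[OF that]] by simp
  qed (rule Z(1))
  then obtain k where k: "AE w in lborel. c < w \<longrightarrow> Z w = k" by blast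
  have "k = 0"
  proof (rule L2_imp_limit_zero[OF Z(2,1), of c "\<lambda>_. k"])
    show "AE w in lborel. c < w \<longrightarrow> norm k \<le> norm (Z w)" using k by eventually_elim auto
  qed simp
  then show ?thesis using k by simp
qed

lemma integrable_norm_add_sq:
  fixes A B :: "real \<Rightarrow> complex"
  assumes [measurable]: "A \<in> borel_measurable borel" "B \<in> borel_measurable borel"
    and A: "integrable lborel (\<lambda>w. (norm (A w))\<^sup>2)" and B: "integrable lborel (\<lambda>w. (norm (B w))\<^sup>2)"
  shows "integrable lborel (\<lambda>w. (norm (A w + of_real c * B w))\<^sup>2)"
proof (rule Bochner_Integration.integrable_bound)
  show "integrable lborel (\<lambda>w. 2 * (norm (A w))\<^sup>2 + 2 * (c\<^sup>2 * (norm (B w))\<^sup>2))"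
    using A B by simp
  show "AE w in lborel. norm ((norm (A w + of_real c * B w))\<^sup>2) \<le> norm (2 * (norm (A w))\<^sup>2 + 2 * (c\<^sup>2 * (norm (B w))\<^sup>2))"
    using norm_add_sq_le[of "A _" "of_real c * B _"] by (intro AE_I2) (auto simp: norm_mult power_mult_distrib)
qed measurable

text \<open>The weak equations \<open>\<partial>\<^sub>w u = u1\<close>, \<open>\<Delta> u = f\<close> and \<open>\<Delta>\<^sub>y u = Y\<close>.\<close>

definition weak_system ::
    "(real \<times> (real ^ 'd) \<Rightarrow> complex) \<Rightarrow> (real \<times> (real ^ 'd) \<Rightarrow> complex) \<Rightarrow>
     (real \<times> (real ^ 'd) \<Rightarrow> complex) \<Rightarrow> (real \<times> (real ^ 'd) \<Rightarrow> complex) \<Rightarrow> bool" where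
  "weak_system u u1 f Y \<longleftrightarrow> (\<forall>D k. test_seq 0 D \<longrightarrow>
    (LINT z|lborel. u z * tensor_test D 1 k z) = - (LINT z|lborel. u1 z * tensor_test D 0 k z) \<and>
    (LINT z|lborel. u z * tensor_test D 2 k z) =
      of_real (freq_sq k) * (LINT z|lborel. u z * tensor_test D 0 k z) + (LINT z|lborel. f z * tensor_test D 0 k z) \<and>
    of_real (freq_sq k) * (LINT z|lborel. u z * tensor_test D 0 k z) = - (LINT z|lborel. Y z * tensor_test D 0 k z))"

text \<open>The estimate is named at a single a because it is available for almost every a only: the
  constant is read off from the slice of \<Delta>_y u at a, which must be square integrable
  there.\<close>

definition carleman_at :: "(real \<times> (real ^ 'd) \<Rightarrow> complex) \<Rightarrow> (real \<times> (real ^ 'd) \<Rightarrow> complex) \<Rightarrow> real \<Rightarrow> real \<Rightarrow> bool" where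
  "carleman_at u f a K \<longleftrightarrow> (\<forall>\<phi> P Q m. weight a \<phi> P Q \<longrightarrow> 0 \<le> m \<longrightarrow>
     (\<forall>k::int^'d. \<forall>w\<ge>a. m \<le> (P w + sqrt (freq_sq k))\<^sup>2 * (P w - sqrt (freq_sq k))\<^sup>2 + Q w * (P w + sqrt (freq_sq k)) * (3 * P w - sqrt (freq_sq k))) \<longrightarrow>
     (\<forall>\<mu>\<ge>0. (\<integral>\<^sup>+w. indicator {a..} w * (ennreal ((P w + \<mu>) ^ 3 * exp (2 * \<phi> w)) * slice_sq u w) \<partial>lborel) < \<infinity>) \<longrightarrow>
     (\<integral>\<^sup>+w. indicator {a..} w * (ennreal (m * exp (2 * \<phi> w)) * slice_sq u w) \<partial>lborel) \<le>
     (\<integral>\<^sup>+w. indicator {a..} w * (ennreal (exp (2 * \<phi> w)) * slice_sq f w) \<partial>lborel) + ennreal (K * exp (2 * \<phi> a)))"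

text \<open>The constant \<open>K\<close> does not depend on the weight.\<close>

lemma carleman_inequality:
  fixes u u1 f Y :: "real \<times> (real ^ 'd) \<Rightarrow> complex"
  assumes u: "cyl_sq u" and u1: "cyl_sq u1" and f: "cyl_sq f" and Y: "cyl_sq Y" and fi: "integrable lborel f"
    and sys: "weak_system u u1 f Y"
    and b: "0 \<le> b"
  shows "AE a in lborel. b < a \<longrightarrow> (\<exists>K\<ge>0. carleman_at u f a K)"
proof -
  note H = sys[unfolded weak_system_def, rule_format]
  note H1 = conjunct1[OF H] and H2 = conjunct1[OF conjunct2[OF H]] and H3 = conjunct2[OF conjunct2[OF H]]
  let ?v = "ennreal (cell_vol TYPE('d))"
  define \<mu> where "\<mu> k = sqrt (freq_sq k)" for k :: "int^'d"
  have \<mu>0: "0 \<le> \<mu> k" and \<mu>2: "(\<mu> k)\<^sup>2 = freq_sq k" for k by (simp_all add: \<mu>_def freq_sq_nonneg)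
  note [measurable] = mode_measurable[OF u] mode_measurable[OF u1] mode_measurable[OF f] mode_measurable[OF Y]
    slice_sq_measurable[OF u] slice_sq_measurable[OF f]
  have ts: "test_seq 0 D" if "test_seq c D" "0 \<le> c" for c D
    using that unfolding test_seq_def by (meson le_less_trans)
  have T: "(LINT w|lborel. mode g k w * of_real (D n w)) = (LINT z|lborel. g z * tensor_test D n (- k) z)"
    if "cyl_sq g" "test_seq 0 D" for g k D n
    using cyl_sq_test_integral(2)[OF that, of n "- k"] by simp
  have Fint: "integrable lborel (mode f k)" for k
  proof -
    have m [measurable]: "f \<in> borel_measurable (lborel \<Otimes>\<^sub>M lborel)" by (rule cyl_sq_measurable[OF f])
    have "integrable (lborel \<Otimes>\<^sub>M lborel) (\<lambda>z. f z * fexp (- k) (snd z))"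
    proof (rule Bochner_Integration.integrable_bound)
      show "integrable (lborel \<Otimes>\<^sub>M lborel) f" using fi by (simp add: lborel_prod)
      show "AE z in lborel \<Otimes>\<^sub>M lborel. norm (f z * fexp (- k) (snd z)) \<le> norm (f z)"
        by (simp add: norm_mult)
    qed measurable
    from lborel_pair.integrable_fst'[OF this] show ?thesis
      by (simp add: mode_def[abs_def] fcoef_def)
  qed
  define Good where "Good k V \<longleftrightarrow> (AE w in lborel. b < w \<longrightarrow> mode u k w = V w) \<and>
      (\<forall>a \<phi> P Q m. b < a \<longrightarrow> weight a \<phi> P Q \<longrightarrow> 0 \<le> m \<longrightarrow>
      (\<forall>w\<ge>a. m \<le> (P w + \<mu> k)\<^sup>2 * (P w - \<mu> k)\<^sup>2 + Q w * (P w + \<mu> k) * (3 * P w - \<mu> k)) \<longrightarrow>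
      (\<integral>\<^sup>+w. indicator {a..} w * ennreal ((P w + \<mu> k) ^ 3 * exp (2 * \<phi> w) * (norm (mode u k w))\<^sup>2) \<partial>lborel) < \<infinity> \<longrightarrow>
      (\<integral>\<^sup>+w. indicator {a..} w * ennreal (m * exp (2 * \<phi> w) * (norm (mode u k w))\<^sup>2) \<partial>lborel) \<le>
      (\<integral>\<^sup>+w. indicator {a..} w * ennreal (exp (2 * \<phi> w) * (norm (mode f k w))\<^sup>2) \<partial>lborel) +
      ennreal (4 * \<mu> k ^ 3 * exp (2 * \<phi> a) * (norm (V a))\<^sup>2))" for k :: "int^'d" and V :: "real \<Rightarrow> complex"
  have "\<exists>V. Good k V" for k
    unfolding Good_def
  proof (rule mode_carleman[OF mode_loc_int[OF u, of k] mode_loc_int[OF u1, of k] Fint[of k] _ _ _ \<mu>0[of k] b])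
    show "integrable lborel (\<lambda>w. (norm (mode u1 k w + of_real (\<mu> k) * mode u k w))\<^sup>2)"
      by (intro integrable_norm_add_sq mode_L2 u u1 mode_measurable)
    fix D assume "test_seq b D"
    then have D: "test_seq 0 D" using b by (rule ts)
    show "(LINT w|lborel. mode u k w * of_real (D 1 w)) = - (LINT w|lborel. mode u1 k w * of_real (D 0 w))"
      unfolding T[OF u D] T[OF u1 D] by (rule H1[OF D])
    have i: "integrable lborel (\<lambda>w. mode u k w * of_real (D 0 w))" "integrable lborel (\<lambda>w. mode f k w * of_real (D 0 w))"
      by (intro loc_int_test[OF _ D] mode_loc_int u f)+
    have "(LINT w|lborel. (of_real ((\<mu> k)\<^sup>2) * mode u k w + mode f k w) * of_real (D 0 w)) =
       (LINT w|lborel. of_real (freq_sq k) * (mode u k w * of_real (D 0 w)) + mode f k w * of_real (D 0 w))"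
      by (simp add: \<mu>2 algebra_simps)
    also have "\<dots> = of_real (freq_sq k) * (LINT w|lborel. mode u k w * of_real (D 0 w)) + (LINT w|lborel. mode f k w * of_real (D 0 w))"
      using i by simp
    finally show "(LINT w|lborel. mode u k w * of_real (D 2 w)) = (LINT w|lborel. (of_real ((\<mu> k)\<^sup>2) * mode u k w + mode f k w) * of_real (D 0 w))"
      unfolding T[OF u D] T[OF f D] using H2[OF D, of "- k"] by simp
  qed blast
  then obtain V where GV: "\<And>k. Good k (V k)" using choice[of Good] by blast
  then have VU: "AE w in lborel. b < w \<longrightarrow> mode u k w = V k w" for k
    using Good_def by blast
  have V: "(\<integral>\<^sup>+w. indicator {a..} w * ennreal (m * exp (2 * \<phi> w) * (norm (mode u k w))\<^sup>2) \<partial>lborel) \<le>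
      (\<integral>\<^sup>+w. indicator {a..} w * ennreal (exp (2 * \<phi> w) * (norm (mode f k w))\<^sup>2) \<partial>lborel) +
      ennreal (4 * \<mu> k ^ 3 * exp (2 * \<phi> a) * (norm (V k a))\<^sup>2)"
    if "b < a" "weight a \<phi> P Q" "0 \<le> m" "(\<forall>w\<ge>a. m \<le> (P w + \<mu> k)\<^sup>2 * (P w - \<mu> k)\<^sup>2 + Q w * (P w + \<mu> k) * (3 * P w - \<mu> k))" "(\<integral>\<^sup>+w. indicator {a..} w * ennreal ((P w + \<mu> k) ^ 3 * exp (2 * \<phi> w) * (norm (mode u k w))\<^sup>2) \<partial>lborel) < \<infinity>" for k a \<phi> P Q m
    by (rule GV[of k, unfolded Good_def, THEN conjunct2, THEN spec[of _ a], THEN spec[of _ \<phi>], THEN spec[of _ P],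
        THEN spec[of _ Q], THEN spec[of _ m], THEN mp, THEN mp, THEN mp, THEN mp, THEN mp]) (fact that)+
  \<comment> \<open>The equation \<Delta>_y u = Y says Y_k = - \<mu>^2 u_k mode by mode. This gives
    control of u_k with the factor \<mu>^2 that the boundary terms require.\<close>
  have UY: "AE w in lborel. 0 < w \<longrightarrow> mode Y k w + of_real (freq_sq k) * mode u k w = 0" for k
  proof (rule AE_zero_of_test_integrals)
    show "integrable lborel (\<lambda>w. (norm (mode Y k w + of_real (freq_sq k) * mode u k w))\<^sup>2)"
      by (intro integrable_norm_add_sq mode_L2 u Y mode_measurable)
    fix D assume D: "test_seq 0 D"
    have i: "integrable lborel (\<lambda>w. mode u k w * of_real (D 0 w))" "integrable lborel (\<lambda>w. mode Y k w * of_real (D 0 w))"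
      by (intro loc_int_test[OF _ D] mode_loc_int u Y)+
    have "(LINT w|lborel. (mode Y k w + of_real (freq_sq k) * mode u k w) * of_real (D 0 w)) =
       (LINT w|lborel. mode Y k w * of_real (D 0 w) + of_real (freq_sq k) * (mode u k w * of_real (D 0 w)))"
      by (simp add: algebra_simps)
    also have "\<dots> = (LINT w|lborel. mode Y k w * of_real (D 0 w)) + of_real (freq_sq k) * (LINT w|lborel. mode u k w * of_real (D 0 w))"
      using i by simp
    also have "\<dots> = 0"
      unfolding T[OF u D] T[OF Y D] using H3[OF D, of "- k"] by simp
    finally show "(LINT w|lborel. (mode Y k w + of_real (freq_sq k) * mode u k w) * of_real (D 0 w)) = 0" .
  qed measurable
  \<comment> \<open>The lattice of frequencies is countable, so one null set of exceptional a serves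
    all modes.\<close>
  have all: "AE a in lborel. \<forall>k. (b < a \<longrightarrow> mode u k a = V k a) \<and> (0 < a \<longrightarrow> mode Y k a + of_real (freq_sq k) * mode u k a = 0)"
  proof -
    have "AE a in lborel. \<forall>k\<in>(UNIV :: (int^'d) set). (b < a \<longrightarrow> mode u k a = V k a) \<and> (0 < a \<longrightarrow> mode Y k a + of_real (freq_sq k) * mode u k a = 0)"
      using VU UY by (subst AE_ball_countable) auto
    then show ?thesis by simp
  qed
  show ?thesis
    using all cyl_sq_slice[OF Y]
  proof eventually_elim
    case (elim a)
    show ?case
    proof (intro impI)
      assume ba: "b < a"
      define N where "N = (LINT y|lborel. (norm (Y (a, y)))\<^sup>2)"
      have N0: "0 \<le> N" by (simp add: N_def)
      \<comment> \<open>\<mu>^2 is a sum of integer squares, hence 0 or at least 1, so \<mu>^3 \<le>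
        \<mu>^4 and the boundary term of mode k is at most 4 |Y_k(a)|^2. Bessel's inequality for Y
        at the slice a then sums these to \<open>4 * N\<close>, up to the common volume
        factor.\<close>
      have bd: "4 * \<mu> k ^ 3 * (norm (V k a))\<^sup>2 \<le> 4 * (norm (mode Y k a))\<^sup>2" for k
      proof -
        have Vk: "V k a = mode u k a" using elim ba by simp
        have "mode Y k a = - (of_real (freq_sq k) * mode u k a)"
        proof -
          have "0 < a" using ba b by simp
          then have "mode Y k a + of_real (freq_sq k) * mode u k a = 0"
            using conjunct2[OF spec[OF elim(1), of k]] by blast
          then show ?thesis by (rule eq_neg_iff_add_eq_0[THEN iffD2])
        qed
        then have nY: "norm (mode Y k a) = (\<mu> k)\<^sup>2 * norm (V k a)"
          using freq_sq_nonneg[of k] by (simp add: norm_mult Vk \<mu>2)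
        have "\<mu> k ^ 3 \<le> \<mu> k ^ 4"
        proof -
          define s where "s = (\<Sum>j\<in>UNIV. (k $ j)\<^sup>2)"
          have fs: "freq_sq k = of_int s" by (simp add: freq_sq_def s_def)
          have "s \<ge> 0" by (simp add: s_def sum_nonneg)
          then have "s = 0 \<or> 1 \<le> s" by linarith
          then have "freq_sq k = 0 \<or> 1 \<le> freq_sq k" unfolding fs by auto
          then show ?thesis
          proof
            assume "1 \<le> freq_sq k"
            then have "1 \<le> \<mu> k" by (simp add: \<mu>_def)
            then show ?thesis by (intro power_increasing) auto
          qed (simp add: \<mu>_def)
        qed
        then have "\<mu> k ^ 3 * (norm (V k a))\<^sup>2 \<le> \<mu> k ^ 4 * (norm (V k a))\<^sup>2" by (rule mult_right_mono) simp
        then show ?thesis by (simp add: nY power_mult_distrib flip: power_mult)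
      qed
      show "\<exists>K\<ge>0. carleman_at u f a K"
        unfolding carleman_at_def
      proof (intro exI[of _ "4 * N"] conjI allI impI)
        show "0 \<le> 4 * N" using N0 by simp
        fix \<phi> P Q :: "real \<Rightarrow> real" and m :: real
        assume wt: "weight a \<phi> P Q" and m: "0 \<le> m"
          and W: "\<forall>k::int^'d. \<forall>w\<ge>a. m \<le> (P w + sqrt (freq_sq k))\<^sup>2 * (P w - sqrt (freq_sq k))\<^sup>2 + Q w * (P w + sqrt (freq_sq k)) * (3 * P w - sqrt (freq_sq k))"
          and fin: "\<forall>\<mu>\<ge>0. (\<integral>\<^sup>+w. indicator {a..} w * (ennreal ((P w + \<mu>) ^ 3 * exp (2 * \<phi> w)) * slice_sq u w) \<partial>lborel) < \<infinity>"
        have [measurable]: "\<phi> \<in> borel_measurable borel" "P \<in> borel_measurable borel" using wt by (auto simp: weight_def)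
        have P0: "0 < P w" if "a \<le> w" for w using wt that by (simp add: weight_def)
        define A where "A k w = indicator {a..} w * (ennreal (m * exp (2 * \<phi> w)) * ennreal ((norm (mode u k w))\<^sup>2))" for k w
        define B where "B k w = indicator {a..} w * (ennreal (exp (2 * \<phi> w)) * ennreal ((norm (mode f k w))\<^sup>2))" for k w
        have [measurable]: "A k \<in> borel_measurable lborel" "B k \<in> borel_measurable lborel" for k
          unfolding A_def B_def by measurable
        have single: "(\<integral>\<^sup>+w. A k w \<partial>lborel) \<le> (\<integral>\<^sup>+w. B k w \<partial>lborel) + ennreal (4 * exp (2 * \<phi> a)) * ennreal ((norm (mode Y k a))\<^sup>2)" for k
        proof -
          have f1: "(\<integral>\<^sup>+w. indicator {a..} w * ennreal ((P w + \<mu> k) ^ 3 * exp (2 * \<phi> w) * (norm (mode u k w))\<^sup>2) \<partial>lborel) < \<infinity>"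
          proof -
            have "(\<integral>\<^sup>+w. indicator {a..} w * ennreal ((P w + \<mu> k) ^ 3 * exp (2 * \<phi> w) * (norm (mode u k w))\<^sup>2) \<partial>lborel) \<le>
              (\<integral>\<^sup>+w. ?v * (indicator {a..} w * (ennreal ((P w + \<mu> k) ^ 3 * exp (2 * \<phi> w)) * slice_sq u w)) \<partial>lborel)"
            proof (rule nn_integral_mono_AE, use cyl_sq_slice[OF u] in eventually_elim)
              case (elim w)
              have s: "ennreal ((norm (mode u k w))\<^sup>2) \<le> ?v * slice_sq u w"
                using bessel_slice[OF elim, of "{k}"] by simp
              show ?case
              proof (cases "a \<le> w")
                case True
                have "ennreal ((P w + \<mu> k) ^ 3 * exp (2 * \<phi> w) * (norm (mode u k w))\<^sup>2) = ennreal ((P w + \<mu> k) ^ 3 * exp (2 * \<phi> w)) * ennreal ((norm (mode u k w))\<^sup>2)"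
                  using P0[OF True] \<mu>0[of k] by (intro ennreal_mult) auto
                also have "\<dots> \<le> ennreal ((P w + \<mu> k) ^ 3 * exp (2 * \<phi> w)) * (?v * slice_sq u w)"
                  by (intro mult_left_mono s) simp
                finally show ?thesis using True by (simp add: mult_ac)
              qed simp
            qed
            also have "\<dots> = ?v * (\<integral>\<^sup>+w. indicator {a..} w * (ennreal ((P w + \<mu> k) ^ 3 * exp (2 * \<phi> w)) * slice_sq u w) \<partial>lborel)"
              by (rule nn_integral_cmult) measurable
            also have "\<dots> < \<infinity>" using fin \<mu>0[of k] by (auto simp: ennreal_mult_less_top)
            finally show ?thesis .
          qed
          have W': "\<forall>w\<ge>a. m \<le> (P w + \<mu> k)\<^sup>2 * (P w - \<mu> k)\<^sup>2 + Q w * (P w + \<mu> k) * (3 * P w - \<mu> k)"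
            using W by (simp add: \<mu>_def)
          have "(\<integral>\<^sup>+w. A k w \<partial>lborel) = (\<integral>\<^sup>+w. indicator {a..} w * ennreal (m * exp (2 * \<phi> w) * (norm (mode u k w))\<^sup>2) \<partial>lborel)"
            unfolding A_def using m by (simp add: ennreal_mult)
          also have "\<dots> \<le> (\<integral>\<^sup>+w. indicator {a..} w * ennreal (exp (2 * \<phi> w) * (norm (mode f k w))\<^sup>2) \<partial>lborel) +
            ennreal (4 * \<mu> k ^ 3 * exp (2 * \<phi> a) * (norm (V k a))\<^sup>2)"
            by (rule V[OF ba wt m W' f1])
          also have "(\<integral>\<^sup>+w. indicator {a..} w * ennreal (exp (2 * \<phi> w) * (norm (mode f k w))\<^sup>2) \<partial>lborel) = (\<integral>\<^sup>+w. B k w \<partial>lborel)"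
            unfolding B_def by (simp add: ennreal_mult)
          also have "ennreal (4 * \<mu> k ^ 3 * exp (2 * \<phi> a) * (norm (V k a))\<^sup>2) \<le> ennreal (4 * exp (2 * \<phi> a)) * ennreal ((norm (mode Y k a))\<^sup>2)"
          proof -
            have "4 * \<mu> k ^ 3 * (norm (V k a))\<^sup>2 * exp (2 * \<phi> a) \<le> 4 * (norm (mode Y k a))\<^sup>2 * exp (2 * \<phi> a)"
              using bd[of k] by (rule mult_right_mono) simp
            then show ?thesis by (simp add: ennreal_mult[symmetric] mult_ac ennreal_leI)
          qed
          finally show ?thesis by (simp add: add_left_mono)
        qed
        have sums: "(\<Sum>k\<in>freq_box n. \<integral>\<^sup>+w. A k w \<partial>lborel) \<le> ?v * ((\<integral>\<^sup>+w. indicator {a..} w * (ennreal (exp (2 * \<phi> w)) * slice_sq f w) \<partial>lborel) + ennreal (4 * N * exp (2 * \<phi> a)))" for n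
        proof -
          have "(\<Sum>k\<in>freq_box n. \<integral>\<^sup>+w. A k w \<partial>lborel) \<le> (\<Sum>k\<in>freq_box n. (\<integral>\<^sup>+w. B k w \<partial>lborel) + ennreal (4 * exp (2 * \<phi> a)) * ennreal ((norm (mode Y k a))\<^sup>2))"
            by (intro sum_mono single)
          also have "\<dots> = (\<Sum>k\<in>freq_box n. (\<integral>\<^sup>+w. B k w \<partial>lborel)) + ennreal (4 * exp (2 * \<phi> a)) * (\<Sum>k\<in>freq_box n. ennreal ((norm (mode Y k a))\<^sup>2))"
            by (simp only: sum.distrib sum_distrib_left)
          also have "\<dots> \<le> ?v * (\<integral>\<^sup>+w. indicator {a..} w * (ennreal (exp (2 * \<phi> w)) * slice_sq f w) \<partial>lborel) + ?v * ennreal (4 * N * exp (2 * \<phi> a))"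
          proof (rule add_mono)
            have "(\<Sum>k\<in>freq_box n. (\<integral>\<^sup>+w. B k w \<partial>lborel)) = (\<integral>\<^sup>+w. (\<Sum>k\<in>freq_box n. B k w) \<partial>lborel)"
              by (rule nn_integral_sum[symmetric]) measurable
            also have "\<dots> \<le> (\<integral>\<^sup>+w. ?v * (indicator {a..} w * (ennreal (exp (2 * \<phi> w)) * slice_sq f w)) \<partial>lborel)"
            proof (rule nn_integral_mono_AE, use cyl_sq_slice[OF f] in eventually_elim)
              case (elim w)
              have "(\<Sum>k\<in>freq_box n. B k w) = indicator {a..} w * (ennreal (exp (2 * \<phi> w)) * (\<Sum>k\<in>freq_box n. ennreal ((norm (mode f k w))\<^sup>2)))"
                by (simp only: B_def sum_distrib_left)
              also have "\<dots> \<le> indicator {a..} w * (ennreal (exp (2 * \<phi> w)) * (?v * slice_sq f w))"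
                by (intro mult_left_mono bessel_slice elim finite_freq_box) auto
              finally show ?case by (simp add: mult_ac)
            qed
            also have "\<dots> = ?v * (\<integral>\<^sup>+w. indicator {a..} w * (ennreal (exp (2 * \<phi> w)) * slice_sq f w) \<partial>lborel)"
              by (rule nn_integral_cmult) measurable
            finally show "(\<Sum>k\<in>freq_box n. (\<integral>\<^sup>+w. B k w \<partial>lborel)) \<le> ?v * (\<integral>\<^sup>+w. indicator {a..} w * (ennreal (exp (2 * \<phi> w)) * slice_sq f w) \<partial>lborel)" .
            have "(\<Sum>k\<in>freq_box n. ennreal ((norm (mode Y k a))\<^sup>2)) \<le> ?v * slice_sq Y a"
              by (intro bessel_slice elim finite_freq_box)
            also have "slice_sq Y a = ennreal N" unfolding N_def by (rule slice_sq_eq[OF elim(2)])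
            finally have "ennreal (4 * exp (2 * \<phi> a)) * (\<Sum>k\<in>freq_box n. ennreal ((norm (mode Y k a))\<^sup>2)) \<le> ennreal (4 * exp (2 * \<phi> a)) * (?v * ennreal N)"
              by (rule mult_left_mono) simp
            also have "\<dots> = ?v * ennreal (4 * N * exp (2 * \<phi> a))"
              using N0 by (simp add: ennreal_mult[symmetric] mult_ac)
            finally show "ennreal (4 * exp (2 * \<phi> a)) * (\<Sum>k\<in>freq_box n. ennreal ((norm (mode Y k a))\<^sup>2)) \<le> ?v * ennreal (4 * N * exp (2 * \<phi> a))" .
          qed
          finally show ?thesis by (simp only: distrib_left)
        qed
        \<comment> \<open>The left side is recovered exactly from its modes by Parseval and monotone
          convergence over the boxes; on the right Bessel's inequality sufficed. Both carry the
          factor \<open>cell_vol\<close>, which cancels at the end.\<close>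
        have "?v * (\<integral>\<^sup>+w. indicator {a..} w * (ennreal (m * exp (2 * \<phi> w)) * slice_sq u w) \<partial>lborel) =
          (\<integral>\<^sup>+w. ?v * (indicator {a..} w * (ennreal (m * exp (2 * \<phi> w)) * slice_sq u w)) \<partial>lborel)"
          by (rule nn_integral_cmult[symmetric]) measurable
        also have "\<dots> = (\<integral>\<^sup>+w. (SUP n. \<Sum>k\<in>freq_box n. A k w) \<partial>lborel)"
        proof (rule nn_integral_cong_AE, use cyl_sq_slice[OF u] in eventually_elim)
          case (elim w)
          have "(SUP n. \<Sum>k\<in>freq_box n. A k w) = (SUP n. (indicator {a..} w * ennreal (m * exp (2 * \<phi> w))) * (\<Sum>k\<in>freq_box n. ennreal ((norm (mode u k w))\<^sup>2)))"
            by (simp only: A_def sum_distrib_left mult.assoc)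
          also have "\<dots> = (indicator {a..} w * ennreal (m * exp (2 * \<phi> w))) * (SUP n. (\<Sum>k\<in>freq_box n. ennreal ((norm (mode u k w))\<^sup>2)))"
            by (rule SUP_mult_left_ennreal[symmetric])
          finally show ?case unfolding parseval_slice[OF elim] by (simp add: mult_ac)
        qed
        also have "\<dots> = (SUP n. \<integral>\<^sup>+w. (\<Sum>k\<in>freq_box n. A k w) \<partial>lborel)"
        proof (rule nn_integral_monotone_convergence_SUP)
          show "incseq (\<lambda>n w. \<Sum>k\<in>freq_box n. A k w)"
            unfolding incseq_def le_fun_def by (intro allI impI sum_mono2 finite_freq_box freq_box_mono) auto
        qed measurable
        also have "\<dots> = (SUP n. (\<Sum>k\<in>freq_box n. \<integral>\<^sup>+w. A k w \<partial>lborel))"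
          by (intro SUP_cong refl nn_integral_sum) measurable
        also have "\<dots> \<le> ?v * ((\<integral>\<^sup>+w. indicator {a..} w * (ennreal (exp (2 * \<phi> w)) * slice_sq f w) \<partial>lborel) + ennreal (4 * N * exp (2 * \<phi> a)))"
          by (intro SUP_least sums)
        finally show "(\<integral>\<^sup>+w. indicator {a..} w * (ennreal (m * exp (2 * \<phi> w)) * slice_sq u w) \<partial>lborel) \<le>
          (\<integral>\<^sup>+w. indicator {a..} w * (ennreal (exp (2 * \<phi> w)) * slice_sq f w) \<partial>lborel) + ennreal (4 * N * exp (2 * \<phi> a))"
          by (subst (asm) ennreal_mult_le_mult_iff) auto
      qed
    qed
  qed
qed

section \<open>Lower bound for the symbol, the large parameter limit, finiteness of weighted
  integrals\<close>

text \<open>For \<mu> \<le> 2 P the second term is at least Q P^2. For \<mu> > 2 P it may be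
  negative, but (P - \<mu>)^2 \<ge> (\<mu>/2)^2 makes the first term at least \<mu>^4 / 4, and 3 Q
  \<le> P^2 limits the loss to half of that; the remaining \<mu>^4 / 8 is at least 2 P^4.\<close>

lemma conjugated_symbol_lower_bound:
  fixes P Q \<mu> m :: real
  assumes P: "0 < P" and Q: "0 \<le> Q" "3 * Q \<le> P\<^sup>2" and \<mu>: "0 \<le> \<mu>" and m: "m \<le> Q * P\<^sup>2" "m \<le> 2 * P ^ 4"
  shows "m \<le> (P + \<mu>)\<^sup>2 * (P - \<mu>)\<^sup>2 + Q * (P + \<mu>) * (3 * P - \<mu>)"
proof (cases "\<mu> \<le> 2 * P")
  case True
  have "m \<le> Q * P\<^sup>2" by fact
  also have "\<dots> = Q * (P * P)" by (simp add: power2_eq_square)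
  also have "\<dots> \<le> Q * ((P + \<mu>) * (3 * P - \<mu>))"
    using True P \<mu> Q by (intro mult_left_mono mult_mono) auto
  also have "\<dots> \<le> (P + \<mu>)\<^sup>2 * (P - \<mu>)\<^sup>2 + Q * (P + \<mu>) * (3 * P - \<mu>)" by (simp add: mult.assoc)
  finally show ?thesis .
next
  case False
  have a: "\<mu>\<^sup>2 * (\<mu> / 2)\<^sup>2 \<le> (P + \<mu>)\<^sup>2 * (P - \<mu>)\<^sup>2"
  proof (rule mult_mono)
    show "\<mu>\<^sup>2 \<le> (P + \<mu>)\<^sup>2" using P \<mu> by (intro power_mono) auto
    have "(\<mu> / 2)\<^sup>2 \<le> (\<mu> - P)\<^sup>2" using False \<mu> by (intro power_mono) auto
    then show "(\<mu> / 2)\<^sup>2 \<le> (P - \<mu>)\<^sup>2" by (simp add: power2_commute)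
  qed auto
  have "Q * ((P + \<mu>) * (\<mu> - 3 * P)) \<le> (P\<^sup>2 / 3) * ((3 / 2 * \<mu>) * \<mu>)"
  proof (cases "\<mu> - 3 * P \<ge> 0")
    case True
    then show ?thesis using False P \<mu> Q by (intro mult_mono) auto
  next
    case neg: False
    then have "Q * ((P + \<mu>) * (\<mu> - 3 * P)) \<le> 0" using P \<mu> Q by (intro mult_nonneg_nonpos) auto
    also have "0 \<le> (P\<^sup>2 / 3) * ((3 / 2 * \<mu>) * \<mu>)" using \<mu> by simp
    finally show ?thesis .
  qed
  also have "\<dots> = P\<^sup>2 * \<mu>\<^sup>2 / 2" by (simp add: power2_eq_square)
  also have "\<dots> \<le> (\<mu> / 2)\<^sup>2 * \<mu>\<^sup>2 / 2"
    using False P by (intro divide_right_mono mult_right_mono power_mono) auto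
  finally have b: "Q * ((P + \<mu>) * (\<mu> - 3 * P)) \<le> (\<mu> / 2)\<^sup>2 * \<mu>\<^sup>2 / 2" .
  have "(2 * P) ^ 4 \<le> \<mu> ^ 4" using False P by (intro power_mono) auto
  then have "2 * P ^ 4 \<le> \<mu> ^ 4 / 8" by (simp add: power_mult_distrib)
  also have "\<dots> = \<mu>\<^sup>2 * (\<mu> / 2)\<^sup>2 - (\<mu> / 2)\<^sup>2 * \<mu>\<^sup>2 / 2" by (simp add: power2_eq_square power4_eq_xxxx)
  also have "\<dots> \<le> (P + \<mu>)\<^sup>2 * (P - \<mu>)\<^sup>2 - Q * ((P + \<mu>) * (\<mu> - 3 * P))" by (rule diff_mono[OF a b])
  also have "\<dots> = (P + \<mu>)\<^sup>2 * (P - \<mu>)\<^sup>2 + Q * (P + \<mu>) * (3 * P - \<mu>)" by (simp add: algebra_simps)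
  finally show ?thesis using m(2) by simp
qed

text \<open>On w \<ge> c > a the weight is at least exp(2 \<tau> \<theta>(c)), so the mass of S
  there is at most K exp(-2 \<tau> (\<theta>(c) - \<theta>(a))), and \<tau> may be taken arbitrarily
  large. The bound is asked for an unbounded set of \<tau> only, since the gaps between sums of two
  squares supply no more.\<close>

lemma AE_zero_of_exponential_weights:
  fixes S :: "real \<Rightarrow> ennreal" and \<theta> :: "real \<Rightarrow> real"
  assumes S [measurable]: "S \<in> borel_measurable borel"
    and mono: "\<And>x y. a \<le> x \<Longrightarrow> x < y \<Longrightarrow> \<theta> x < \<theta> y" and K: "0 \<le> K"
    and bound: "\<And>T. \<exists>\<tau>\<ge>T. (\<integral>\<^sup>+w. indicator {a..} w * (ennreal (exp (2 * (\<tau> * \<theta> w))) * S w) \<partial>lborel) \<le> ennreal (K * exp (2 * (\<tau> * \<theta> a)))"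
  shows "AE w in lborel. a < w \<longrightarrow> S w = 0"
proof -
  have zero: "(\<integral>\<^sup>+w. indicator {c..} w * S w \<partial>lborel) = 0" if c: "a < c" for c
  proof -
    define \<delta> where "\<delta> = \<theta> c - \<theta> a"
    have \<delta>: "0 < \<delta>" using mono[of a c] c by (simp add: \<delta>_def)
    have "(\<integral>\<^sup>+w. indicator {c..} w * S w \<partial>lborel) \<le> 0 + ennreal e" if e: "0 < e" for e
    proof -
      have "((\<lambda>\<tau>. K * exp (- (2 * \<delta> * \<tau>))) \<longlongrightarrow> K * 0) at_top"
        using \<delta> by (intro tendsto_intros filterlim_compose[OF exp_at_bot] filterlim_uminus_at_bot_at_top[THEN filterlim_compose]
            filterlim_tendsto_pos_mult_at_top[OF tendsto_const]) (auto intro: filterlim_ident)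
      then have "eventually (\<lambda>\<tau>. K * exp (- (2 * \<delta> * \<tau>)) < e) at_top"
        using e by (intro order_tendstoD) auto
      then obtain T where T: "\<And>\<tau>. T \<le> \<tau> \<Longrightarrow> K * exp (- (2 * \<delta> * \<tau>)) < e" by (auto simp: eventually_at_top_linorder)
      obtain \<tau> where \<tau>: "\<tau> \<ge> max T 0" and b: "(\<integral>\<^sup>+w. indicator {a..} w * (ennreal (exp (2 * (\<tau> * \<theta> w))) * S w) \<partial>lborel) \<le> ennreal (K * exp (2 * (\<tau> * \<theta> a)))"
        using bound by blast
      have "(\<integral>\<^sup>+w. indicator {c..} w * S w \<partial>lborel) \<le> (\<integral>\<^sup>+w. ennreal (exp (- (2 * (\<tau> * \<theta> c)))) * (indicator {a..} w * (ennreal (exp (2 * (\<tau> * \<theta> w))) * S w)) \<partial>lborel)"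
      proof (rule nn_integral_mono)
        fix w
        show "indicator {c..} w * S w \<le> ennreal (exp (- (2 * (\<tau> * \<theta> c)))) * (indicator {a..} w * (ennreal (exp (2 * (\<tau> * \<theta> w))) * S w))"
        proof (cases "c \<le> w")
          case True
          have "\<theta> c \<le> \<theta> w" using mono[of c w] True c by (cases "c = w") auto
          then have "\<tau> * \<theta> c \<le> \<tau> * \<theta> w" using \<tau> by (intro mult_left_mono) auto
          then have "1 \<le> exp (- (2 * (\<tau> * \<theta> c))) * exp (2 * (\<tau> * \<theta> w))" by (simp flip: exp_add)
          then have "1 * S w \<le> ennreal (exp (- (2 * (\<tau> * \<theta> c))) * exp (2 * (\<tau> * \<theta> w))) * S w"
            by (intro mult_right_mono) (auto simp: ennreal_1[symmetric] simp del: ennreal_1 intro!: ennreal_leI)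
          then show ?thesis using True c by (simp add: ennreal_mult mult.assoc)
        qed simp
      qed
      also have "\<dots> = ennreal (exp (- (2 * (\<tau> * \<theta> c)))) * (\<integral>\<^sup>+w. indicator {a..} w * (ennreal (exp (2 * (\<tau> * \<theta> w))) * S w) \<partial>lborel)"
      proof (rule nn_integral_cmult)
        have "mono_on {a..} \<theta>"
          using mono by (intro mono_onI) (metis atLeast_iff less_eq_real_def order_refl)
        then have "(\<lambda>w. indicator {a..} w *\<^sub>R \<theta> w) \<in> borel_measurable borel"
          using borel_measurable_mono_on_fnc[of "{a..}" \<theta>] by (subst borel_measurable_restrict_space_iff[symmetric]) auto
        then have "(\<lambda>w. indicator {a..} w * (ennreal (exp (2 * (\<tau> * (indicator {a..} w *\<^sub>R \<theta> w)))) * S w)) \<in> borel_measurable borel"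
          by measurable
        also have "(\<lambda>w. indicator {a..} w * (ennreal (exp (2 * (\<tau> * (indicator {a..} w *\<^sub>R \<theta> w)))) * S w)) = (\<lambda>w. indicator {a..} w * (ennreal (exp (2 * (\<tau> * \<theta> w))) * S w))"
          by (auto simp: indicator_def)
        finally show "(\<lambda>w. indicator {a..} w * (ennreal (exp (2 * (\<tau> * \<theta> w))) * S w)) \<in> borel_measurable lborel" by simp
      qed
      also have "\<dots> \<le> ennreal (exp (- (2 * (\<tau> * \<theta> c)))) * ennreal (K * exp (2 * (\<tau> * \<theta> a)))"
        by (intro mult_left_mono b) simp
      also have "\<dots> = ennreal (exp (- (2 * (\<tau> * \<theta> c))) * (K * exp (2 * (\<tau> * \<theta> a))))"
        by (rule ennreal_mult'[symmetric]) simp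
      also have "exp (- (2 * (\<tau> * \<theta> c))) * (K * exp (2 * (\<tau> * \<theta> a))) = K * (exp (- (2 * (\<tau> * \<theta> c))) * exp (2 * (\<tau> * \<theta> a)))" by simp
      also have "\<dots> = K * exp (- (2 * \<delta> * \<tau>))"
        unfolding exp_add[symmetric] by (simp add: \<delta>_def algebra_simps)
      also have "ennreal \<dots> \<le> ennreal e" using T[of \<tau>] \<tau> by (intro ennreal_leI) auto
      finally show ?thesis by simp
    qed
    then have "(\<integral>\<^sup>+w. indicator {c..} w * S w \<partial>lborel) \<le> 0" by (rule ennreal_le_epsilon)
    then show ?thesis by simp
  qed
  have "AE w in lborel. \<forall>n. indicator {a + 1 / real (Suc n)..} w * S w = 0"
  proof (subst AE_all_countable, intro allI)
    fix n
    have "(\<integral>\<^sup>+w. indicator {a + 1 / real (Suc n)..} w * S w \<partial>lborel) = 0" by (rule zero) simp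
    then show "AE w in lborel. indicator {a + 1 / real (Suc n)..} w * S w = 0"
      by (subst (asm) nn_integral_0_iff_AE) auto
  qed
  then show ?thesis
  proof eventually_elim
    case (elim w)
    show ?case
    proof
      assume "a < w"
      then obtain n where n: "1 / real (Suc n) < w - a" using nat_approx_posE[of "w - a"] by (metis diff_gt_0_iff_gt)
      then have "w \<in> {a + 1 / real (Suc n)..}" by auto
      then show "S w = 0" using elim[rule_format, of n] by (simp add: indicator_def)
    qed
  qed
qed

lemma nn_integral_slice_sq:
  assumes "cyl_sq g" shows "(\<integral>\<^sup>+w. slice_sq g w \<partial>lborel) = (\<integral>\<^sup>+z. ennreal ((norm (g z))\<^sup>2) \<partial>lborel)"
proof -
  note [measurable] = cyl_sq_measurable[OF assms]
  have "(\<integral>\<^sup>+z. ennreal ((norm (g z))\<^sup>2) \<partial>lborel) = (\<integral>\<^sup>+z. ennreal ((norm (g z))\<^sup>2) \<partial>(lborel \<Otimes>\<^sub>M lborel))"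
    by (simp add: lborel_prod)
  also have "\<dots> = (\<integral>\<^sup>+w. \<integral>\<^sup>+y. ennreal ((norm (g (w, y)))\<^sup>2) \<partial>lborel \<partial>lborel)"
    by (rule lborel.nn_integral_fst[symmetric]) measurable
  finally show ?thesis by (simp add: slice_sq_def)
qed

text \<open>Up to \<open>w1\<close> the weight is bounded and square integrability of u suffices.
  Beyond \<open>w1\<close> the slice norm is at most K^2 exp(-2 N \<theta>) times the volume of the
  cell, and \<open>ev\<close> leaves the integrable majorant exp(-w).\<close>

lemma weighted_slice_integral_finite:
  fixes u :: "real \<times> (real ^ 'd) \<Rightarrow> complex" and \<omega> \<theta> :: "real \<Rightarrow> real"
  assumes u: "cyl_sq u"
    and decay: "AE z in lborel. w0 \<le> fst z \<longrightarrow> norm (u z) \<le> K * exp (- N * \<theta> (fst z))"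
    and \<omega>: "continuous_on {a..} \<omega>" "\<And>w. a \<le> w \<Longrightarrow> 0 \<le> \<omega> w"
    and ev: "eventually (\<lambda>w. \<omega> w * exp (- (2 * N * \<theta> w)) \<le> exp (- w)) at_top"
  shows "(\<integral>\<^sup>+w. indicator {a..} w * (ennreal (\<omega> w) * slice_sq u w) \<partial>lborel) < \<infinity>"
proof -
  note [measurable] = cyl_sq_measurable[OF u] slice_sq_measurable[OF u]
  let ?V = "emeasure lborel (torus_cell :: (real^'d) set)"
  obtain w2 where w2: "\<And>w. w2 \<le> w \<Longrightarrow> \<omega> w * exp (- (2 * N * \<theta> w)) \<le> exp (- w)"
    using ev by (auto simp: eventually_at_top_linorder)
  define w1 where "w1 = max (max w0 w2) a"
  have "compact (\<omega> ` {a..w1})" using \<omega>(1) by (intro compact_continuous_image) (auto intro: continuous_on_subset)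
  then have "bounded (\<omega> ` {a..w1})" by (rule compact_imp_bounded)
  then obtain B where "\<forall>y\<in>\<omega> ` {a..w1}. norm y \<le> B" unfolding bounded_iff by blast
  then have B: "\<omega> w \<le> B" if "a \<le> w" "w \<le> w1" for w using that by force
  have "AE z in lborel \<Otimes>\<^sub>M lborel. w0 \<le> fst z \<longrightarrow> norm (u z) \<le> K * exp (- N * \<theta> (fst z))"
  proof -
    have L: "lborel \<Otimes>\<^sub>M lborel = (lborel :: (real \<times> (real^'d)) measure)" by (rule lborel_prod)
    show ?thesis unfolding L by (rule decay)
  qed
  then have "AE w in lborel. AE y in lborel. w0 \<le> fst (w, y) \<longrightarrow> norm (u (w, y)) \<le> K * exp (- N * \<theta> (fst (w, y)))"
    by (rule lborel_pair.AE_pair)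
  then have ptw: "AE w in lborel. indicator {a..} w * (ennreal (\<omega> w) * slice_sq u w) \<le>
     ennreal B * slice_sq u w + (?V * ennreal (K\<^sup>2)) * (ennreal (exp (- w)) * indicator {w1..} w)"
  proof eventually_elim
    case (elim w)
    consider "w < a" | "a \<le> w" "w \<le> w1" | "w1 < w" by linarith
    then show ?case
    proof cases
      case 2
      then have "indicator {a..} w * (ennreal (\<omega> w) * slice_sq u w) \<le> ennreal B * slice_sq u w"
        using B[of w] by (auto intro!: mult_right_mono ennreal_leI)
      then show ?thesis by (rule order_trans) simp
    next
      case 3
      then have w: "w0 \<le> w" "w2 \<le> w" "a \<le> w" by (auto simp: w1_def)
      have "slice_sq u w \<le> (\<integral>\<^sup>+y. ennreal (K\<^sup>2 * exp (- (2 * N * \<theta> w))) * indicator torus_cell y \<partial>(lborel :: (real^'d) measure))"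
        unfolding slice_sq_def
      proof (rule nn_integral_mono_AE, use elim in eventually_elim)
        case (elim y)
        show ?case
        proof (cases "y \<in> torus_cell")
          case True
          have "norm (u (w, y)) \<le> K * exp (- N * \<theta> w)" using elim w by simp
          then have "(norm (u (w, y)))\<^sup>2 \<le> (K * exp (- N * \<theta> w))\<^sup>2" by (intro power_mono) auto
          also have "\<dots> = K\<^sup>2 * exp (- (2 * N * \<theta> w))"
            by (simp add: power_mult_distrib algebra_simps flip: exp_double)
          finally show ?thesis using True by (simp add: ennreal_leI)
        next
          case False
          then have "u (w, y) = 0" using u by (auto simp: cyl_sq_def cyl_domain_def)
          then show ?thesis by simp
        qed
      qed
      also have "\<dots> = ennreal (K\<^sup>2 * exp (- (2 * N * \<theta> w))) * ?V"
        by (rule nn_integral_cmult_indicator) simp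
      finally have "ennreal (\<omega> w) * slice_sq u w \<le> ennreal (\<omega> w) * (ennreal (K\<^sup>2 * exp (- (2 * N * \<theta> w))) * ?V)"
        by (rule mult_left_mono) simp
      also have "\<dots> = ennreal (K\<^sup>2 * (\<omega> w * exp (- (2 * N * \<theta> w)))) * ?V"
        using \<omega>(2)[OF w(3)] by (simp add: ennreal_mult mult_ac)
      also have "\<dots> \<le> ennreal (K\<^sup>2 * exp (- w)) * ?V"
        by (intro mult_right_mono ennreal_leI mult_left_mono w2 w) auto
      also have "\<dots> = (?V * ennreal (K\<^sup>2)) * (ennreal (exp (- w)) * indicator {w1..} w)"
        using 3 by (simp add: ennreal_mult mult_ac)
      finally show ?thesis using w by (simp add: add_increasing)
    qed simp
  qed
  have "(\<integral>\<^sup>+w. indicator {a..} w * (ennreal (\<omega> w) * slice_sq u w) \<partial>lborel) \<le>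
    (\<integral>\<^sup>+w. ennreal B * slice_sq u w + (?V * ennreal (K\<^sup>2)) * (ennreal (exp (- w)) * indicator {w1..} w) \<partial>lborel)"
    by (rule nn_integral_mono_AE[OF ptw])
  also have "\<dots> = ennreal B * (\<integral>\<^sup>+w. slice_sq u w \<partial>lborel) + (?V * ennreal (K\<^sup>2)) * (\<integral>\<^sup>+w. ennreal (exp (- w)) * indicator {w1..} w \<partial>lborel)"
    by (simp add: nn_integral_add nn_integral_cmult)
  also have "(\<integral>\<^sup>+w. ennreal (exp (- w)) * indicator {w1..} w \<partial>lborel) = ennreal (0 - (- exp (- w1)))"
  proof (rule nn_integral_FTC_atLeast[where F="\<lambda>w. - exp (- w)"])
    have "((\<lambda>w::real. exp (- w)) \<longlongrightarrow> 0) at_top"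
      by (rule filterlim_compose[OF exp_at_bot filterlim_uminus_at_bot_at_top])
    from tendsto_minus[OF this] show "((\<lambda>w::real. - exp (- w)) \<longlongrightarrow> 0) at_top" by simp
  qed (auto intro!: derivative_eq_intros)
  also have "(\<integral>\<^sup>+w. slice_sq u w \<partial>lborel) = ennreal (LINT z|lborel. (norm (u z))\<^sup>2)"
    unfolding nn_integral_slice_sq[OF u] using u by (intro nn_integral_eq_integral) (auto simp: cyl_sq_def)
  also have "ennreal B * ennreal (LINT z|lborel. (norm (u z))\<^sup>2) + ?V * ennreal (K\<^sup>2) * ennreal (0 - - exp (- w1)) < \<infinity>"
    using emeasure_torus_cell_finite[where 'd='d] by (simp add: ennreal_mult_less_top)
  finally show ?thesis .
qed

section \<open>Gaps between sums of two squares\<close>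

text \<open>-1 is not a square mod p: with k = (p - 1)/2 odd, raising x^2 = - y^2 to the power k
  would give 1 = -1 mod p by Fermat's theorem, unless p divides x.\<close>

lemma prime_3_mod_4_dvd_sum_squares:
  fixes x y :: int
  assumes p: "prime p" "p mod 4 = 3" and dvd: "int p dvd x\<^sup>2 + y\<^sup>2"
  shows "int p dvd x"
proof (rule ccontr)
  assume x: "\<not> int p dvd x"
  have pi: "prime (int p)" using p(1) by simp
  have y: "\<not> int p dvd y"
  proof
    assume "int p dvd y"
    then have "int p dvd x\<^sup>2" using dvd by (simp add: dvd_add_left_iff power2_eq_square)
    then show False using x pi prime_dvd_power by blast
  qed
  define k where "k = (p - 1) div 2"
  have k: "p - 1 = 2 * k" "odd k" using p(2) unfolding k_def by presburger+
  have fermat: "[z ^ (p - 1) = 1] (mod int p)" if "\<not> int p dvd z" for z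
  proof -
    have "\<not> p dvd nat \<bar>z\<bar>" using that by (simp add: int_dvd_int_iff[symmetric])
    then have "[nat \<bar>z\<bar> ^ (p - 1) = 1] (mod p)" using p(1) fermat_theorem by blast
    then have "[int (nat \<bar>z\<bar> ^ (p - 1)) = int 1] (mod int p)" by (simp only: cong_int_iff)
    then show ?thesis using k by (simp add: power_mult)
  qed
  have "[x\<^sup>2 = - (y\<^sup>2)] (mod int p)" using dvd by (simp add: cong_iff_dvd_diff)
  then have "[(x\<^sup>2) ^ k = (- (y\<^sup>2)) ^ k] (mod int p)" by (rule cong_pow)
  then have "[x ^ (p - 1) = - (y ^ (p - 1))] (mod int p)"
    using k by (simp add: power_mult)
  moreover have "[- (y ^ (p - 1)) = - 1] (mod int p)" using fermat[OF y] by (simp add: cong_minus_minus_iff)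
  ultimately have "[1 = - 1] (mod int p)" using fermat[OF x] by (meson cong_sym cong_trans)
  then have "int p dvd 2" by (simp add: cong_iff_dvd_diff)
  then have "p \<le> 2" by (metis int_dvd_int_iff of_nat_numeral dvd_imp_le pos2)
  then show False using p(2) by (cases "p = 0 \<or> p = 1 \<or> p = 2") auto
qed

text \<open>An odd number all of whose prime factors are 1 mod 4 is itself 1 mod 4; the induction
  removes one such factor at a time.\<close>

lemma prime_factor_3_mod_4:
  fixes m :: nat
  shows "m mod 4 = 3 \<Longrightarrow> \<exists>p. prime p \<and> p dvd m \<and> p mod 4 = 3"
proof (induction m rule: less_induct)
  case (less m)
  then have "m \<noteq> 1" by auto
  then obtain p where p: "prime p" "p dvd m" using prime_factor_nat by blast
  show ?case
  proof (cases "p mod 4 = 3")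
    case False
    obtain k where k: "m = p * k" using p(2) by blast
    have "odd m" using less.prems by presburger
    then have "odd p" using k by simp
    then have p1: "p mod 4 = 1" using False by presburger
    have "m mod 4 = ((p mod 4) * k) mod 4" unfolding k by (simp add: mod_mult_left_eq)
    then have "k mod 4 = 3" using less.prems p1 by simp
    moreover have "k < m" using k p(1) \<open>k mod 4 = 3\<close> prime_gt_1_nat[OF p(1)] by (cases "k = 0") auto
    ultimately show ?thesis using less.IH[of k] k by (metis dvd_mult)
  qed (use p in blast)
qed

text \<open>Euclid's argument with 4 n! - 1, which is 3 mod 4 and prime to every number from 2 to n.
  Writing n! = k + 1 turns it into 4 k + 3 and avoids subtraction.\<close>

lemma exists_large_prime_3_mod_4: "\<exists>p>n. prime p \<and> p mod 4 = (3::nat)"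
proof -
  obtain k :: nat where k: "fact n = Suc k" using fact_gt_zero[of n, where 'a=nat] gr0_implies_Suc by blast
  have "(4 * k + 3) mod 4 = 3" by simp
  then obtain p where p: "prime p" "p dvd 4 * k + 3" "p mod 4 = 3" using prime_factor_3_mod_4 by blast
  have "p > n"
  proof (rule ccontr)
    assume "\<not> p > n"
    then have "p \<le> n" by simp
    then have "p dvd fact n" by (rule prime_dvd_fact_iff[OF p(1), THEN iffD2])
    then have "p dvd 4 * Suc k" unfolding k by (rule dvd_mult)
    then have "p dvd 4 * Suc k - (4 * k + 3)" using p(2) by (rule dvd_diff_nat)
    then show False using p(1) by simp
  qed
  then show ?thesis using p by blast
qed

text \<open>By the Chinese remainder theorem, \<open>n + i\<close> is exactly divisible by \<open>p\<^sub>i\<close> to the first power for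
  all \<open>i \<le> 2 M\<close>.\<close>

lemma sum_two_squares_gap: "\<exists>c\<ge>N. \<forall>x y :: int. int M < \<bar>x\<^sup>2 + y\<^sup>2 - int c\<bar>"
proof -
  obtain next_p where next_p: "\<And>n. next_p n > n \<and> prime (next_p n) \<and> next_p n mod 4 = (3::nat)"
    using exists_large_prime_3_mod_4 by metis
  define p where "p i = (next_p ^^ Suc i) 0" for i
  have p: "prime (p i)" "p i mod 4 = 3" "p i < p (Suc i)" for i
    using next_p by (auto simp: p_def)
  have "strict_mono p" using p(3) by (intro strict_mono_Suc_iff[THEN iffD2]) auto
  then have inj: "inj p" by (rule strict_mono_imp_inj_on)
  \<comment> \<open>The intended residue is p_i - i; adding i times (p_i)^2 keeps it a natural
    number. After adding i it becomes p_i modulo (p_i)^2.\<close>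
  have "\<exists>x. \<forall>i\<in>{..2 * M}. [x = p i + i * ((p i)\<^sup>2 - 1)] (mod (p i)\<^sup>2)"
  proof (rule chinese_remainder_nat)
    show "\<forall>i\<in>{..2 * M}. \<forall>j\<in>{..2 * M}. i \<noteq> j \<longrightarrow> coprime ((p i)\<^sup>2) ((p j)\<^sup>2)"
      using p(1) inj by (auto simp: primes_coprime inj_eq)
  qed auto
  then obtain x where x: "\<And>i. i \<le> 2 * M \<Longrightarrow> [x = p i + i * ((p i)\<^sup>2 - 1)] (mod (p i)\<^sup>2)" by auto
  \<comment> \<open>Adding a multiple of the product of the moduli moves the solution beyond N
    without changing any residue.\<close>
  define n where "n = x + N * (\<Prod>i\<le>2 * M. (p i)\<^sup>2)"
  have "(\<Prod>i\<le>2 * M. (p i)\<^sup>2) \<ge> 1"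
    using p(1) by (intro prod_ge_1) (auto simp: Suc_le_eq prime_gt_0_nat)
  then have "N * 1 \<le> N * (\<Prod>i\<le>2 * M. (p i)\<^sup>2)" by (rule mult_le_mono2)
  then have nN: "n \<ge> N" unfolding n_def by linarith
  have ni: "[n + i = p i] (mod (p i)\<^sup>2)" if i: "i \<le> 2 * M" for i
  proof -
    have "(p i)\<^sup>2 dvd (\<Prod>i\<le>2 * M. (p i)\<^sup>2)" using i by (intro dvd_prodI) auto
    then have "[n = x] (mod (p i)\<^sup>2)" by (simp add: n_def cong_add_lcancel_0_nat cong_0_iff)
    then have "[n = p i + i * ((p i)\<^sup>2 - 1)] (mod (p i)\<^sup>2)" using x[OF i] by (rule cong_trans)
    then have "[n + i = p i + i * ((p i)\<^sup>2 - 1) + i] (mod (p i)\<^sup>2)" by (intro cong_add) auto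
    moreover have "p i + i * ((p i)\<^sup>2 - 1) + i = p i + i * (p i)\<^sup>2"
      using prime_gt_0_nat[OF p(1)[of i]] by (cases "(p i)\<^sup>2") (auto simp: algebra_simps)
    moreover have "[p i + i * (p i)\<^sup>2 = p i] (mod (p i)\<^sup>2)" by (simp add: cong_add_lcancel_0_nat cong_0_iff)
    ultimately show ?thesis by (metis cong_trans)
  qed
  \<comment> \<open>A representation as x^2 + y^2 would have p_i dividing x and y, hence (p_i)^2
    dividing n + i, against the residue p_i.\<close>
  have no: "int (n + i) \<noteq> x\<^sup>2 + y\<^sup>2" if i: "i \<le> 2 * M" for i x y
  proof
    assume eq: "int (n + i) = x\<^sup>2 + y\<^sup>2"
    have "[n + i = p i] (mod p i)" using ni[OF i] by (rule cong_dvd_modulus_nat) simp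
    then have "p i dvd n + i" by (simp add: cong_dvd_iff)
    then have d: "int (p i) dvd x\<^sup>2 + y\<^sup>2" unfolding eq[symmetric] by (simp only: int_dvd_int_iff)
    have "int (p i) dvd x" "int (p i) dvd y"
      using prime_3_mod_4_dvd_sum_squares[OF p(1,2) d] prime_3_mod_4_dvd_sum_squares[OF p(1,2), of i y x] d by (auto simp: add.commute)
    then have "(int (p i))\<^sup>2 dvd x\<^sup>2 + y\<^sup>2" by (simp add: dvd_power_same)
    then have "int ((p i)\<^sup>2) dvd int (n + i)" unfolding eq by simp
    then have "(p i)\<^sup>2 dvd n + i" by (simp only: int_dvd_int_iff)
    then have "(p i)\<^sup>2 dvd p i" using ni[OF i] by (simp add: cong_dvd_iff)
    then have "(p i)\<^sup>2 \<le> p i" using prime_gt_0_nat[OF p(1)[of i]] by (intro dvd_imp_le)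
    then show False using prime_gt_1_nat[OF p(1)[of i]] by (simp add: power2_eq_square)
  qed
  show ?thesis
  \<comment> \<open>The centre of the window n, ..., n + 2 M: an integer within M of it lies in the
    window.\<close>
  proof (intro exI[of _ "n + M"] conjI allI)
    show "N \<le> n + M" using nN by simp
    fix x y :: int
    show "int M < \<bar>x\<^sup>2 + y\<^sup>2 - int (n + M)\<bar>"
    proof (rule ccontr)
      assume "\<not> ?thesis"
      then have "x\<^sup>2 + y\<^sup>2 \<ge> int n" "x\<^sup>2 + y\<^sup>2 \<le> int (n + 2 * M)" by auto
      then have "int (n + nat (x\<^sup>2 + y\<^sup>2 - int n)) = x\<^sup>2 + y\<^sup>2" "nat (x\<^sup>2 + y\<^sup>2 - int n) \<le> 2 * M" by auto
      then show False using no by blast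
    qed
  qed
qed

section \<open>Uniqueness from families of weights\<close>

lemma AE_obtain_in_interval:
  fixes b c :: real
  assumes "AE x in lborel. P x" "b < c"
  obtains x where "b < x" "x < c" "P x"
proof (cases "\<exists>x. b < x \<and> x < c \<and> P x")
  case False
  have "AE x in lborel. x \<notin> {b<..<c}"
    using assms(1) by eventually_elim (use False in auto)
  then have "{b<..<c} \<in> null_sets lborel" by (subst (asm) AE_iff_null_sets[symmetric]) auto
  then show ?thesis using assms(2) by (simp add: null_sets_def)
qed (use that in blast)

lemma slice_sq_mono_AE:
  assumes f: "cyl_sq f" and u: "cyl_sq u" and fu: "AE z in lborel. norm (f z) \<le> C * norm (u z)"
  shows "AE w in lborel. slice_sq f w \<le> ennreal (C\<^sup>2) * slice_sq u w"
proof -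
  note [measurable] = cyl_sq_measurable[OF u]
  have "AE z in lborel \<Otimes>\<^sub>M lborel. norm (f z) \<le> C * norm (u z)"
    unfolding lborel_prod by (rule fu)
  then have "AE w in lborel. AE y in lborel. norm (f (w, y)) \<le> C * norm (u (w, y))"
    by (rule lborel_pair.AE_pair)
  then show ?thesis
  proof eventually_elim
    case (elim w)
    have "slice_sq f w \<le> (\<integral>\<^sup>+y. ennreal (C\<^sup>2) * ennreal ((norm (u (w, y)))\<^sup>2) \<partial>lborel)"
      unfolding slice_sq_def
    proof (rule nn_integral_mono_AE, use elim in eventually_elim)
      case (elim y)
      then have "(norm (f (w, y)))\<^sup>2 \<le> (C * norm (u (w, y)))\<^sup>2" by (intro power_mono) auto
      then show ?case by (simp add: power_mult_distrib ennreal_mult[symmetric] ennreal_leI)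
    qed
    also have "\<dots> = ennreal (C\<^sup>2) * slice_sq u w"
      unfolding slice_sq_def by (rule nn_integral_cmult) measurable
    finally show ?case .
  qed
qed

text \<open>The symbol bound C^2 + 1 leaves one copy of the weighted norm of u after C^2 copies
  absorb f. For every b > 0 a good a exists between b and 2 b, which gives vanishing beyond 2 b;
  letting b tend to 0 along 1/(n + 1) covers the half-line.\<close>

lemma uniqueness_of_weights:
  fixes u u1 f Y :: "real \<times> (real ^ 'd) \<Rightarrow> complex" and \<theta> \<theta>1 \<theta>2 :: "real \<Rightarrow> real"
  assumes u: "cyl_sq u" and u1: "cyl_sq u1" and f: "cyl_sq f" and Y: "cyl_sq Y" and fi: "integrable lborel f"
    and sys: "weak_system u u1 f Y"
    and fu: "AE z in lborel. norm (f z) \<le> C * norm (u z)"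
    and weights: "\<And>a T. 0 < a \<Longrightarrow> \<exists>\<tau>\<ge>T. 0 < \<tau> \<and> weight a (\<lambda>w. \<tau> * \<theta> w) (\<lambda>w. \<tau> * \<theta>1 w) (\<lambda>w. \<tau> * \<theta>2 w) \<and>
      (\<forall>k::int^'d. \<forall>w\<ge>a. C\<^sup>2 + 1 \<le> (\<tau> * \<theta>1 w + sqrt (freq_sq k))\<^sup>2 * (\<tau> * \<theta>1 w - sqrt (freq_sq k))\<^sup>2 +
        \<tau> * \<theta>2 w * (\<tau> * \<theta>1 w + sqrt (freq_sq k)) * (3 * (\<tau> * \<theta>1 w) - sqrt (freq_sq k)))"
    and fin0: "\<And>a \<tau>. 0 < a \<Longrightarrow> 0 < \<tau> \<Longrightarrow>
      (\<integral>\<^sup>+w. indicator {a..} w * (ennreal (exp (2 * (\<tau> * \<theta> w))) * slice_sq u w) \<partial>lborel) < \<infinity>"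
    and fin3: "\<And>a \<tau> \<mu>. 0 < a \<Longrightarrow> 0 < \<tau> \<Longrightarrow> 0 \<le> \<mu> \<Longrightarrow>
      (\<integral>\<^sup>+w. indicator {a..} w * (ennreal ((\<tau> * \<theta>1 w + \<mu>) ^ 3 * exp (2 * (\<tau> * \<theta> w))) * slice_sq u w) \<partial>lborel) < \<infinity>"
    and mono: "\<And>x y. 0 < x \<Longrightarrow> x < y \<Longrightarrow> \<theta> x < \<theta> y"
  shows "AE z in lborel. u z = 0"
proof -
  note [measurable] = cyl_sq_measurable[OF u] slice_sq_measurable[OF u] slice_sq_measurable[OF f]
  have sl: "AE w in lborel. 2 * b < w \<longrightarrow> slice_sq u w = 0" if b: "0 < b" for b
  proof -
    have b0: "0 \<le> b" "b < 2 * b" using b by auto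
    have "AE a in lborel. b < a \<longrightarrow> (\<exists>K\<ge>0. carleman_at u f a K)"
      by (rule carleman_inequality[OF u u1 f Y fi sys b0(1)])
    then obtain a where a: "b < a" "a < 2 * b" and "b < a \<longrightarrow> (\<exists>K\<ge>0. carleman_at u f a K)"
      using b0(2) by (rule AE_obtain_in_interval)
    then obtain K where K: "0 \<le> K" and carleman: "carleman_at u f a K" by blast
    have a0: "0 < a" using a b by simp
    have "AE w in lborel. a < w \<longrightarrow> slice_sq u w = 0"
    proof (rule AE_zero_of_exponential_weights[OF slice_sq_measurable[OF u] _ K])
      show "\<theta> x < \<theta> y" if "a \<le> x" "x < y" for x y using mono that a0 by simp
      fix T
      obtain \<tau> where \<tau>: "T \<le> \<tau>" "0 < \<tau>" and wt: "weight a (\<lambda>w. \<tau> * \<theta> w) (\<lambda>w. \<tau> * \<theta>1 w) (\<lambda>w. \<tau> * \<theta>2 w)"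
        and W: "\<forall>k::int^'d. \<forall>w\<ge>a. C\<^sup>2 + 1 \<le> (\<tau> * \<theta>1 w + sqrt (freq_sq k))\<^sup>2 * (\<tau> * \<theta>1 w - sqrt (freq_sq k))\<^sup>2 +
        \<tau> * \<theta>2 w * (\<tau> * \<theta>1 w + sqrt (freq_sq k)) * (3 * (\<tau> * \<theta>1 w) - sqrt (freq_sq k))"
        using weights[OF a0, of T] by blast
      have [measurable]: "(\<lambda>w. \<tau> * \<theta> w) \<in> borel_measurable borel" using wt by (simp add: weight_def)
      define I where "I = (\<integral>\<^sup>+w. indicator {a..} w * (ennreal (exp (2 * (\<tau> * \<theta> w))) * slice_sq u w) \<partial>lborel)"
      have I: "I < \<infinity>" unfolding I_def by (rule fin0[OF a0 \<tau>(2)])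
      have f3: "\<forall>\<mu>\<ge>0. (\<integral>\<^sup>+w. indicator {a..} w * (ennreal ((\<tau> * \<theta>1 w + \<mu>) ^ 3 * exp (2 * (\<tau> * \<theta> w))) * slice_sq u w) \<partial>lborel) < \<infinity>"
        using fin3[OF a0 \<tau>(2)] by blast
      have m0: "0 \<le> C\<^sup>2 + 1" by simp
      have "ennreal (C\<^sup>2) * I + I = (\<integral>\<^sup>+w. ennreal (C\<^sup>2) * (indicator {a..} w * (ennreal (exp (2 * (\<tau> * \<theta> w))) * slice_sq u w)) +
         indicator {a..} w * (ennreal (exp (2 * (\<tau> * \<theta> w))) * slice_sq u w) \<partial>lborel)"
        unfolding I_def by (subst nn_integral_add) (auto simp: nn_integral_cmult)
      also have "\<dots> = (\<integral>\<^sup>+w. indicator {a..} w * (ennreal ((C\<^sup>2 + 1) * exp (2 * (\<tau> * \<theta> w))) * slice_sq u w) \<partial>lborel)"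
      proof (rule nn_integral_cong)
        fix w
        have "ennreal ((C\<^sup>2 + 1) * exp (2 * (\<tau> * \<theta> w))) = ennreal (C\<^sup>2) * ennreal (exp (2 * (\<tau> * \<theta> w))) + ennreal (exp (2 * (\<tau> * \<theta> w)))"
          by (simp add: distrib_right ennreal_plus ennreal_mult)
        then show "ennreal (C\<^sup>2) * (indicator {a..} w * (ennreal (exp (2 * (\<tau> * \<theta> w))) * slice_sq u w)) +
         indicator {a..} w * (ennreal (exp (2 * (\<tau> * \<theta> w))) * slice_sq u w) = indicator {a..} w * (ennreal ((C\<^sup>2 + 1) * exp (2 * (\<tau> * \<theta> w))) * slice_sq u w)"
          by (simp only: distrib_right distrib_left mult_ac)
      qed
      also have "\<dots> \<le> (\<integral>\<^sup>+w. indicator {a..} w * (ennreal (exp (2 * (\<tau> * \<theta> w))) * slice_sq f w) \<partial>lborel) + ennreal (K * exp (2 * (\<tau> * \<theta> a)))"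
        by (rule carleman[unfolded carleman_at_def, THEN spec, THEN spec, THEN spec, THEN spec, THEN mp, THEN mp, THEN mp, THEN mp, OF wt m0 W f3])
      also have "(\<integral>\<^sup>+w. indicator {a..} w * (ennreal (exp (2 * (\<tau> * \<theta> w))) * slice_sq f w) \<partial>lborel) \<le>
        (\<integral>\<^sup>+w. ennreal (C\<^sup>2) * (indicator {a..} w * (ennreal (exp (2 * (\<tau> * \<theta> w))) * slice_sq u w)) \<partial>lborel)"
      proof (rule nn_integral_mono_AE, use slice_sq_mono_AE[OF f u fu] in eventually_elim)
        case (elim w)
        have "indicator {a..} w * (ennreal (exp (2 * (\<tau> * \<theta> w))) * slice_sq f w) \<le> indicator {a..} w * (ennreal (exp (2 * (\<tau> * \<theta> w))) * (ennreal (C\<^sup>2) * slice_sq u w))"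
          by (intro mult_left_mono elim) auto
        then show ?case by (simp add: mult_ac)
      qed
      also have "\<dots> = ennreal (C\<^sup>2) * I" unfolding I_def by (rule nn_integral_cmult) measurable
      finally have "ennreal (C\<^sup>2) * I + I \<le> ennreal (C\<^sup>2) * I + ennreal (K * exp (2 * (\<tau> * \<theta> a)))"
        by (simp add: add_right_mono)
      \<comment> \<open>The cancellation in \<open>ennreal\<close> is legitimate because I is
        finite. This is where decay faster than every weight of the family is indispensable.\<close>
      moreover have "ennreal (C\<^sup>2) * I \<noteq> \<infinity>" using I by (simp add: ennreal_mult_eq_top_iff)
      ultimately have "I \<le> ennreal (K * exp (2 * (\<tau> * \<theta> a)))"
        by (simp add: ennreal_add_left_cancel_le)
      then show "\<exists>\<tau>\<ge>T. (\<integral>\<^sup>+w. indicator {a..} w * (ennreal (exp (2 * (\<tau> * \<theta> w))) * slice_sq u w) \<partial>lborel) \<le> ennreal (K * exp (2 * (\<tau> * \<theta> a)))"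
        using \<tau>(1) unfolding I_def by blast
    qed
    then show ?thesis by eventually_elim (use a in auto)
  qed
  have "AE w in lborel. \<forall>n. 2 * (1 / real (Suc n)) < w \<longrightarrow> slice_sq u w = 0"
    by (subst AE_all_countable, intro allI sl) simp
  then have "AE w in lborel. slice_sq u w = 0"
  proof eventually_elim
    case (elim w)
    show ?case
    proof (cases "0 < w")
      case True
      then obtain n where "1 / real (Suc n) < w / 2" using nat_approx_posE[of "w / 2"] by auto
      then have "2 * (1 / real (Suc n)) < w" by simp
      then show ?thesis using elim by blast
    next
      case False
      then have "u (w, y) = 0" for y using u by (auto simp: cyl_sq_def cyl_domain_def)
      then show ?thesis by (simp add: slice_sq_def)
    qed
  qed
  then have "(\<integral>\<^sup>+w. slice_sq u w \<partial>lborel) = 0"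
    by (subst nn_integral_0_iff_AE) auto
  then have "(\<integral>\<^sup>+z. ennreal ((norm (u z))\<^sup>2) \<partial>lborel) = 0" by (simp add: nn_integral_slice_sq[OF u])
  then have "AE z in lborel. ennreal ((norm (u z))\<^sup>2) = 0"
    by (subst (asm) nn_integral_0_iff_AE) auto
  then show ?thesis by eventually_elim simp
qed

section \<open>The two families of weights and their symbol bounds\<close>

lemma weight_four_thirds:
  assumes a: "0 < a" and \<tau>: "0 < \<tau>"
  shows "weight a (\<lambda>w. \<tau> * w powr (4/3)) (\<lambda>w. \<tau> * (4/3 * w powr (1/3))) (\<lambda>w. \<tau> * (4/9 * w powr (-2/3)))"
  unfolding weight_def
proof (intro conjI allI impI)
  show "filterlim (\<lambda>w. \<tau> * w powr (4/3)) at_top at_top" using \<tau> by real_asymp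
  show "continuous_on {a..} (\<lambda>w. \<tau> * (4/9 * w powr (-2/3)))"
    using a by (intro continuous_intros) auto
  fix w assume w: "a \<le> w"
  then have w0: "0 < w" using a by simp
  show "((\<lambda>w. \<tau> * w powr (4/3)) has_real_derivative \<tau> * (4/3 * w powr (1/3))) (at w)"
    using w0 by (auto intro!: derivative_eq_intros)
  show "((\<lambda>w. \<tau> * (4/3 * w powr (1/3))) has_real_derivative \<tau> * (4/9 * w powr (-2/3))) (at w)"
    using w0 by (auto intro!: derivative_eq_intros)
  show "0 < \<tau> * (4/3 * w powr (1/3))" "0 \<le> \<tau> * (4/9 * w powr (-2/3))"
    using \<tau> w0 by auto
qed measurable

lemma symbol_bound_four_thirds:
  fixes a m T :: real
  assumes a: "0 < a" and m: "0 \<le> m"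
  shows "\<exists>\<tau>\<ge>T. 0 < \<tau> \<and> weight a (\<lambda>w. \<tau> * w powr (4/3)) (\<lambda>w. \<tau> * (4/3 * w powr (1/3))) (\<lambda>w. \<tau> * (4/9 * w powr (-2/3))) \<and>
    (\<forall>\<mu>\<ge>0. \<forall>w\<ge>a. m \<le> (\<tau> * (4/3 * w powr (1/3)) + \<mu>)\<^sup>2 * (\<tau> * (4/3 * w powr (1/3)) - \<mu>)\<^sup>2 +
       \<tau> * (4/9 * w powr (-2/3)) * (\<tau> * (4/3 * w powr (1/3)) + \<mu>) * (3 * (\<tau> * (4/3 * w powr (1/3))) - \<mu>))"
proof -
  \<comment> \<open>Each entry secures one hypothesis of
    \<open>conjugated_symbol_lower_bound\<close>: a powr (-4/3) gives 3 Q \<le> P^2; the entries 1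
    and 2 m give m \<le> Q P^2, which equals 64/81 \<tau>^3 for every w; the last entry gives P
    \<ge> m + 1, hence m \<le> 2 P^4. The worst point is w = a, since the relevant powers of w
    increase.\<close>
  define \<tau> where "\<tau> = Max {T, 1, 2 * m, a powr (-4/3), a powr (-1/3) * (m + 1)}"
  have \<tau>: "T \<le> \<tau>" "1 \<le> \<tau>" "2 * m \<le> \<tau>" "a powr (-4/3) \<le> \<tau>" "a powr (-1/3) * (m + 1) \<le> \<tau>"
    unfolding \<tau>_def by (rule Max_ge; simp)+
  have "m \<le> (\<tau> * (4/3 * w powr (1/3)) + \<mu>)\<^sup>2 * (\<tau> * (4/3 * w powr (1/3)) - \<mu>)\<^sup>2 +
       \<tau> * (4/9 * w powr (-2/3)) * (\<tau> * (4/3 * w powr (1/3)) + \<mu>) * (3 * (\<tau> * (4/3 * w powr (1/3))) - \<mu>)"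
    if \<mu>: "0 \<le> \<mu>" and w: "a \<le> w" for \<mu> w
  proof (rule conjugated_symbol_lower_bound)
    have w0: "0 < w" using w a by simp
    show "0 < \<tau> * (4/3 * w powr (1/3))" using \<tau> w0 by simp
    show "0 \<le> \<tau> * (4/9 * w powr (-2/3))" using \<tau> by simp
    have sq: "(w powr (1/3))\<^sup>2 = w powr (2/3)" using w0 by (simp add: powr_powr flip: powr_numeral)
    have "1 = a powr (-4/3) * a powr (4/3)" using a by (simp flip: powr_add)
    also have "\<dots> \<le> \<tau> * w powr (4/3)"
      using \<tau> a w by (intro mult_mono powr_mono2) auto
    finally have "1 \<le> \<tau> * w powr (4/3)" .
    then have "(\<tau> * w powr (-2/3)) * 1 \<le> (\<tau> * w powr (-2/3)) * (\<tau> * w powr (4/3))"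
      using \<tau> by (intro mult_left_mono) auto
    also have "\<dots> = \<tau>\<^sup>2 * (w powr (-2/3) * w powr (4/3))" by (simp add: power2_eq_square)
    also have "w powr (-2/3) * w powr (4/3) = w powr (2/3)" by (simp flip: powr_add)
    finally have le: "\<tau> * w powr (-2/3) \<le> \<tau>\<^sup>2 * w powr (2/3)" by simp
    have P2: "(\<tau> * (4/3 * w powr (1/3)))\<^sup>2 = 16/9 * (\<tau>\<^sup>2 * w powr (2/3))"
    proof -
      have "(\<tau> * (4/3 * x))\<^sup>2 = 16/9 * (\<tau>\<^sup>2 * x\<^sup>2)" for x by (simp add: power2_eq_square)
      then show ?thesis by (simp only: sq)
    qed
    show "3 * (\<tau> * (4/9 * w powr (-2/3))) \<le> (\<tau> * (4/3 * w powr (1/3)))\<^sup>2"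
    proof -
      have "3 * (\<tau> * (4/9 * w powr (-2/3))) = 4/3 * (\<tau> * w powr (-2/3))" by simp
      moreover have "0 \<le> \<tau>\<^sup>2 * w powr (2/3)" by simp
      ultimately show ?thesis unfolding P2 using le by linarith
    qed
    have "m \<le> 64/81 * \<tau>" using \<tau> m by simp
    also have "\<dots> \<le> 64/81 * \<tau> ^ 3" using \<tau> by (simp add: self_le_power)
    also have "\<dots> = 64/81 * (\<tau> ^ 3 * (w powr (-2/3) * w powr (2/3)))" using w0 by (simp flip: powr_add)
    also have "\<dots> = \<tau> * (4/9 * w powr (-2/3)) * (\<tau> * (4/3 * w powr (1/3)))\<^sup>2"
      unfolding P2 by (simp add: power2_eq_square power3_eq_cube)
    finally show "m \<le> \<tau> * (4/9 * w powr (-2/3)) * (\<tau> * (4/3 * w powr (1/3)))\<^sup>2" .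
    have "m + 1 = (a powr (-1/3) * (m + 1)) * a powr (1/3)" using a by (simp add: mult.assoc mult.commute[of "m+1"] flip: powr_add)
    also have "\<dots> \<le> \<tau> * w powr (1/3)"
      using \<tau> a w by (intro mult_mono powr_mono2) auto
    finally have P1: "m + 1 \<le> \<tau> * w powr (1/3)" .
    define p where "p = \<tau> * (4/3 * w powr (1/3))"
    have p: "m + 1 \<le> p" using P1 m unfolding p_def by simp
    then have "p \<le> p ^ 4" using m by (intro self_le_power) auto
    then show "m \<le> 2 * (\<tau> * (4/3 * w powr (1/3))) ^ 4" using p m unfolding p_def[symmetric] by simp
  qed (use that in auto)
  moreover have "weight a (\<lambda>w. \<tau> * w powr (4/3)) (\<lambda>w. \<tau> * (4/3 * w powr (1/3))) (\<lambda>w. \<tau> * (4/9 * w powr (-2/3)))"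
    using \<tau> by (intro weight_four_thirds a) auto
  ultimately show ?thesis using \<tau> by (intro exI[of _ \<tau>]) auto
qed

lemma weight_linear:
  assumes \<tau>: "0 < \<tau>"
  shows "weight a (\<lambda>w. \<tau> * w) (\<lambda>w. \<tau> * 1) (\<lambda>w. \<tau> * 0)"
  unfolding weight_def
proof (intro conjI allI impI)
  show "filterlim (\<lambda>w. \<tau> * w) at_top at_top" using \<tau> by real_asymp
qed (use \<tau> in \<open>auto intro!: derivative_eq_intros\<close>)

lemma freq_sq_two_squares:
  assumes "CARD('d::finite) = 1 \<or> CARD('d) = 2"
  shows "\<exists>x y :: int. freq_sq (k :: int ^ 'd) = of_int (x\<^sup>2 + y\<^sup>2)"
  using assms
proof
  assume "CARD('d) = 1"
  then obtain j :: 'd where U: "UNIV = {j}" by (auto simp: card_1_singleton_iff)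
  have "freq_sq k = of_int ((k $ j)\<^sup>2 + 0\<^sup>2)" unfolding freq_sq_def U by simp
  then show ?thesis by blast
next
  assume "CARD('d) = 2"
  then obtain i j :: 'd where U: "UNIV = {i, j}" "i \<noteq> j" by (auto simp: card_2_iff)
  have "freq_sq k = of_int ((k $ i)\<^sup>2 + (k $ j)\<^sup>2)" unfolding freq_sq_def U(1) using U(2) by simp
  then show ?thesis by blast
qed

lemma symbol_bound_linear:
  fixes a m T :: real
  assumes d: "CARD('d::finite) = 1 \<or> CARD('d) = 2"
  shows "\<exists>\<tau>\<ge>T. 0 < \<tau> \<and> weight a (\<lambda>w. \<tau> * w) (\<lambda>w. \<tau> * 1) (\<lambda>w. \<tau> * 0) \<and>
    (\<forall>k::int^'d. \<forall>w\<ge>a. m \<le> (\<tau> * 1 + sqrt (freq_sq k))\<^sup>2 * (\<tau> * 1 - sqrt (freq_sq k))\<^sup>2 +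
       \<tau> * 0 * (\<tau> * 1 + sqrt (freq_sq k)) * (3 * (\<tau> * 1) - sqrt (freq_sq k)))"
proof -
  \<comment> \<open>Here Q = 0, and the symbol is (\<tau>^2 - \<mu>^2)^2, the square of a difference
    of two integers larger than M in absolute value. The summand 1 ensures M \<ge> 1, so that m
    \<le> M \<le> M^2.\<close>
  define M where "M = nat \<lceil>\<bar>m\<bar>\<rceil> + 1"
  have M: "m \<le> real M" "1 \<le> real M" unfolding M_def by linarith+
  obtain c where c: "nat \<lceil>T\<^sup>2\<rceil> + 1 \<le> c" "\<forall>x y :: int. int M < \<bar>x\<^sup>2 + y\<^sup>2 - int c\<bar>"
    using sum_two_squares_gap[where N = "nat \<lceil>T\<^sup>2\<rceil> + 1" and M = M] by blast
  define \<tau> where "\<tau> = sqrt (real c)"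
  have "T\<^sup>2 \<le> real c" using c(1) by linarith
  then have "T \<le> \<tau>" unfolding \<tau>_def by (rule real_le_rsqrt)
  have "0 < \<tau>" using c(1) by (simp add: \<tau>_def)
  have "m \<le> (\<tau> + sqrt (freq_sq k))\<^sup>2 * (\<tau> - sqrt (freq_sq k))\<^sup>2" for k :: "int^'d"
  proof -
    obtain x y :: int where xy: "freq_sq k = of_int (x\<^sup>2 + y\<^sup>2)" using freq_sq_two_squares[OF d] by blast
    have "of_int (int M) < \<bar>of_int (x\<^sup>2 + y\<^sup>2 - int c) :: real\<bar>"
      using c(2)[rule_format, of x y] by linarith
    then have gap: "real M \<le> \<bar>real c - freq_sq k\<bar>" by (simp add: xy)
    have "m \<le> real M" by fact
    also have "\<dots> \<le> (real M)\<^sup>2" using M by (intro self_le_power) auto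
    also have "\<dots> \<le> (real c - freq_sq k)\<^sup>2" using gap by (intro abs_le_square_iff[THEN iffD1]) simp
    also have "\<dots> = (\<tau> + sqrt (freq_sq k))\<^sup>2 * (\<tau> - sqrt (freq_sq k))\<^sup>2"
    proof -
      have "real c - freq_sq k = \<tau>\<^sup>2 - (sqrt (freq_sq k))\<^sup>2" by (simp add: \<tau>_def freq_sq_nonneg)
      also have "\<dots> = (\<tau> + sqrt (freq_sq k)) * (\<tau> - sqrt (freq_sq k))" by (simp add: power2_eq_square algebra_simps)
      finally show ?thesis by (simp only: power_mult_distrib)
    qed
    finally show ?thesis .
  qed
  then show ?thesis
    using \<open>T \<le> \<tau>\<close> \<open>0 < \<tau>\<close> weight_linear[OF \<open>0 < \<tau>\<close>] by (intro exI[of _ \<tau>]) auto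
qed

text \<open>The inequality |u| \<le> exp(w) |u|^2 + exp(-w) turns the weighted L2 bound into an L1
  bound, because the cell has finite volume. Integrability of f is what allows its modes to be
  integrated from infinity when X is solved for, including the mode \<mu> = 0.\<close>

lemma integrable_of_decay:
  fixes u f :: "real \<times> (real ^ 'd) \<Rightarrow> complex"
  assumes u: "cyl_sq u" and f: "cyl_sq f" and fu: "AE z in lborel. norm (f z) \<le> C * norm (u z)"
    and fin: "(\<integral>\<^sup>+w. indicator {0..} w * (ennreal (exp w) * slice_sq u w) \<partial>lborel) < \<infinity>"
  shows "integrable lborel f"
proof (rule integrableI_bounded)
  note [measurable] = cyl_sq_measurable[OF u] slice_sq_measurable[OF u]
  let ?V = "emeasure lborel (torus_cell :: (real^'d) set)"
  show "f \<in> borel_measurable lborel" using f by (simp add: cyl_sq_def)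
  define h where "h z = indicator {0..} (fst z) * (ennreal (exp (fst z)) * ennreal ((norm (u z))\<^sup>2)) +
     ennreal (exp (- fst z)) * indicator {0..} (fst z) * indicator torus_cell (snd z)" for z :: "real \<times> (real^'d)"
  have hm [measurable]: "h \<in> borel_measurable (lborel \<Otimes>\<^sub>M lborel)" unfolding h_def by measurable
  have "(\<integral>\<^sup>+z. ennreal (norm (f z)) \<partial>lborel) \<le> (\<integral>\<^sup>+z. ennreal \<bar>C\<bar> * h z \<partial>lborel)"
  proof (rule nn_integral_mono_AE, use fu in eventually_elim)
    case (elim z)
    show ?case
    proof (cases "z \<in> cyl_domain")
      case True
      then have z: "0 < fst z" "snd z \<in> torus_cell" by (auto simp: cyl_domain_def)
      have "norm (f z) \<le> \<bar>C\<bar> * norm (u z)" using elim by (meson abs_ge_self mult_right_mono norm_ge_zero order_trans)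
      moreover have "norm (u z) \<le> exp (fst z) * (norm (u z))\<^sup>2 + exp (- fst z)"
      proof -
        have "0 \<le> (exp (fst z / 2) * norm (u z) - exp (- fst z / 2))\<^sup>2" by simp
        also have "\<dots> = (exp (fst z / 2))\<^sup>2 * (norm (u z))\<^sup>2 + (exp (- fst z / 2))\<^sup>2 - 2 * (exp (fst z / 2) * exp (- fst z / 2)) * norm (u z)"
          by (simp add: power2_eq_square algebra_simps)
        also have "\<dots> = exp (fst z) * (norm (u z))\<^sup>2 + exp (- fst z) - 2 * norm (u z)"
          by (simp add: exp_double[symmetric] flip: exp_add)
        finally show ?thesis using norm_ge_zero[of "u z"] by linarith
      qed
      ultimately have "norm (f z) \<le> \<bar>C\<bar> * (exp (fst z) * (norm (u z))\<^sup>2 + exp (- fst z))"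
        by (meson abs_ge_zero mult_left_mono order_trans)
      then have "ennreal (norm (f z)) \<le> ennreal (\<bar>C\<bar> * (exp (fst z) * (norm (u z))\<^sup>2 + exp (- fst z)))" by (rule ennreal_leI)
      also have "\<dots> = ennreal \<bar>C\<bar> * h z" using z by (simp add: h_def ennreal_mult ennreal_plus)
      finally show ?thesis .
    next
      case False
      then have "f z = 0" using f unfolding cyl_sq_def by blast
      then show ?thesis by simp
    qed
  qed
  also have "\<dots> = ennreal \<bar>C\<bar> * (\<integral>\<^sup>+z. h z \<partial>(lborel \<Otimes>\<^sub>M lborel))"
    using hm by (subst nn_integral_cmult) (auto simp: lborel_prod)
  also have "(\<integral>\<^sup>+z. h z \<partial>(lborel \<Otimes>\<^sub>M lborel)) = (\<integral>\<^sup>+w. \<integral>\<^sup>+y. h (w, y) \<partial>lborel \<partial>lborel)"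
    by (rule lborel.nn_integral_fst[symmetric]) measurable
  also have "\<dots> = (\<integral>\<^sup>+w. indicator {0..} w * (ennreal (exp w) * slice_sq u w) + ennreal (exp (- w)) * indicator {0..} w * ?V \<partial>lborel)"
  proof (rule nn_integral_cong)
    fix w
    have "(\<integral>\<^sup>+y. h (w, y) \<partial>lborel) = (\<integral>\<^sup>+y. (indicator {0..} w * ennreal (exp w)) * ennreal ((norm (u (w, y)))\<^sup>2) \<partial>lborel) +
      (\<integral>\<^sup>+y. (ennreal (exp (- w)) * indicator {0..} w) * indicator torus_cell y \<partial>(lborel :: (real^'d) measure))"
      unfolding h_def fst_conv snd_conv mult.assoc by (rule nn_integral_add) measurable
    also have "\<dots> = indicator {0..} w * (ennreal (exp w) * slice_sq u w) + ennreal (exp (- w)) * indicator {0..} w * ?V"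
      unfolding slice_sq_def by (simp add: nn_integral_cmult nn_integral_cmult_indicator mult.assoc)
    finally show "(\<integral>\<^sup>+y. h (w, y) \<partial>lborel) = indicator {0..} w * (ennreal (exp w) * slice_sq u w) + ennreal (exp (- w)) * indicator {0..} w * ?V" .
  qed
  also have "\<dots> = (\<integral>\<^sup>+w. indicator {0..} w * (ennreal (exp w) * slice_sq u w) \<partial>lborel) + (\<integral>\<^sup>+w. ennreal (exp (- w)) * indicator {0..} w \<partial>lborel) * ?V"
    by (subst nn_integral_add) (auto simp: nn_integral_multc)
  also have "(\<integral>\<^sup>+w. ennreal (exp (- w)) * indicator {0..} w \<partial>lborel) = ennreal (0 - (- exp (- 0)))"
  proof (rule nn_integral_FTC_atLeast[where F="\<lambda>w. - exp (- w)"])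
    show "((\<lambda>w::real. - exp (- w)) \<longlongrightarrow> 0) at_top" by real_asymp
  qed (auto intro!: derivative_eq_intros)
  finally show "(\<integral>\<^sup>+z. ennreal (norm (f z)) \<partial>lborel) < \<infinity>"
    using fin emeasure_torus_cell_finite[where 'd='d] by (auto simp: ennreal_mult_less_top elim!: le_less_trans)
qed

section \<open>Reduction of the Sobolev problem to weak mode equations\<close>

lemma iter_partial_test_product:
  fixes D :: "nat \<Rightarrow> real \<Rightarrow> real" and k :: "int ^ 'd"
  assumes D: "smooth_seq D"
  defines "\<phi> \<equiv> \<lambda>c n z. c * tensor_test D n k z"
  shows "(\<phi> c n has_derivative (\<lambda>h. c * (of_real (D (Suc n) (fst z) * fst h) * fexp k (snd z)) +
       c * (of_real (D n (fst z)) * (\<i> * of_real (\<Sum>j\<in>UNIV. of_int (k $ j) * snd h $ j) * fexp k (snd z))))) (at z)" (is ?D)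
    and "frechet_derivative (\<phi> c n) (at z) dir_w = \<phi> c (Suc n) z"
    and "frechet_derivative (\<phi> c n) (at z) (dir_y j) = \<phi> (c * (\<i> * of_int (k $ j))) n z"
proof -
  have d1: "((\<lambda>z. complex_of_real (D n (fst z))) has_derivative (\<lambda>h. of_real (D (Suc n) (fst z) * fst h))) (at z)"
  proof -
    have "(D n has_derivative (*) (D (Suc n) (fst z))) (at (fst z))"
      using D unfolding smooth_seq_def has_field_derivative_def by blast
    from has_derivative_compose[OF has_derivative_fst[OF has_derivative_ident] this]
    have "((\<lambda>z::real \<times> (real^'d). D n (fst z)) has_derivative (\<lambda>h. D (Suc n) (fst z) * fst h)) (at z)" by simp
    then show ?thesis by (rule has_derivative_of_real)
  qed
  have d2: "((\<lambda>z. fexp k (snd z)) has_derivative (\<lambda>h. \<i> * of_real (\<Sum>j\<in>UNIV. of_int (k $ j) * snd h $ j) * fexp k (snd z))) (at z)"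
  proof -
    have s: "((\<lambda>z::real \<times> (real^'d). \<Sum>j\<in>UNIV. of_int (k $ j) * snd z $ j) has_derivative (\<lambda>h. \<Sum>j\<in>UNIV. of_int (k $ j) * snd h $ j)) (at z)"
      by (intro has_derivative_sum has_derivative_mult_right bounded_linear.has_derivative[OF bounded_linear_vec_nth] has_derivative_snd has_derivative_ident)
    have e: "((\<lambda>t. cis t) has_derivative (\<lambda>h. of_real h * (\<i> * cis t))) (at t)" for t
    proof -
      have "((\<lambda>z. exp (\<i> * z)) has_field_derivative (\<i> * exp (\<i> * of_real t))) (at (of_real t))"
        by (auto intro!: derivative_eq_intros)
      from has_vector_derivative_real_field[OF this] show ?thesis
        by (simp add: cis_conv_exp has_vector_derivative_def scaleR_conv_of_real)
    qed
    from has_derivative_compose[OF s e] show ?thesis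
      unfolding fexp_def by (simp add: mult_ac)
  qed
  show D: ?D
    unfolding \<phi>_def
    by (rule has_derivative_eq_rhs[OF has_derivative_mult_right[OF has_derivative_mult[OF d1 d2]]])
       (simp add: fun_eq_iff algebra_simps)
  note fd = frechet_derivative_at[OF D, symmetric]
  show "frechet_derivative (\<phi> c n) (at z) dir_w = \<phi> c (Suc n) z"
    unfolding fd by (simp add: dir_w_def \<phi>_def)
  have "(\<Sum>i\<in>UNIV. of_int (k $ i) * (axis j (1::real)) $ i) = of_int (k $ j)"
    by (simp add: axis_def if_distrib[of "(*) _"] cong: if_cong)
  then show "frechet_derivative (\<phi> c n) (at z) (dir_y j) = \<phi> (c * (\<i> * of_int (k $ j))) n z"
    unfolding fd by (simp add: dir_y_def \<phi>_def)
qed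

lemma Basis_half_cylinder:
  assumes "b \<in> (Basis :: (real \<times> (real ^ 'd)) set)"
  shows "b = dir_w \<or> (\<exists>j. b = dir_y j)"
  using assms by (auto simp: Basis_prod_def Basis_vec_def dir_w_def dir_y_def)

text \<open>The scalar and the order n are kept variable so that the induction over the list closes:
  a derivative in w raises n, a derivative in y_j multiplies the scalar by i k_j. Smoothness of all
  tensor test functions follows.\<close>

lemma iter_partial_test_product_form:
  fixes D :: "nat \<Rightarrow> real \<Rightarrow> real" and k :: "int ^ 'd"
  assumes D: "smooth_seq D" and bs: "set bs \<subseteq> Basis"
  shows "\<exists>c' n'. iter_partial bs (\<lambda>z. c * tensor_test D n k z) = (\<lambda>z. c' * tensor_test D n' k z)"
  using bs
proof (induction bs arbitrary: c n)
  case (Cons b bs)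
  have "b = dir_w \<or> (\<exists>j. b = dir_y j)" using Cons.prems by (intro Basis_half_cylinder) auto
  then have "\<exists>c1 n1. (\<lambda>z. frechet_derivative (\<lambda>z. c * tensor_test D n k z) (at z) b) = (\<lambda>z. c1 * tensor_test D n1 k z)"
  proof (elim disjE exE)
    assume "b = dir_w"
    then show ?thesis
      using iter_partial_test_product(2)[OF D, of c n k] by (intro exI[of _ c] exI[of _ "Suc n"]) auto
  next
    fix j assume "b = dir_y j"
    then show ?thesis
      using iter_partial_test_product(3)[OF D, of c n k _ j] by (intro exI[of _ "c * (\<i> * of_int (k $ j))"] exI[of _ n]) auto
  qed
  then obtain c1 n1 where e: "(\<lambda>z. frechet_derivative (\<lambda>z. c * tensor_test D n k z) (at z) b) = (\<lambda>z. c1 * tensor_test D n1 k z)"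
    by blast
  show ?case unfolding iter_partial.simps e using Cons.prems by (intro Cons.IH) simp
qed auto

lemma fexp_periodic: "fexp k (y + axis j (2 * pi)) = fexp k y"
proof -
  have "(\<Sum>i\<in>UNIV. of_int (k $ i) * (axis j (2 * pi)) $ i) = of_int (k $ j) * (2 * pi)"
    by (simp add: axis_def if_distrib[of "(*) _"] cong: if_cong)
  then have "fexp k (axis j (2 * pi)) = 1"
    using cis_multiple_2pi[of "of_int (k $ j)"] by (simp add: fexp_def mult.commute)
  then show ?thesis
    by (simp add: fexp_def sum.distrib distrib_left flip: cis_mult)
qed

lemma test_function_product:
  fixes k :: "int ^ 'd"
  assumes D: "test_seq 0 D"
  shows "test_function (\<lambda>z. tensor_test D n k z)"
  unfolding test_function_def
proof (intro conjI)
  show "cyl_function (\<lambda>z. tensor_test D n k z)"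
    by (simp add: cyl_function_def fexp_periodic)
  show "smooth_on half_space (\<lambda>z. tensor_test D n k z)"
    unfolding smooth_on_def
  proof (intro allI impI)
    fix bs :: "(real \<times> (real ^ 'd)) list" assume bs: "set bs \<subseteq> Basis"
    obtain c' n' where e: "iter_partial bs (\<lambda>z. 1 * tensor_test D n k z) = (\<lambda>z. c' * tensor_test D n' k z)"
      using iter_partial_test_product_form[OF test_seq_smooth[OF D] bs] by blast
    show "iter_partial bs (\<lambda>z. tensor_test D n k z) differentiable_on half_space"
      using e iter_partial_test_product(1)[OF test_seq_smooth[OF D], of c' n' k]
      unfolding differentiable_on_def differentiable_def by (auto intro: has_derivative_at_withinI)
  qed
  obtain a b where "0 < a" "\<And>n x. D n x \<noteq> 0 \<Longrightarrow> a \<le> x \<and> x \<le> b"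
    using D unfolding test_seq_def by blast
  then show "\<exists>a b. 0 < a \<and> (\<forall>w>0. \<forall>y. of_real (D n (fst (w, y))) * fexp k (snd (w, y)) \<noteq> 0 \<longrightarrow> a \<le> w \<and> w \<le> b)"
    by (intro exI[of _ a] exI[of _ b]) auto
qed

lemma frechet_derivative_test_product_w:
  assumes "smooth_seq D"
  shows "frechet_derivative (\<lambda>z. tensor_test D n k z) (at z) dir_w = tensor_test D (Suc n) k z"
  using iter_partial_test_product(2)[OF assms, of 1 n k z] by (simp only: mult_1_left)

lemma iter_partial_w:
  assumes "smooth_seq D"
  shows "iter_partial [dir_w] (\<lambda>z. tensor_test D n k z) = (\<lambda>z. tensor_test D (Suc n) k z)"
  by (simp only: iter_partial.simps frechet_derivative_test_product_w[OF assms])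

lemma iter_partial_ww:
  assumes "smooth_seq D"
  shows "iter_partial [dir_w, dir_w] (\<lambda>z. tensor_test D n k z) = (\<lambda>z. tensor_test D (Suc (Suc n)) k z)"
  by (simp only: iter_partial.simps frechet_derivative_test_product_w[OF assms])

lemma iter_partial_yy:
  assumes "smooth_seq D"
  shows "iter_partial [dir_y j, dir_y j] (\<lambda>z. tensor_test D n k z) =
    (\<lambda>z. - of_real ((of_int (k $ j))\<^sup>2) * tensor_test D n k z)"
proof -
  have "iter_partial [dir_y j, dir_y j] (\<lambda>z. 1 * tensor_test D n k z) =
    (\<lambda>z. 1 * (\<i> * of_int (k $ j)) * (\<i> * of_int (k $ j)) * tensor_test D n k z)"
    by (simp only: iter_partial.simps iter_partial_test_product(3)[OF assms])
  moreover have "1 * (\<i> * of_int (k $ j)) * (\<i> * of_int (k $ j)) = - complex_of_real ((of_int (k $ j))\<^sup>2)"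
    by (simp add: complex_eq_iff power2_eq_square)
  ultimately show ?thesis by (simp only: mult_1_left)
qed

section \<open>Borel representatives and the weak equations tested on tensor products\<close>

lemma cyl_domain_borel [measurable]: "cyl_domain \<in> sets (borel :: (real \<times> (real ^ 'd)) measure)"
proof -
  have "{0::real<..} \<times> torus_cell \<in> sets (borel \<Otimes>\<^sub>M (borel :: (real^'d) measure))"
    by (intro pair_measureI torus_cell_borel) auto
  then show ?thesis unfolding cyl_domain_def borel_prod .
qed

text \<open>\<open>v0\<close> is a Borel function on the whole space representing \<open>v\<close> on the fundamental domain.\<close>

definition borel_rep :: "(real \<times> (real ^ 'd) \<Rightarrow> complex) \<Rightarrow> (real \<times> (real ^ 'd) \<Rightarrow> complex) \<Rightarrow> bool" where
  "borel_rep v v0 \<longleftrightarrow> v \<in> borel_measurable (lebesgue_on cyl_domain) \<and> v0 \<in> borel_measurable borel \<and>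
     (\<forall>z. z \<notin> cyl_domain \<longrightarrow> v0 z = 0) \<and> (AE z in lborel. z \<in> cyl_domain \<longrightarrow> v z = v0 z)"

text \<open>A function measurable for the completed measure agrees almost everywhere with a Borel
  function; the real and imaginary parts are replaced separately. Borel representatives are what
  Fubini with \<open>lborel\<close> can process.\<close>

lemma borel_rep_exists:
  fixes v :: "real \<times> (real ^ 'd) \<Rightarrow> complex"
  assumes v: "v \<in> borel_measurable (lebesgue_on cyl_domain)"
  obtains v0 where "borel_rep v v0"
proof -
  have vm: "(\<lambda>z. indicator cyl_domain z *\<^sub>R v z) \<in> borel_measurable lebesgue"
    using v by (subst (asm) borel_measurable_restrict_space_iff) auto
  have R: "Re \<in> borel_measurable borel" "Im \<in> borel_measurable borel" by measurable
  obtain g1 where g1: "g1 \<in> borel_measurable lborel" "AE z in lborel. Re (indicator cyl_domain z *\<^sub>R v z) = g1 z"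
    using completion_ex_borel_measurable_real[OF measurable_compose[OF vm R(1)]] by blast
  obtain g2 where g2: "g2 \<in> borel_measurable lborel" "AE z in lborel. Im (indicator cyl_domain z *\<^sub>R v z) = g2 z"
    using completion_ex_borel_measurable_real[OF measurable_compose[OF vm R(2)]] by blast
  define g where "g z = Complex (g1 z) (g2 z)" for z
  have [measurable]: "g1 \<in> borel_measurable borel" "g2 \<in> borel_measurable borel" using g1 g2 by auto
  have "(\<lambda>z. of_real (g1 z) + \<i> * of_real (g2 z)) \<in> borel_measurable borel" by measurable
  then have gm: "g \<in> borel_measurable lborel" by (simp add: g_def[abs_def] Complex_eq)
  have g: "AE z in lborel. indicator cyl_domain z *\<^sub>R v z = g z"
    using g1(2) g2(2) by eventually_elim (simp add: g_def complex_eq_iff)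
  have "borel_rep v (\<lambda>z. indicator cyl_domain z *\<^sub>R g z)"
    unfolding borel_rep_def
  proof (intro conjI allI impI)
    show "AE z in lborel. z \<in> cyl_domain \<longrightarrow> v z = indicator cyl_domain z *\<^sub>R g z"
      using g by eventually_elim auto
  qed (use v gm in auto)
  then show ?thesis by (rule that)
qed

lemma borel_rep_integral:
  fixes v :: "real \<times> (real ^ 'd) \<Rightarrow> complex" and h :: "real \<times> (real ^ 'd) \<Rightarrow> complex"
  assumes v: "borel_rep v v0" and h: "h \<in> borel_measurable borel"
  shows "integral\<^sup>L (lebesgue_on cyl_domain) (\<lambda>z. v z * h z) = (LINT z|lborel. v0 z * h z)"
proof -
  have [measurable]: "v0 \<in> borel_measurable borel" "h \<in> borel_measurable borel" using v h by (auto simp: borel_rep_def)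
  have m: "(\<lambda>z. indicator cyl_domain z *\<^sub>R v z) \<in> borel_measurable lebesgue"
    using v by (subst borel_measurable_restrict_space_iff[symmetric]) (auto simp: borel_rep_def)
  have hl: "h \<in> borel_measurable lebesgue" using h by (intro measurable_completion) simp
  have ae: "AE z in lebesgue. z \<in> cyl_domain \<longrightarrow> v z = v0 z"
    using v unfolding borel_rep_def by (intro AE_completion) auto
  have "integral\<^sup>L (lebesgue_on cyl_domain) (\<lambda>z. v z * h z) = (LINT z|lebesgue. indicator cyl_domain z *\<^sub>R (v z * h z))"
    by (rule integral_restrict_space) auto
  also have "\<dots> = (LINT z|lebesgue. v0 z * h z)"
  proof (rule integral_cong_AE)
    show "(\<lambda>z. indicator cyl_domain z *\<^sub>R (v z * h z)) \<in> borel_measurable lebesgue"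
      using borel_measurable_times[OF m hl] by simp
    show "(\<lambda>z. v0 z * h z) \<in> borel_measurable lebesgue"
      by (intro measurable_completion) measurable
    show "AE z in lebesgue. indicator cyl_domain z *\<^sub>R (v z * h z) = v0 z * h z"
      using ae by eventually_elim (use v in \<open>auto simp: borel_rep_def indicator_def\<close>)
  qed
  also have "\<dots> = (LINT z|lborel. v0 z * h z)"
    by (rule integral_completion) measurable
  finally show ?thesis .
qed

lemma borel_rep_integrable_norm_sq:
  assumes v: "borel_rep v v0" and S: "S \<in> sets borel" "S \<subseteq> cyl_domain"
  shows "integrable (lebesgue_on S) (\<lambda>z. (norm (v z))\<^sup>2) \<Longrightarrow> integrable lborel (\<lambda>z. indicator S z *\<^sub>R (norm (v0 z))\<^sup>2)"
    and "integrable (lebesgue_on S) v \<Longrightarrow> integrable lborel (\<lambda>z. indicator S z *\<^sub>R v0 z)"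
proof -
  have [measurable]: "v0 \<in> borel_measurable borel" using v by (auto simp: borel_rep_def)
  note [measurable] = S(1)
  have ae: "AE z in lebesgue. z \<in> cyl_domain \<longrightarrow> v z = v0 z"
    using v unfolding borel_rep_def by (intro AE_completion) auto
  {
    assume "integrable (lebesgue_on S) (\<lambda>z. (norm (v z))\<^sup>2)"
    then have "integrable lebesgue (\<lambda>z. indicator S z *\<^sub>R (norm (v z))\<^sup>2)"
      using S by (subst (asm) integrable_restrict_space) auto
    then have "integrable lebesgue (\<lambda>z. indicator S z *\<^sub>R (norm (v0 z))\<^sup>2)"
    proof (rule integrable_cong_AE_imp)
      show "AE z in lebesgue. indicator S z *\<^sub>R (norm (v z))\<^sup>2 = indicator S z *\<^sub>R (norm (v0 z))\<^sup>2"
        using ae by eventually_elim (use S(2) in \<open>auto simp: indicator_def\<close>)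
    qed (intro measurable_completion, measurable)
    then show "integrable lborel (\<lambda>z. indicator S z *\<^sub>R (norm (v0 z))\<^sup>2)"
      by (subst (asm) integrable_completion) auto
  next
    assume "integrable (lebesgue_on S) v"
    then have "integrable lebesgue (\<lambda>z. indicator S z *\<^sub>R v z)"
      using S by (subst (asm) integrable_restrict_space) auto
    then have "integrable lebesgue (\<lambda>z. indicator S z *\<^sub>R v0 z)"
    proof (rule integrable_cong_AE_imp)
      show "AE z in lebesgue. indicator S z *\<^sub>R v z = indicator S z *\<^sub>R v0 z"
        using ae by eventually_elim (use S(2) in \<open>auto simp: indicator_def\<close>)
    qed (intro measurable_completion, measurable)
    then show "integrable lborel (\<lambda>z. indicator S z *\<^sub>R v0 z)"
      by (subst (asm) integrable_completion) auto
  }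
qed

lemma borel_rep_cyl_sq:
  assumes v: "borel_rep v v0" and L2: "cyl_L2 v"
  shows "cyl_sq v0"
proof -
  have "integrable lborel (\<lambda>z. indicator cyl_domain z *\<^sub>R (norm (v0 z))\<^sup>2)"
    using L2 by (intro borel_rep_integrable_norm_sq(1)[OF v]) (auto simp: cyl_L2_def)
  also have "(\<lambda>z. indicator cyl_domain z *\<^sub>R (norm (v0 z))\<^sup>2) = (\<lambda>z. (norm (v0 z))\<^sup>2)"
    using v by (auto simp: fun_eq_iff borel_rep_def indicator_def)
  finally show ?thesis using v by (simp add: cyl_sq_def borel_rep_def)
qed

text \<open>Serves \<open>weak_deriv\<close>, a chosen representative of which local integrability
  is all that is known. Exhausting the domain by the sets \<open>S n\<close>, which stay away from w
  = 0, makes it a pointwise limit of measurable functions.\<close>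

lemma cyl_loc_integrable_measurable:
  fixes v :: "real \<times> (real ^ 'd) \<Rightarrow> complex"
  assumes v: "cyl_loc_integrable v"
  shows "v \<in> borel_measurable (lebesgue_on cyl_domain)"
proof -
  define S where "S n = {1 / real (Suc n)..real (Suc n)} \<times> (torus_cell :: (real^'d) set)" for n
  have S: "S n \<in> sets borel" for n
  proof -
    have "{1 / real (Suc n)..real (Suc n)} \<times> torus_cell \<in> sets (borel \<Otimes>\<^sub>M (borel :: (real^'d) measure))"
      by (intro pair_measureI torus_cell_borel) auto
    then show ?thesis unfolding S_def borel_prod .
  qed
  have m: "(\<lambda>z. indicator (S n) z *\<^sub>R v z) \<in> borel_measurable lebesgue" for n
  proof -
    have "v \<in> borel_measurable (lebesgue_on (S n))"
      using v unfolding cyl_loc_integrable_def S_def by (intro borel_measurable_integrable) auto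
    then show ?thesis using S[of n] by (subst (asm) borel_measurable_restrict_space_iff) auto
  qed
  have "(\<lambda>z. indicator cyl_domain z *\<^sub>R v z) \<in> borel_measurable lebesgue"
  proof (rule borel_measurable_LIMSEQ_metric[OF m])
    fix z :: "real \<times> (real^'d)"
    show "(\<lambda>n. indicator (S n) z *\<^sub>R v z) \<longlonglongrightarrow> indicator cyl_domain z *\<^sub>R v z"
    proof (cases "z \<in> cyl_domain")
      case True
      then have z: "0 < fst z" "snd z \<in> torus_cell" by (auto simp: cyl_domain_def)
      obtain N where N: "max (fst z) (1 / fst z) < real N" using reals_Archimedean2 by blast
      have "z \<in> S n" if "N \<le> n" for n
      proof -
        have "fst z \<le> real (Suc n)" "1 / fst z \<le> real (Suc n)" using N that by auto
        then show ?thesis using z by (cases z) (auto simp: S_def field_simps)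
      qed
      then have "eventually (\<lambda>n. indicator (S n) z *\<^sub>R v z = indicator cyl_domain z *\<^sub>R v z) sequentially"
        unfolding eventually_sequentially using True by (intro exI[of _ N]) auto
      then show ?thesis by (rule tendsto_eventually)
    next
      case False
      have "S n \<subseteq> cyl_domain" for n
        unfolding S_def cyl_domain_def by (auto intro: less_le_trans[rotated])
      then have "z \<notin> S n" for n using False by blast
      then show ?thesis using False by simp
    qed
  qed
  then show ?thesis by (subst borel_measurable_restrict_space_iff) auto
qed

lemma borel_measurable_tensor_test:
  fixes k :: "int ^ 'd"
  assumes D: "test_seq c D"
  shows "(\<lambda>z. tensor_test D n k z) \<in> borel_measurable borel"
proof -
  note [measurable] = smooth_seq_measurable[OF test_seq_smooth[OF D]]
  have "(\<lambda>z. tensor_test D n k z) \<in> borel_measurable (borel \<Otimes>\<^sub>M borel)"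
    by measurable
  then show ?thesis unfolding borel_prod .
qed

lemma borel_rep_test_integrable:
  fixes v :: "real \<times> (real ^ 'd) \<Rightarrow> complex" and k :: "int ^ 'd"
  assumes v: "borel_rep v v0" and loc: "cyl_loc_integrable v" and D: "test_seq 0 D"
  shows "integrable lborel (\<lambda>z. v0 z * tensor_test D n k z)"
proof -
  have m: "(\<lambda>z. tensor_test D n k z) \<in> borel_measurable borel"
    by (rule borel_measurable_tensor_test[OF D])
  have [measurable]: "v0 \<in> borel_measurable borel" using v by (simp add: borel_rep_def)
  obtain a b where ab: "0 < a" "\<And>n x. D n x \<noteq> 0 \<Longrightarrow> a \<le> x \<and> x \<le> b" using D unfolding test_seq_def by blast
  obtain B where B: "\<And>x. \<bar>D n x\<bar> \<le> B" using test_seq_bounded[OF D] by blast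
  have B0: "0 \<le> B" using B[of 0] by simp
  define S where "S = {a..b} \<times> (torus_cell :: (real^'d) set)"
  have "{a..b} \<times> torus_cell \<in> sets (borel \<Otimes>\<^sub>M (borel :: (real^'d) measure))"
    by (intro pair_measureI torus_cell_borel) auto
  then have S: "S \<in> sets borel" unfolding S_def borel_prod .
  have Sc: "S \<subseteq> cyl_domain" using ab(1) by (auto simp: S_def cyl_domain_def)
  have "integrable (lebesgue_on S) v" using loc ab(1) by (simp add: cyl_loc_integrable_def S_def)
  then have "integrable lborel (\<lambda>z. indicator S z *\<^sub>R v0 z)" by (rule borel_rep_integrable_norm_sq(2)[OF v S Sc])
  then have "integrable lborel (\<lambda>z. B *\<^sub>R (indicator S z *\<^sub>R v0 z))" by (rule integrable_scaleR_right)
  then show ?thesis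
  proof (rule Bochner_Integration.integrable_bound)
    show "(\<lambda>z. v0 z * tensor_test D n k z) \<in> borel_measurable lborel"
      using m by simp
    show "AE z in lborel. norm (v0 z * tensor_test D n k z) \<le> norm (B *\<^sub>R (indicator S z *\<^sub>R v0 z))"
    proof (rule AE_I2)
      fix z
      show "norm (v0 z * tensor_test D n k z) \<le> norm (B *\<^sub>R (indicator S z *\<^sub>R v0 z))"
      proof (cases "z \<in> S")
        case True
        have "norm (v0 z) * \<bar>D n (fst z)\<bar> \<le> norm (v0 z) * B" by (intro mult_left_mono B) simp
        then show ?thesis using True B0 by (simp add: norm_mult mult.commute)
      next
        case False
        then have "D n (fst z) = 0 \<or> v0 z = 0"
          using ab(2)[of n "fst z"] v by (cases z) (auto simp: S_def borel_rep_def cyl_domain_def)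
        then show ?thesis by auto
      qed
    qed
  qed
qed

lemma weak_deriv_test:
  fixes u v :: "real \<times> (real ^ 'd) \<Rightarrow> complex" and k :: "int ^ 'd"
  assumes wd: "has_weak_deriv bs u v" and u: "borel_rep u u0" and v: "borel_rep v v0" and D: "test_seq 0 D"
    and it: "iter_partial bs (\<lambda>z. tensor_test D 0 k z) = (\<lambda>z. c * tensor_test D n k z)"
  shows "c * (LINT z|lborel. u0 z * tensor_test D n k z) =
    (-1) ^ length bs * (LINT z|lborel. v0 z * tensor_test D 0 k z)"
proof -
  have m: "(\<lambda>z. tensor_test D n k z) \<in> borel_measurable borel" for n
    by (rule borel_measurable_tensor_test[OF D])
  have "integral\<^sup>L (lebesgue_on cyl_domain) (\<lambda>z. u z * iter_partial bs (\<lambda>z. tensor_test D 0 k z) z) =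
      (-1) ^ length bs * integral\<^sup>L (lebesgue_on cyl_domain) (\<lambda>z. v z * tensor_test D 0 k z)"
    using wd test_function_product[OF D, of 0 k] unfolding has_weak_deriv_def by blast
  also have "integral\<^sup>L (lebesgue_on cyl_domain) (\<lambda>z. v z * tensor_test D 0 k z) = (LINT z|lborel. v0 z * tensor_test D 0 k z)"
    by (rule borel_rep_integral[OF v m])
  also have "integral\<^sup>L (lebesgue_on cyl_domain) (\<lambda>z. u z * iter_partial bs (\<lambda>z. tensor_test D 0 k z) z) =
     (LINT z|lborel. u0 z * (c * tensor_test D n k z))"
    unfolding it by (rule borel_rep_integral[OF u]) (intro borel_measurable_times borel_measurable_const m)
  also have "\<dots> = (LINT z|lborel. c * (u0 z * tensor_test D n k z))"
    by (simp only: mult.left_commute)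
  also have "\<dots> = c * (LINT z|lborel. u0 z * tensor_test D n k z)"
    by (rule integral_mult_right_zero)
  finally show ?thesis .
qed

section \<open>Periodicity: from the fundamental cell to the half-space\<close>

lemma cyl_function_shift:
  fixes u :: "real \<times> (real ^ 'd) \<Rightarrow> complex"
  assumes u: "cyl_function u" and w: "0 < w"
  shows "u (w, y + (\<chi> j. 2 * pi * of_int (k $ j))) = u (w, y)"
proof -
  have nat: "u (w, y + axis j (2 * pi * of_nat n)) = u (w, y)" for y j and n :: nat
  proof (induction n)
    case (Suc n)
    have "y + axis j (2 * pi * of_nat (Suc n)) = (y + axis j (2 * pi * of_nat n)) + axis j (2 * pi)"
      by (auto simp: vec_eq_iff axis_def algebra_simps)
    then show ?case using u w Suc unfolding cyl_function_def by metis
  qed (simp add: axis_def zero_vec_def[symmetric])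
  have int: "u (w, y + axis j (2 * pi * of_int n)) = u (w, y)" for y j and n :: int
  proof (cases "0 \<le> n")
    case True
    then show ?thesis using nat[of y j "nat n"] by simp
  next
    case False
    have "y = (y + axis j (2 * pi * of_int n)) + axis j (2 * pi * of_nat (nat (- n)))"
      using False by (auto simp: vec_eq_iff axis_def algebra_simps)
    then show ?thesis using nat[of "y + axis j (2 * pi * of_int n)" j "nat (- n)"] by metis
  qed
  have "u (w, y + (\<Sum>j\<in>J. axis j (2 * pi * of_int (k $ j)))) = u (w, y)" if "finite J" for J
    using that
  proof (induction J)
    case (insert j J)
    have eq: "y + (\<Sum>j\<in>insert j J. axis j (2 * pi * of_int (k $ j))) = (y + (\<Sum>j\<in>J. axis j (2 * pi * of_int (k $ j)))) + axis j (2 * pi * of_int (k $ j))"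
      using insert by (simp add: algebra_simps)
    show ?case unfolding eq int by (rule insert.IH)
  qed simp
  from this[of UNIV] have "u (w, y + (\<Sum>j\<in>UNIV. axis j (2 * pi * of_int (k $ j)))) = u (w, y)" by simp
  moreover have "(\<Sum>j\<in>UNIV. axis j (2 * pi * of_int (k $ j))) = (\<chi> j. 2 * pi * of_int (k $ j))"
    by (auto simp: vec_eq_iff axis_def if_distrib cong: if_cong)
  ultimately show ?thesis by simp
qed

lemma torus_cell_reduction: "\<exists>k. y - (\<chi> j. 2 * pi * of_int (k $ j)) \<in> torus_cell" for y :: "real ^ 'd"
proof -
  define k :: "int^'d" where "k = (\<chi> j. \<lfloor>y $ j / (2 * pi)\<rfloor>)"
  have "0 \<le> y $ j - 2 * pi * of_int (k $ j) \<and> y $ j - 2 * pi * of_int (k $ j) < 2 * pi" for j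
  proof -
    have "of_int (k $ j) \<le> y $ j / (2 * pi)" "y $ j / (2 * pi) < of_int (k $ j) + 1"
      unfolding k_def by (simp_all add: floor_correct)
    then show ?thesis by (simp add: field_simps)
  qed
  then show ?thesis by (intro exI[of _ k]) (simp add: torus_cell_def)
qed

text \<open>Every point of the half-space is a lattice translate of a point of the cell, so by
  periodicity the set where u is nonzero lies in the union of countably many translates of one null
  set.\<close>

lemma AE_half_space_of_cell:
  fixes u u0 :: "real \<times> (real ^ 'd) \<Rightarrow> complex"
  assumes u: "cyl_function u" and rep: "borel_rep u u0" and 0: "AE z in lborel. u0 z = 0"
  shows "AE z in lebesgue_on half_space. u z = 0"
proof -
  have "AE z in lborel. z \<in> cyl_domain \<longrightarrow> u z = 0"
    using 0 rep[unfolded borel_rep_def, THEN conjunct2, THEN conjunct2, THEN conjunct2] by eventually_elim auto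
  then have ae: "AE z in lebesgue. z \<in> cyl_domain \<longrightarrow> u z = 0" by (rule AE_completion)
  define N where "N = {z. \<not> (z \<in> cyl_domain \<longrightarrow> u z = 0)}"
  have N: "N \<in> null_sets lebesgue"
    using ae unfolding N_def by (simp add: AE_iff_null_sets completion.AE_iff_null_sets AE_completion_iff)
  have neg: "negligible N" using N by (simp add: negligible_iff_null_sets)
  define M where "M = (\<Union>k::int^'d. (+) (0, \<chi> j. 2 * pi * of_int (k $ j)) ` N)"
  have "negligible M"
    unfolding M_def by (intro negligible_countable_Union) (auto intro: negligible_translation neg)
  then have M: "M \<in> null_sets lebesgue" by (simp add: negligible_iff_null_sets)
  have sub: "z \<in> M" if z: "z \<in> half_space" "u z \<noteq> 0" for z
  proof -
    obtain w y where zw: "z = (w, y)" by (cases z)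
    have w: "0 < w" using z zw by (simp add: half_space_def)
    obtain k :: "int^'d" where k: "y - (\<chi> j. 2 * pi * of_int (k $ j)) \<in> torus_cell" (is "y - ?s \<in> _") using torus_cell_reduction by blast
    have "u (w, (y - ?s) + ?s) = u (w, y - ?s)" by (rule cyl_function_shift[OF u w])
    then have "u (w, y - ?s) \<noteq> 0" using z zw by simp
    then have "(w, y - ?s) \<in> N" using k w by (simp add: N_def cyl_domain_def)
    then have "(0, ?s) + (w, y - ?s) \<in> M" unfolding M_def by blast
    then show ?thesis using zw by simp
  qed
  have hs: "half_space \<in> sets (lebesgue :: (real \<times> (real^'d)) measure)"
    unfolding half_space_def by (intro lmeasurable_open open_Times | simp add: open_Times borel_open)+
  have "AE z in lebesgue. z \<in> half_space \<longrightarrow> u z = 0"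
    using M sub by (intro AE_I'[of M]) auto
  then show ?thesis using hs by (subst AE_restrict_space_iff) auto
qed

lemma dir_in_Basis: "dir_w \<in> Basis" "dir_y j \<in> Basis"
  by (auto simp: dir_w_def dir_y_def Basis_prod_def Basis_vec_def)

lemma cyl_sq_add:
  assumes f: "cyl_sq f" and g: "cyl_sq g" shows "cyl_sq (\<lambda>z. f z + g z)"
proof -
  have [measurable]: "f \<in> borel_measurable borel" "g \<in> borel_measurable borel" using f g by (auto simp: cyl_sq_def)
  have "integrable lborel (\<lambda>z. (norm (f z + g z))\<^sup>2)"
  proof (rule Bochner_Integration.integrable_bound)
    show "integrable lborel (\<lambda>z. 2 * (norm (f z))\<^sup>2 + 2 * (norm (g z))\<^sup>2)" using f g by (simp add: cyl_sq_def)
    show "AE z in lborel. norm ((norm (f z + g z))\<^sup>2) \<le> norm (2 * (norm (f z))\<^sup>2 + 2 * (norm (g z))\<^sup>2)"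
      using norm_add_sq_le[of "f _" "g _"] by (intro AE_I2) auto
  qed measurable
  then show ?thesis using f g unfolding cyl_sq_def by (auto intro: borel_measurable_add)
qed

lemma cyl_sq_sum:
  assumes "finite J" "\<And>j. j \<in> J \<Longrightarrow> cyl_sq (f j)" shows "cyl_sq (\<lambda>z. \<Sum>j\<in>J. f j z)"
  using assms
proof (induction rule: finite_induct)
  case empty
  show ?case by (simp add: cyl_sq_def)
next
  case (insert j J)
  have "cyl_sq (\<lambda>z. f j z + (\<Sum>j\<in>J. f j z))"
    using insert.prems insert.IH by (intro cyl_sq_add) auto
  then show ?case using insert.hyps by simp
qed

lemma AE_lebesgue_on_half_space:
  fixes P :: "real \<times> (real ^ 'd) \<Rightarrow> bool"
  assumes "AE z in lebesgue_on half_space. P z"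
  shows "AE z in lborel. z \<in> cyl_domain \<longrightarrow> P z"
proof -
  have "open (half_space :: (real \<times> (real^'d)) set)" unfolding half_space_def by (intro open_Times) auto
  then have "half_space \<in> sets (lebesgue :: (real \<times> (real^'d)) measure)" by auto
  then have "AE z in lebesgue. z \<in> half_space \<longrightarrow> P z"
    using assms by (subst (asm) AE_restrict_space_iff) auto
  then have "AE z in lborel. z \<in> half_space \<longrightarrow> P z" by (simp add: AE_completion_iff)
  then show ?thesis by eventually_elim (auto simp: half_space_def cyl_domain_def)
qed

section \<open>From the Sobolev function to the weak system, and the conclusion\<close>

text \<open>Two kinds of representatives are combined. \<open>f\<close> is built from the chosen
  \<open>weak_deriv\<close>, because the differential inequality speaks about it; its square
  integrability is deduced from |f| \<le> C |u|. \<open>u1\<close> and \<open>Y\<close> come from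
  the square integrable weak derivatives that membership in the Sobolev space provides. No
  uniqueness of weak derivatives is invoked: both kinds satisfy the same tested identities.\<close>

lemma sobolev_reduction:
  fixes u :: "real \<times> (real ^ 'd) \<Rightarrow> complex" and C :: real
  assumes u: "u \<in> sobolev_W2 2"
    and lap: "AE z in lebesgue_on half_space. norm (laplacian u z) \<le> C * norm (u z)"
  obtains u0 u1 f Y where "borel_rep u u0" "cyl_sq u0" "cyl_sq u1" "cyl_sq f" "cyl_sq Y"
    "AE z in lborel. norm (f z) \<le> C * norm (u0 z)"
    and "weak_system u0 u1 f Y"
proof -
  have uL: "cyl_L2 u" using u by (simp add: sobolev_W2_def)
  obtain u0 where u0: "borel_rep u u0" using borel_rep_exists uL unfolding cyl_L2_def by blast
  have su0: "cyl_sq u0" by (rule borel_rep_cyl_sq[OF u0 uL])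
  have wd_ex: "\<exists>v. cyl_L2 v \<and> has_weak_deriv bs u v" if "set bs \<subseteq> Basis" "length bs \<le> 2" for bs
    using u that by (simp add: sobolev_W2_def)
  have rep_L2: "\<exists>v v0. has_weak_deriv bs u v \<and> borel_rep v v0 \<and> cyl_sq v0" if bs: "set bs \<subseteq> Basis" "length bs \<le> 2" for bs
  proof -
    obtain v where v: "cyl_L2 v" "has_weak_deriv bs u v" using wd_ex[OF bs] by blast
    obtain v0 where v0: "borel_rep v v0" using borel_rep_exists v(1) unfolding cyl_L2_def by blast
    show ?thesis using v v0 borel_rep_cyl_sq[OF v0 v(1)] by blast
  qed
  have wd: "has_weak_deriv bs u (weak_deriv bs u)" if bs: "set bs \<subseteq> Basis" "length bs \<le> 2" for bs
    unfolding weak_deriv_def using wd_ex[OF bs] by (metis someI_ex)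
  have rep_wd: "\<exists>v0. borel_rep (weak_deriv bs u) v0" if bs: "set bs \<subseteq> Basis" "length bs \<le> 2" for bs
    using wd[OF bs] cyl_loc_integrable_measurable borel_rep_exists unfolding has_weak_deriv_def by metis
  obtain v1 u1 where u1: "has_weak_deriv [dir_w] u v1" "borel_rep v1 u1" "cyl_sq u1"
    using rep_L2[of "[dir_w]"] dir_in_Basis by auto
  have "\<exists>v v0. has_weak_deriv [dir_y j, dir_y j] u v \<and> borel_rep v v0 \<and> cyl_sq v0" for j
    using rep_L2[of "[dir_y j, dir_y j]"] dir_in_Basis by auto
  then obtain vy Yj where Yj: "\<And>j. has_weak_deriv [dir_y j, dir_y j] u (vy j)" "\<And>j. borel_rep (vy j) (Yj j)" "\<And>j. cyl_sq (Yj j)"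
    by metis
  define Y where "Y z = (\<Sum>j\<in>UNIV. Yj j z)" for z
  have sY: "cyl_sq Y" unfolding Y_def by (intro cyl_sq_sum Yj) auto
  have bw: "set [dir_w, dir_w] \<subseteq> Basis" "length [dir_w, dir_w] \<le> 2"
    and by2: "set [dir_y j, dir_y j] \<subseteq> Basis" "length [dir_y j, dir_y j] \<le> 2" for j :: 'd
    using dir_in_Basis by auto
  obtain fw where fw: "borel_rep (weak_deriv [dir_w, dir_w] u) fw" using rep_wd[OF bw] by blast
  obtain fy where fy: "\<And>j. borel_rep (weak_deriv [dir_y j, dir_y j] u) (fy j)" using rep_wd[OF by2] by metis
  define f where "f z = fw z + (\<Sum>j\<in>UNIV. fy j z)" for z
  have [measurable]: "fw \<in> borel_measurable borel" "fy j \<in> borel_measurable borel" "u0 \<in> borel_measurable borel" for j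
    using fw fy u0 by (auto simp: borel_rep_def)
  have fm: "f \<in> borel_measurable borel" unfolding f_def by measurable
  have f0: "f z = 0" if "z \<notin> cyl_domain" for z
  proof -
    have "fw z = 0" "fy j z = 0" for j using fw fy that unfolding borel_rep_def by blast+
    then show ?thesis by (simp add: f_def)
  qed
  have fyae: "AE z in lborel. \<forall>j\<in>UNIV. z \<in> cyl_domain \<longrightarrow> weak_deriv [dir_y j, dir_y j] u z = fy j z"
    using fy unfolding borel_rep_def by (subst AE_finite_all) auto
  have fwae: "AE z in lborel. z \<in> cyl_domain \<longrightarrow> weak_deriv [dir_w, dir_w] u z = fw z"
    using fw by (simp add: borel_rep_def)
  have uae: "AE z in lborel. z \<in> cyl_domain \<longrightarrow> u z = u0 z"
    using u0 by (simp add: borel_rep_def)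
  have fu: "AE z in lborel. norm (f z) \<le> C * norm (u0 z)"
    using fyae fwae uae AE_lebesgue_on_half_space[OF lap]
  proof eventually_elim
    case (elim z)
    show ?case
    proof (cases "z \<in> cyl_domain")
      case True
      then have "laplacian u z = f z" "u z = u0 z" using elim by (simp_all add: laplacian_def f_def)
      then show ?thesis using elim True by simp
    next
      case False
      then have "u0 z = 0" using u0 unfolding borel_rep_def by blast
      then show ?thesis using f0[OF False] by simp
    qed
  qed
  have sf: "cyl_sq f"
    unfolding cyl_sq_def
  proof (intro conjI allI impI)
    show "integrable lborel (\<lambda>z. (norm (f z))\<^sup>2)"
    proof (rule Bochner_Integration.integrable_bound)
      show "integrable lborel (\<lambda>z. C\<^sup>2 * (norm (u0 z))\<^sup>2)" using su0 by (simp add: cyl_sq_def)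
      show "AE z in lborel. norm ((norm (f z))\<^sup>2) \<le> norm (C\<^sup>2 * (norm (u0 z))\<^sup>2)"
        using fu
      proof eventually_elim
        case (elim z)
        then have "(norm (f z))\<^sup>2 \<le> (C * norm (u0 z))\<^sup>2" by (intro power_mono) auto
        then show ?case by (simp add: power_mult_distrib)
      qed
    qed (use fm in measurable)
  qed (use fm f0 in auto)
  have H1: "(LINT z|lborel. u0 z * tensor_test D 1 k z) =
      - (LINT z|lborel. u1 z * tensor_test D 0 k z)" if D: "test_seq 0 D" for D and k :: "int^'d"
  proof -
    have "iter_partial [dir_w] (\<lambda>z. tensor_test D 0 k z) = (\<lambda>z. 1 * tensor_test D 1 k z)"
      unfolding iter_partial_w[OF test_seq_smooth[OF D]] by simp
    from weak_deriv_test[OF u1(1) u0 u1(2) D this] show ?thesis by simp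
  qed
  have Hyy: "- of_real ((of_int (k $ j))\<^sup>2) * (LINT z|lborel. u0 z * tensor_test D 0 k z) =
      (LINT z|lborel. v0 z * tensor_test D 0 k z)"
    if D: "test_seq 0 D" and v: "has_weak_deriv [dir_y j, dir_y j] u v" "borel_rep v v0" for D and k :: "int^'d" and j v v0
    using weak_deriv_test[OF v(1) u0 v(2) D iter_partial_yy[OF test_seq_smooth[OF D]]] by simp
  have lam: "(\<Sum>j\<in>UNIV. - of_real ((of_int (k $ j))\<^sup>2) * x) = - (of_real (freq_sq k) * x)" for k :: "int^'d" and x :: complex
    by (simp add: freq_sq_def sum_negf sum_distrib_right)
  have H3: "of_real (freq_sq k) * (LINT z|lborel. u0 z * tensor_test D 0 k z) =
      - (LINT z|lborel. Y z * tensor_test D 0 k z)" if D: "test_seq 0 D" for D and k :: "int^'d"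
  proof -
    have "(LINT z|lborel. Y z * tensor_test D 0 k z) = (LINT z|lborel. (\<Sum>j\<in>UNIV. Yj j z * tensor_test D 0 k z))"
      by (simp only: Y_def sum_distrib_right)
    also have "\<dots> = (\<Sum>j\<in>UNIV. (LINT z|lborel. Yj j z * tensor_test D 0 k z))"
      by (intro Bochner_Integration.integral_sum cyl_sq_test_integral(1) Yj D)
    also have "\<dots> = - (of_real (freq_sq k) * (LINT z|lborel. u0 z * tensor_test D 0 k z))"
      unfolding Hyy[OF D Yj(1,2), symmetric] by (rule lam)
    finally show ?thesis by simp
  qed
  have H2: "(LINT z|lborel. u0 z * tensor_test D 2 k z) =
      of_real (freq_sq k) * (LINT z|lborel. u0 z * tensor_test D 0 k z) +
      (LINT z|lborel. f z * tensor_test D 0 k z)" if D: "test_seq 0 D" for D and k :: "int^'d"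
  proof -
    let ?e = "\<lambda>z. tensor_test D 0 k z"
    have locw: "cyl_loc_integrable (weak_deriv [dir_w, dir_w] u)"
      using wd[OF bw] by (simp add: has_weak_deriv_def)
    have locy: "cyl_loc_integrable (weak_deriv [dir_y j, dir_y j] u)" for j
      using wd[OF by2[of j]] by (simp add: has_weak_deriv_def)
    have iw: "integrable lborel (\<lambda>z. fw z * ?e z)" by (rule borel_rep_test_integrable[OF fw locw D])
    have iy: "integrable lborel (\<lambda>z. fy j z * ?e z)" for j by (rule borel_rep_test_integrable[OF fy locy D])
    have "iter_partial [dir_w, dir_w] ?e = (\<lambda>z. 1 * tensor_test D 2 k z)"
      unfolding iter_partial_ww[OF test_seq_smooth[OF D]] by (simp add: numeral_2_eq_2)
    from weak_deriv_test[OF wd[OF bw] u0 fw D this]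
    have w: "(LINT z|lborel. u0 z * tensor_test D 2 k z) = (LINT z|lborel. fw z * ?e z)" by simp
    have "(LINT z|lborel. f z * ?e z) = (LINT z|lborel. fw z * ?e z + (\<Sum>j\<in>UNIV. fy j z * ?e z))"
      by (simp only: f_def distrib_right sum_distrib_right)
    also have "\<dots> = (LINT z|lborel. fw z * ?e z) + (LINT z|lborel. (\<Sum>j\<in>UNIV. fy j z * ?e z))"
      by (intro Bochner_Integration.integral_add Bochner_Integration.integrable_sum iw iy)
    also have "(LINT z|lborel. (\<Sum>j\<in>UNIV. fy j z * ?e z)) = (\<Sum>j\<in>UNIV. LINT z|lborel. fy j z * ?e z)"
      by (intro Bochner_Integration.integral_sum iy)
    also have "\<dots> = - (of_real (freq_sq k) * (LINT z|lborel. u0 z * ?e z))"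
      unfolding Hyy[OF D wd[OF by2] fy, symmetric] by (rule lam)
    finally show ?thesis using w by simp
  qed
  have "weak_system u0 u1 f Y"
    unfolding weak_system_def by (intro allI impI conjI H1 H2 H3)
  then show ?thesis by (rule that[OF u0 su0 u1(3) sf sY fu])
qed

lemma cyl_bigo_decay:
  fixes u :: "real \<times> (real ^ 'd) \<Rightarrow> complex"
  assumes O: "cyl_bigo u (\<lambda>w. exp (- N * \<theta> w))" and rep: "borel_rep u u0"
  obtains K w0 where "AE z in lborel. w0 \<le> fst z \<longrightarrow> norm (u0 z) \<le> K * exp (- N * \<theta> (fst z))"
proof -
  obtain K w0 where K: "AE z in lebesgue_on half_space. w0 \<le> fst z \<longrightarrow> norm (u z) \<le> K * \<bar>exp (- N * \<theta> (fst z))\<bar>"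
    using O unfolding cyl_bigo_def by blast
  have "AE z in lborel. z \<in> cyl_domain \<longrightarrow> u z = u0 z"
    using rep by (simp add: borel_rep_def)
  with AE_lebesgue_on_half_space[OF K]
  have "AE z in lborel. w0 \<le> fst z \<longrightarrow> norm (u0 z) \<le> \<bar>K\<bar> * exp (- N * \<theta> (fst z))"
  proof eventually_elim
    case (elim z)
    show ?case
    proof (cases "z \<in> cyl_domain")
      case True
      have "K * exp (- N * \<theta> (fst z)) \<le> \<bar>K\<bar> * exp (- N * \<theta> (fst z))" by (intro mult_right_mono) auto
      moreover have "w0 \<le> fst z \<longrightarrow> norm (u0 z) \<le> K * exp (- N * \<theta> (fst z))"
        using True elim by simp
      ultimately show ?thesis using order_trans by blast
    next
      case False
      then have "u0 z = 0" using rep unfolding borel_rep_def by blast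
      then show ?thesis by simp
    qed
  qed
  then show ?thesis by (rule that)
qed

text \<open>Separates the functional analysis from the two concrete choices of \<theta>, which have
  to supply the symbol bound and elementary growth comparisons only.\<close>

lemma uniqueness_of_decay:
  fixes u :: "real \<times> (real ^ 'd) \<Rightarrow> complex" and C :: real and \<theta> \<theta>1 \<theta>2 :: "real \<Rightarrow> real"
  assumes u: "u \<in> sobolev_W2 2"
    and lap: "AE z in lebesgue_on half_space. norm (laplacian u z) \<le> C * norm (u z)"
    and decay: "\<And>N. 0 < N \<Longrightarrow> cyl_bigo u (\<lambda>w. exp (- N * \<theta> w))"
    and weights: "\<And>a T. 0 < a \<Longrightarrow> \<exists>\<tau>\<ge>T. 0 < \<tau> \<and> weight a (\<lambda>w. \<tau> * \<theta> w) (\<lambda>w. \<tau> * \<theta>1 w) (\<lambda>w. \<tau> * \<theta>2 w) \<and>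
      (\<forall>k::int^'d. \<forall>w\<ge>a. C\<^sup>2 + 1 \<le> (\<tau> * \<theta>1 w + sqrt (freq_sq k))\<^sup>2 * (\<tau> * \<theta>1 w - sqrt (freq_sq k))\<^sup>2 +
        \<tau> * \<theta>2 w * (\<tau> * \<theta>1 w + sqrt (freq_sq k)) * (3 * (\<tau> * \<theta>1 w) - sqrt (freq_sq k)))"
    and mono: "\<And>x y. 0 < x \<Longrightarrow> x < y \<Longrightarrow> \<theta> x < \<theta> y"
    and cont: "continuous_on {0<..} \<theta>" "continuous_on {0<..} \<theta>1" "\<And>w. 0 < w \<Longrightarrow> 0 \<le> \<theta>1 w"
    and ev0: "eventually (\<lambda>w. exp w * exp (- (4 * \<theta> w)) \<le> exp (- w)) at_top"
    and ev: "\<And>\<tau> \<mu> n. 0 < \<tau> \<Longrightarrow> 0 \<le> \<mu> \<Longrightarrow> eventually (\<lambda>w. (\<tau> * \<theta>1 w + \<mu>) ^ n * exp (- (2 * \<theta> w)) \<le> exp (- w)) at_top"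
  shows "AE z in lebesgue_on half_space. u z = 0"
proof -
  obtain u0 u1 f Y where u0: "borel_rep u u0" "cyl_sq u0" and s: "cyl_sq u1" "cyl_sq f" "cyl_sq Y"
    and fu: "AE z in lborel. norm (f z) \<le> C * norm (u0 z)"
    and sys: "weak_system u0 u1 f Y"
    by (rule sobolev_reduction[OF u lap])
  have fin: "(\<integral>\<^sup>+w. indicator {a..} w * (ennreal ((\<tau> * \<theta>1 w + \<mu>) ^ n * exp (2 * (\<tau> * \<theta> w))) * slice_sq u0 w) \<partial>lborel) < \<infinity>"
    if a: "0 < a" and \<tau>: "0 < \<tau>" and \<mu>: "0 \<le> \<mu>" for a \<tau> \<mu> n
  proof -
    \<comment> \<open>Decay at rate \<tau> + 1 beats the weight exp(2 \<tau> \<theta>) and leaves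
      exp(-2 \<theta>) to absorb the polynomial factor in \<open>\<theta>1\<close>; this is the left
      side of \<open>ev\<close>.\<close>
    have "0 < \<tau> + 1" using \<tau> by simp
    then obtain K w0 where dec: "AE z in lborel. w0 \<le> fst z \<longrightarrow> norm (u0 z) \<le> K * exp (- (\<tau> + 1) * \<theta> (fst z))"
      using cyl_bigo_decay[OF decay u0(1)] by blast
    have sub: "{a..} \<subseteq> {0<..}" using a by auto
    show ?thesis
    proof (rule weighted_slice_integral_finite[OF u0(2) dec])
      show "continuous_on {a..} (\<lambda>w. (\<tau> * \<theta>1 w + \<mu>) ^ n * exp (2 * (\<tau> * \<theta> w)))"
        by (intro continuous_intros continuous_on_subset[OF cont(1) sub] continuous_on_subset[OF cont(2) sub])
      show "0 \<le> (\<tau> * \<theta>1 w + \<mu>) ^ n * exp (2 * (\<tau> * \<theta> w))" if "a \<le> w" for w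
        using that a \<tau> \<mu> cont(3)[of w] by simp
      have "(\<tau> * \<theta>1 w + \<mu>) ^ n * exp (2 * (\<tau> * \<theta> w)) * exp (- (2 * (\<tau> + 1) * \<theta> w)) = (\<tau> * \<theta>1 w + \<mu>) ^ n * exp (- (2 * \<theta> w))" for w
        unfolding mult.assoc exp_add[symmetric] by (simp add: algebra_simps)
      then show "eventually (\<lambda>w. (\<tau> * \<theta>1 w + \<mu>) ^ n * exp (2 * (\<tau> * \<theta> w)) * exp (- (2 * (\<tau> + 1) * \<theta> w)) \<le> exp (- w)) at_top"
        using ev[OF \<tau> \<mu>, of n] by (simp only:)
    qed
  qed
  have fi: "integrable lborel f"
  proof (rule integrable_of_decay[OF u0(2) s(2) fu])
    \<comment> \<open>Rate 2 turns the decay of |u|^2 into exp(-4 \<theta>), which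
      \<open>ev0\<close> compares with the weight exp(w) used for integrability of f.\<close>
    obtain K w0 where dec: "AE z in lborel. w0 \<le> fst z \<longrightarrow> norm (u0 z) \<le> K * exp (- 2 * \<theta> (fst z))"
      by (rule cyl_bigo_decay[OF decay[of 2] u0(1)]) simp
    show "(\<integral>\<^sup>+w. indicator {0..} w * (ennreal (exp w) * slice_sq u0 w) \<partial>lborel) < \<infinity>"
      by (rule weighted_slice_integral_finite[OF u0(2), where N=2]) (use dec ev0 in \<open>auto intro!: continuous_intros\<close>)
  qed
  have "AE z in lborel. u0 z = 0"
  proof (rule uniqueness_of_weights[OF u0(2) s fi sys fu weights _ _ mono])
    show "(\<integral>\<^sup>+w. indicator {a..} w * (ennreal (exp (2 * (\<tau> * \<theta> w))) * slice_sq u0 w) \<partial>lborel) < \<infinity>" if "0 < a" "0 < \<tau>" for a \<tau>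
      using fin[OF that order_refl, of 0] by simp
    show "(\<integral>\<^sup>+w. indicator {a..} w * (ennreal ((\<tau> * \<theta>1 w + \<mu>) ^ 3 * exp (2 * (\<tau> * \<theta> w))) * slice_sq u0 w) \<partial>lborel) < \<infinity>"
      if "0 < a" "0 < \<tau>" "0 \<le> \<mu>" for a \<tau> \<mu>
      by (rule fin[OF that])
  qed
  then show ?thesis
    using u u0(1) by (intro AE_half_space_of_cell) (auto simp: sobolev_W2_def cyl_L2_def)
qed

theorem theorem0p5:
  fixes u :: "real \<times> (real ^ 'd) \<Rightarrow> complex" and C :: real
  assumes "u \<in> sobolev_W2 2"
    and "AE z in lebesgue_on half_space. norm (laplacian u z) \<le> C * norm (u z)"
  shows "((\<forall>N>0. cyl_bigo u (\<lambda>w. exp (- N * w powr (4 / 3)))) \<longrightarrow>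
            (AE z in lebesgue_on half_space. u z = 0)) \<and>
         (CARD('d) = 1 \<or> CARD('d) = 2 \<longrightarrow>
          (\<forall>N>0. cyl_bigo u (\<lambda>w. exp (- N * w))) \<longrightarrow>
            (AE z in lebesgue_on half_space. u z = 0))"
proof (intro conjI impI)
  assume decay: "\<forall>N>0. cyl_bigo u (\<lambda>w. exp (- N * w powr (4 / 3)))"
  show "AE z in lebesgue_on half_space. u z = 0"
  proof (rule uniqueness_of_decay[OF assms, where \<theta> = "\<lambda>w. w powr (4/3)" and ?\<theta>1.0 = "\<lambda>w. 4/3 * w powr (1/3)" and ?\<theta>2.0 = "\<lambda>w. 4/9 * w powr (-2/3)"])
    show "cyl_bigo u (\<lambda>w. exp (- N * w powr (4 / 3)))" if "0 < N" for N using decay that by blast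
    show "\<exists>\<tau>\<ge>T. 0 < \<tau> \<and> weight a (\<lambda>w. \<tau> * w powr (4/3)) (\<lambda>w. \<tau> * (4/3 * w powr (1/3))) (\<lambda>w. \<tau> * (4/9 * w powr (-2/3))) \<and>
      (\<forall>k::int^'d. \<forall>w\<ge>a. C\<^sup>2 + 1 \<le> (\<tau> * (4/3 * w powr (1/3)) + sqrt (freq_sq k))\<^sup>2 * (\<tau> * (4/3 * w powr (1/3)) - sqrt (freq_sq k))\<^sup>2 +
        \<tau> * (4/9 * w powr (-2/3)) * (\<tau> * (4/3 * w powr (1/3)) + sqrt (freq_sq k)) * (3 * (\<tau> * (4/3 * w powr (1/3))) - sqrt (freq_sq k)))"
      if "0 < a" for a T
    proof -
      have "0 \<le> C\<^sup>2 + 1" by simp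
      from symbol_bound_four_thirds[OF that this, of T] show ?thesis
        using real_sqrt_ge_zero[OF freq_sq_nonneg] by blast
    qed
    show "x powr (4/3) < y powr (4/3)" if "0 < x" "x < y" for x y :: real using that by (intro powr_less_mono2) auto
    show "eventually (\<lambda>w. (\<tau> * (4/3 * w powr (1/3)) + \<mu>) ^ n * exp (- (2 * w powr (4/3))) \<le> exp (- w)) at_top" if "0 < \<tau>" "0 \<le> \<mu>" for \<tau> \<mu> :: real and n
    proof -
      \<comment> \<open>Replacing the base by w removes \<tau> and \<mu> from the comparison. One
        factor exp(-w) then absorbs w^n and the other is the bound required.\<close>
      have l: "eventually (\<lambda>w::real. \<tau> * (4/3 * w powr (1/3)) + \<mu> \<le> w) at_top" by real_asymp
      have "eventually (\<lambda>w::real. w ^ n * exp (- w) \<le> 1) at_top"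
      proof -
        have "eventually (\<lambda>w::real. w ^ n / exp w < 1) at_top"
          using tendsto_power_div_exp_0[of n] by (rule order_tendstoD) simp
        then show ?thesis by eventually_elim (simp add: exp_minus field_simps)
      qed
      moreover have "eventually (\<lambda>w::real. exp (- (2 * w powr (4/3))) \<le> exp (- w) * exp (- w)) at_top" by real_asymp
      ultimately show ?thesis using l eventually_gt_at_top[of 0]
      proof eventually_elim
        case (elim w)
        have "(\<tau> * (4/3 * w powr (1/3)) + \<mu>) ^ n * exp (- (2 * w powr (4/3))) \<le> w ^ n * (exp (- w) * exp (- w))"
          using elim that by (intro mult_mono power_mono) auto
        also have "\<dots> = (w ^ n * exp (- w)) * exp (- w)" by simp
        also have "\<dots> \<le> 1 * exp (- w)" using elim by (intro mult_right_mono) auto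
        finally show ?case by simp
      qed
    qed
    show "eventually (\<lambda>w::real. exp w * exp (- (4 * w powr (4/3))) \<le> exp (- w)) at_top" by real_asymp
  qed (auto intro!: continuous_intros)
next
  assume d: "CARD('d) = 1 \<or> CARD('d) = 2" and decay: "\<forall>N>0. cyl_bigo u (\<lambda>w. exp (- N * w))"
  show "AE z in lebesgue_on half_space. u z = 0"
  proof (rule uniqueness_of_decay[OF assms, where \<theta> = "\<lambda>w. w" and ?\<theta>1.0 = "\<lambda>w. 1" and ?\<theta>2.0 = "\<lambda>w. 0"])
    show "cyl_bigo u (\<lambda>w. exp (- N * w))" if "0 < N" for N using decay that by blast
    show "\<exists>\<tau>\<ge>T. 0 < \<tau> \<and> weight a (\<lambda>w. \<tau> * w) (\<lambda>w. \<tau> * 1) (\<lambda>w. \<tau> * 0) \<and>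
      (\<forall>k::int^'d. \<forall>w\<ge>a. C\<^sup>2 + 1 \<le> (\<tau> * 1 + sqrt (freq_sq k))\<^sup>2 * (\<tau> * 1 - sqrt (freq_sq k))\<^sup>2 +
        \<tau> * 0 * (\<tau> * 1 + sqrt (freq_sq k)) * (3 * (\<tau> * 1) - sqrt (freq_sq k)))"
      for a T by (rule symbol_bound_linear[OF d])
    show "eventually (\<lambda>w. (\<tau> * 1 + \<mu>) ^ n * exp (- (2 * w)) \<le> exp (- w)) at_top" if "0 < \<tau>" "0 \<le> \<mu>" for \<tau> \<mu> :: real and n
    proof -
      define c where "c = (\<tau> * 1 + \<mu>) ^ n"
      have "0 < c" using that by (simp add: c_def)
      then show ?thesis unfolding c_def[symmetric] by real_asymp
    qed
    show "eventually (\<lambda>w::real. exp w * exp (- (4 * w)) \<le> exp (- w)) at_top" by real_asymp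
  qed (auto intro!: continuous_intros)
qed

end
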